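(* Consider a (static or dynamic) sequential team that admits an independent-measurements reduction with reduced cost $c_s(\omega_0,\mathbf{y},\mathbf{u})$ continuous only in $\mathbf{u}=(u^1,\dots,u^N)$ for every fixed $\omega_0,\mathbf{y}=(y^1,\dots,y^N)$. Suppose further that each $\mathbb{U}^i$ is $\sigma$-compact, that is, $\mathbb{U}^i=\bigcup_n K^i_n$ for a countable collection of increasing compact sets $K^i_n$, and that without any loss the control laws can be restricted to those with $E[\phi^i(u^i)]\le M$, $i=1,\dots,N$, for some finite $M$ and some lower semi-continuous $\phi^i:\mathbb{U}^i\to\mathbb{R}_+$ satisfying $\lim_{n\to\infty}\inf_{u^i\notin K^i_n}\phi^i(u^i)=\infty$. Then an optimal team policy exists.
   Context: Sequential team: there are $N$ decision makers (DMs) acting in the order $1,\dots,N$. $\Omega_0$, the measurement spaces $\mathbb{Y}^t$ and the action spaces $\mathbb{U}^t$ are standard Borel. A random variable $\omega_0\in\Omega_0$ has a given law $P(d\omega_0)$, and for each $t$ the measurement $y^t\in\mathbb{Y}^t$ is generated from $(\omega_0,y^1,\dots,y^{t-1},u^1,\dots,u^{t-1})$ by a given stochastic kernel $P(dy^t\mid\omega_0,y^1,\dots,y^{t-1},u^1,\dots,u^{t-1})$; the team is static if measurements are not affected by actions, and dynamic otherwise. DM $t$ observes only $y^t$ and applies $u^t=\gamma^t(y^t)$, where $\gamma^t\in\Gamma^t$, the set of measurable maps $\mathbb{Y}^t\to\mathbb{U}^t$; a team policy is $\underline\gamma=(\gamma^1,\dots,\gamma^N)$. The cost is $J(\underline\gamma)=E^{\underline\gamma}[c(\omega_0,u^1,\dots,u^N)]$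 with $c\ge0$ measurable; $\underline\gamma^*$ is an optimal team policy if $J(\underline\gamma^* )=\inf_{\underline\gamma}J(\underline\gamma)$. Independent-measurements reduction: the team admits such a reduction if for every $t$ there are a reference probability measure $Q_t$ on $\mathbb{Y}^t$ and a nonnegative measurable function $f_t$ such that for all Borel $S\subset\mathbb{Y}^t$ $$P(y^t\in S\mid\omega_0,u^1,\dots,u^{t-1},y^1,\dots,y^{t-1})=\int_S f_t(y^t,\omega_0,u^1,\dots,u^{t-1},y^1,\dots,y^{t-1})\,Q_t(dy^t).$$ The reduced cost is the (measurable) function $$c_s(\omega_0,\mathbf{y},\mathbf{u})=c(\omega_0,\mathbf{u})\prod_{t=1}^N f_t(y^t,\omega_0,u^1,\dots,u^{t-1},y^1,\dots,y^{t-1}),$$ so that $J(\underline\gamma)=\int P(d\omega_0)\prod_{t=1}^N Q_t(dy^t)\,c_s(\omega_0,\mathbf{y},\gamma^1(y^1),\dots,\gamma^N(y^N))$. Moment restriction: the expectation $E[\phi^i(u^i)]$ is taken in the reduced form, i.e. $E[\phi^i(u^i)]=\int\phi^i(\gamma^i(y^i))\,Q_i(dy^i)$; "without any loss" means that the infimum of $J$ over team policies satisfying $E[\phi^i(u^i)]\le M$ for all $i$ equals the infimum of $J$ over all team policies. *)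

theory Defs
  imports "HOL-Probability.Probability"
begin

text \<open>
  The $N$ decision makers are indexed by \<open>{1..N}\<close>.  Spaces that depend on the decision maker are
  carried by families \<open>Y t\<close> of measurable spaces over one type \<open>'y\<close> and \<open>U t\<close> of topologies over
  one type \<open>'u\<close>; since carriers are explicit, this allows arbitrary different spaces.  Families
  \<open>(y\<^sup>1, \<dots>, y\<^sup>t)\<close> are extensional functions on \<open>{1..t}\<close>, as in \<open>Pi\<^sub>M\<close>.
\<close>

section \<open>Topological and measurable notions\<close>

definition borel_of_top :: "'a topology \<Rightarrow> 'a measure" where
  "borel_of_top X = sigma (topspace X) {V. openin X V}"

text \<open>A standard Borel space is a Borel subset of a complete separable metric space.\<close>

definition standard_borel_top :: "'a topology \<Rightarrow> bool" where
  "standard_borel_top T \<longleftrightarrow>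
     (\<exists>X B. completely_metrizable_space X \<and> separable_space X \<and>
            B \<in> sets (borel_of_top X) \<and> T = subtopology X B)"

text \<open>
  The version for measurable spaces; only the \<open>\<sigma>\<close>-algebra of the argument matters.
\<close>

definition standard_borel :: "'a measure \<Rightarrow> bool" where
  "standard_borel M \<longleftrightarrow> (\<exists>T. standard_borel_top T \<and> sets M = sets (borel_of_top T))"

definition lower_semicontinuous_on_top :: "'a topology \<Rightarrow> ('a \<Rightarrow> real) \<Rightarrow> bool" where
  "lower_semicontinuous_on_top X g \<longleftrightarrow> (\<forall>a. openin X {x \<in> topspace X. a < g x})"

section \<open>Sequential teams\<close>

text \<open>
  Information preceding the measurement of decision maker \<open>t\<close>: the triple
  \<open>(\<omega>\<^sub>0, (y\<^sup>1,\<dots>,y\<^sup>t\<^sup>-\<^sup>1), (u\<^sup>1,\<dots>,u\<^sup>t\<^sup>-\<^sup>1))\<close>.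
\<close>

type_synonym ('w, 'y, 'u) history = "'w \<times> (nat \<Rightarrow> 'y) \<times> (nat \<Rightarrow> 'u)"

definition history_space ::
  "'w measure \<Rightarrow> (nat \<Rightarrow> 'y measure) \<Rightarrow> (nat \<Rightarrow> 'u topology) \<Rightarrow> nat \<Rightarrow> ('w, 'y, 'u) history measure"
  where
  "history_space P Y U t =
     P \<Otimes>\<^sub>M (Pi\<^sub>M {1..<t} Y \<Otimes>\<^sub>M Pi\<^sub>M {1..<t} (\<lambda>s. borel_of_top (U s)))"

text \<open>
  \<open>P\<close> is the law of \<open>\<omega>\<^sub>0\<close> and \<open>K t\<close> the stochastic kernel generating \<open>y\<^sup>t\<close>.  The condition that the
  action spaces are nonempty ensures that team policies exist.
\<close>

definition sequential_team ::
  "nat \<Rightarrow> 'w measure \<Rightarrow> (nat \<Rightarrow> 'y measure) \<Rightarrow> (nat \<Rightarrow> 'u topology) \<Rightarrow>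
   (nat \<Rightarrow> ('w, 'y, 'u) history \<Rightarrow> 'y measure) \<Rightarrow> ('w \<Rightarrow> (nat \<Rightarrow> 'u) \<Rightarrow> real) \<Rightarrow> bool" where
  "sequential_team N P Y U K c \<longleftrightarrow>
     prob_space P \<and> standard_borel P \<and>
     (\<forall>t\<in>{1..N}. standard_borel (Y t)) \<and>
     (\<forall>t\<in>{1..N}. standard_borel_top (U t) \<and> topspace (U t) \<noteq> {}) \<and>
     (\<forall>t\<in>{1..N}. K t \<in> measurable (history_space P Y U t) (prob_algebra (Y t))) \<and>
     (\<lambda>(w, u). c w u) \<in> borel_measurable (P \<Otimes>\<^sub>M Pi\<^sub>M {1..N} (\<lambda>t. borel_of_top (U t))) \<and>
     (\<forall>w\<in>space P. \<forall>u\<in>(\<Pi>\<^sub>E t\<in>{1..N}. topspace (U t)). 0 \<le> c w u)"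

text \<open>Values of a policy at indices outside \<open>{1..N}\<close> are irrelevant.\<close>

definition team_policies ::
  "nat \<Rightarrow> (nat \<Rightarrow> 'y measure) \<Rightarrow> (nat \<Rightarrow> 'u topology) \<Rightarrow> (nat \<Rightarrow> 'y \<Rightarrow> 'u) set" where
  "team_policies N Y U = (\<Pi> t\<in>{1..N}. measurable (Y t) (borel_of_top (U t)))"

definition actions :: "nat \<Rightarrow> (nat \<Rightarrow> 'y \<Rightarrow> 'u) \<Rightarrow> (nat \<Rightarrow> 'y) \<Rightarrow> nat \<Rightarrow> 'u" where
  "actions n \<gamma> y = (\<lambda>t\<in>{1..n}. \<gamma> t (y t))"

text \<open>
  The joint law of \<open>(\<omega>\<^sub>0, y\<^sup>1, \<dots>, y\<^sup>n)\<close> under the policy \<open>\<gamma>\<close>, obtained by successively drawing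
  \<open>y\<^sup>t\<close> from \<open>K t\<close> while applying \<open>u\<^sup>t = \<gamma>\<^sup>t (y\<^sup>t)\<close>.
\<close>

primrec team_law ::
  "'w measure \<Rightarrow> (nat \<Rightarrow> 'y measure) \<Rightarrow> (nat \<Rightarrow> ('w, 'y, 'u) history \<Rightarrow> 'y measure) \<Rightarrow>
   (nat \<Rightarrow> 'y \<Rightarrow> 'u) \<Rightarrow> nat \<Rightarrow> ('w \<times> (nat \<Rightarrow> 'y)) measure" where
  "team_law P Y K \<gamma> 0 = distr P (P \<Otimes>\<^sub>M Pi\<^sub>M {1..0} Y) (\<lambda>w. (w, \<lambda>_. undefined))"
| "team_law P Y K \<gamma> (Suc n) =
     bind (team_law P Y K \<gamma> n)
       (\<lambda>(w, y). distr (K (Suc n) (w, y, actions n \<gamma> y)) (P \<Otimes>\<^sub>M Pi\<^sub>M {1..Suc n} Y)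
                   (\<lambda>z. (w, y(Suc n := z))))"

definition team_cost ::
  "nat \<Rightarrow> 'w measure \<Rightarrow> (nat \<Rightarrow> 'y measure) \<Rightarrow> (nat \<Rightarrow> ('w, 'y, 'u) history \<Rightarrow> 'y measure) \<Rightarrow>
   ('w \<Rightarrow> (nat \<Rightarrow> 'u) \<Rightarrow> real) \<Rightarrow> (nat \<Rightarrow> 'y \<Rightarrow> 'u) \<Rightarrow> ennreal" where
  "team_cost N P Y K c \<gamma> = (\<integral>\<^sup>+ (w, y). ennreal (c w (actions N \<gamma> y)) \<partial>team_law P Y K \<gamma> N)"

definition optimal_policy ::
  "nat \<Rightarrow> 'w measure \<Rightarrow> (nat \<Rightarrow> 'y measure) \<Rightarrow> (nat \<Rightarrow> 'u topology) \<Rightarrow>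
   (nat \<Rightarrow> ('w, 'y, 'u) history \<Rightarrow> 'y measure) \<Rightarrow> ('w \<Rightarrow> (nat \<Rightarrow> 'u) \<Rightarrow> real) \<Rightarrow>
   (nat \<Rightarrow> 'y \<Rightarrow> 'u) \<Rightarrow> bool" where
  "optimal_policy N P Y U K c \<gamma> \<longleftrightarrow>
     \<gamma> \<in> team_policies N Y U \<and>
     team_cost N P Y K c \<gamma> = (INF \<gamma>'\<in>team_policies N Y U. team_cost N P Y K c \<gamma>')"

section \<open>Independent-measurements reduction\<close>

definition independent_reduction ::
  "nat \<Rightarrow> 'w measure \<Rightarrow> (nat \<Rightarrow> 'y measure) \<Rightarrow> (nat \<Rightarrow> 'u topology) \<Rightarrow>
   (nat \<Rightarrow> ('w, 'y, 'u) history \<Rightarrow> 'y measure) \<Rightarrow>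
   (nat \<Rightarrow> 'y measure) \<Rightarrow> (nat \<Rightarrow> 'y \<Rightarrow> ('w, 'y, 'u) history \<Rightarrow> real) \<Rightarrow> bool" where
  "independent_reduction N P Y U K Q f \<longleftrightarrow>
     (\<forall>t\<in>{1..N}.
        prob_space (Q t) \<and> sets (Q t) = sets (Y t) \<and>
        (\<lambda>(z, h). f t z h) \<in> borel_measurable (Y t \<Otimes>\<^sub>M history_space P Y U t) \<and>
        (\<forall>z\<in>space (Y t). \<forall>h\<in>space (history_space P Y U t). 0 \<le> f t z h) \<and>
        (\<forall>h\<in>space (history_space P Y U t). \<forall>S\<in>sets (Y t).
           emeasure (K t h) S = (\<integral>\<^sup>+ z\<in>S. ennreal (f t z h) \<partial>Q t)))"

definition reduced_cost ::
  "nat \<Rightarrow> ('w \<Rightarrow> (nat \<Rightarrow> 'u) \<Rightarrow> real) \<Rightarrow> (nat \<Rightarrow> 'y \<Rightarrow> ('w, 'y, 'u) history \<Rightarrow> real) \<Rightarrow>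
   'w \<Rightarrow> (nat \<Rightarrow> 'y) \<Rightarrow> (nat \<Rightarrow> 'u) \<Rightarrow> real" where
  "reduced_cost N c f w y u =
     c w u * (\<Prod>t\<in>{1..N}. f t (y t) (w, restrict y {1..<t}, restrict u {1..<t}))"

text \<open>
  The policies with \<open>E[\<phi>\<^sup>i(u\<^sup>i)] \<le> m\<close> for all \<open>i\<close>, the expectation being taken in the reduced form,
  i.e. with \<open>y\<^sup>i\<close> distributed according to \<open>Q\<^sub>i\<close>.
\<close>

definition moment_policies ::
  "nat \<Rightarrow> (nat \<Rightarrow> 'y measure) \<Rightarrow> (nat \<Rightarrow> 'u topology) \<Rightarrow> (nat \<Rightarrow> 'y measure) \<Rightarrow>
   (nat \<Rightarrow> 'u \<Rightarrow> real) \<Rightarrow> ennreal \<Rightarrow> (nat \<Rightarrow> 'y \<Rightarrow> 'u) set" where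
  "moment_policies N Y U Q \<phi> m =
     {\<gamma> \<in> team_policies N Y U. \<forall>i\<in>{1..N}. (\<integral>\<^sup>+ z. ennreal (\<phi> i (\<gamma> i z)) \<partial>Q i) \<le> m}"

end

theory Submission
  imports Defs
begin

text \<open>
  Under the independent reference measures the cost of a policy \<open>\<gamma>\<close> is the integral of the reduced
  cost at \<open>u\<^sup>t = \<gamma>\<^sup>t (y\<^sup>t)\<close> with respect to the product of \<open>P\<close> and \<open>Q\<^sub>1, \<dots>, Q\<^sub>N\<close>
  (\<open>team_cost_eq_reduced\<close>).  The argument is the direct method: a minimising sequence of policies
  with bounded moments has a limit among the randomised policies, the cost is lower semicontinuous
  there, and randomisation does not help.  Because the reference measure is a product, the decision makers can
  be treated one at a time.

  For compactness, fix a decision maker and a sequence \<open>\<gamma> n\<close> of measurable maps into \<open>U\<close>.  The space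
  \<open>U\<close> is split into finitely many cells, which are refined again and again by a countable base and by
  the compact sets of the exhaustion.  Tychonoff's theorem gives one filter along which
  \<open>Q (A \<inter> {\<gamma> n \<in> E})\<close> converges for every measurable \<open>A\<close> and every cell \<open>E\<close>.  As a function of \<open>A\<close> the
  limit is a measure dominated by \<open>Q\<close>, so it has a density \<open>p\<close>, and \<open>p z\<close> is the limiting conditional
  probability of \<open>E\<close> given \<open>z\<close>.  These probabilities are sampled with one uniform variable \<open>\<xi>\<close>: the
  cell of \<open>\<xi>\<close> at each level is an index in the inverse distribution function, and the cells chosen for
  the same \<open>\<xi>\<close> are nested.  The moment bound keeps them inside a compact set almost surely, hence
  they shrink to a point \<open>G z \<xi>\<close>.  The map \<open>G\<close> is the randomised limit strategy
  (\<open>young_limit_exists\<close>).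

  For lower semicontinuity, observe that on a product of cells of level \<open>k\<close> the reduced cost is at least its infimum
  over the product.  The resulting lower bound for the cost of \<open>\<gamma> n\<close> involves only indicators of
  cells, one factor per decision maker, and passes to the limit because products of setwise limits
  are setwise limits for the product measure (\<open>product_setwise_limit\<close>).  As \<open>k\<close> grows the cells
  shrink to \<open>G z \<xi>\<close>, the infima approach the reduced cost there by continuity in the actions, and
  Fatou's lemma bounds the cost of the randomised policy by the limit of the costs.

  Finally, the cost of the randomised policy is the average over \<open>\<xi> = (\<xi>\<^sup>1, \<dots>, \<xi>\<^sup>N)\<close> of
  the costs of the deterministic policies \<open>z \<mapsto> G\<^sup>i z \<xi>\<^sup>i\<close>, so one of them does not exceed the average
  (\<open>exists_policy_le_limit\<close>).
\<close>

section \<open>Setwise limits of measures along a filter\<close>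

text \<open>
  The index set of the bounded quantities is uncountable in the application (it ranges over all
  measurable sets), out of reach of a diagonal argument.  Tychonoff's theorem gives a cluster
  point of the sequence in the compact cube instead, and the filter generated by its neighbourhoods
  does the work of a subsequence.
\<close>

lemma exists_convergent_subfilter:
  fixes T :: "nat \<Rightarrow> 'i \<Rightarrow> real"
  assumes "\<And>n i. T n i \<in> {0..1}"
  obtains F where "F \<le> sequentially" "F \<noteq> bot" "\<And>i. \<exists>l. ((\<lambda>n. T n i) \<longlongrightarrow> l) F"
proof -
  have "compactin (product_topology (\<lambda>_::'i. euclideanreal) UNIV) (PiE UNIV (\<lambda>_. {0..1}))"
    by (simp add: compactin_PiE)
  then have "compact (PiE (UNIV :: 'i set) (\<lambda>_. {0..1::real}))"
    by (simp add: euclidean_product_topology)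
  moreover have "filtermap T sequentially \<noteq> bot"
    by (simp add: filtermap_bot_iff)
  moreover have "eventually (\<lambda>x. x \<in> PiE UNIV (\<lambda>_. {0..1})) (filtermap T sequentially)"
    using assms by (simp add: eventually_filtermap PiE_UNIV_domain Pi_iff always_eventually del: atLeastAtMost_iff)
  ultimately obtain x where x: "inf (nhds x) (filtermap T sequentially) \<noteq> bot"
    unfolding compact_filter by blast
  \<comment> \<open>The trace of the neighbourhoods of the cluster point on the sequence.\<close>
  define F where "F = inf sequentially (filtercomap T (nhds x))"
  have "F \<noteq> bot"
  proof
    assume "F = bot"
    then have "eventually (\<lambda>_. False) (inf sequentially (filtercomap T (nhds x)))"
      by (simp add: F_def)
    then obtain A B where A: "eventually A sequentially" and B: "eventually B (nhds x)"
      and AB: "\<And>n. A n \<Longrightarrow> B (T n) \<Longrightarrow> False"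
      by (fastforce simp: eventually_inf eventually_filtercomap)
    have "eventually (\<lambda>z. \<not> B z) (filtermap T sequentially)"
      unfolding eventually_filtermap using A by (rule eventually_mono) (use AB in blast)
    with B have "eventually (\<lambda>_. False) (inf (nhds x) (filtermap T sequentially))"
      by (auto simp: eventually_inf)
    with x show False by (simp add: eventually_False)
  qed
  moreover have lim: "filterlim T (nhds x) F"
    unfolding F_def by (meson filterlim_filtercomap filterlim_mono inf_le2 order_refl)
  ultimately have "((\<lambda>n. T n i) \<longlongrightarrow> x i) F" for i
    by (intro continuous_on_tendsto_compose[OF continuous_on_product_coordinates lim]) auto
  with \<open>F \<noteq> bot\<close> show ?thesis
    using that[of F] by (auto simp: F_def)
qed

text \<open>
  Domination by a finite measure makes the series over a disjoint family uniformly convergent, which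
  is Tannery's theorem; dominated convergence for sequences would not cover general filters.
\<close>

lemma tendsto_measure_UNION_dominated:
  fixes \<nu> :: "'n \<Rightarrow> 'a set \<Rightarrow> real" and \<mu> :: "'a measure"
  assumes "finite_measure \<mu>" and A: "disjoint_family A" "range A \<subseteq> sets \<mu>"
    and bound: "\<And>n k. 0 \<le> \<nu> n (A k) \<and> \<nu> n (A k) \<le> measure \<mu> (A k)"
    and sums: "\<And>n. (\<lambda>k. \<nu> n (A k)) sums \<nu> n (\<Union>k. A k)"
    and lim: "\<And>k. ((\<lambda>n. \<nu> n (A k)) \<longlongrightarrow> b k) F" and "F \<noteq> bot"
  shows "((\<lambda>n. \<nu> n (\<Union>k. A k)) \<longlongrightarrow> suminf b) F" "summable b"
proof -
  interpret finite_measure \<mu> by fact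
  have "summable (\<lambda>k. measure \<mu> (A k))"
    using finite_measure_UNION[OF A(2,1)] by (rule sums_summable)
  from tannerys_theorem[where a = "\<lambda>k n. \<nu> n (A k)", OF lim _ this \<open>F \<noteq> bot\<close>] bound
  have "summable (\<lambda>k. norm (b k)) \<and> ((\<lambda>n. \<Sum>k. \<nu> n (A k)) \<longlongrightarrow> suminf b) F"
    by (auto intro!: always_eventually)
  then show "((\<lambda>n. \<nu> n (\<Union>k. A k)) \<longlongrightarrow> suminf b) F" "summable b"
    using sums by (auto simp: sums_iff intro: summable_norm_cancel)
qed

text \<open>
  The limit \<open>l\<close> is countably additive by the preceding lemma and is dominated by \<open>Q\<close>, hence it has a
  density by the Radon-Nikodym theorem.  Thus \<open>p\<close> is the weak limit of the indicators of \<open>B n\<close>.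
\<close>

lemma weak_limit_density:
  fixes Q :: "'a measure" and l :: "'a set \<Rightarrow> real"
  assumes "prob_space Q" and B: "\<And>n. B n \<in> sets Q" and F: "F \<noteq> bot"
    and lim: "\<And>A. A \<in> sets Q \<Longrightarrow> ((\<lambda>n. measure Q (A \<inter> B n)) \<longlongrightarrow> l A) F"
  obtains p :: "'a \<Rightarrow> real" where "p \<in> borel_measurable Q" "\<And>x. 0 \<le> p x"
    "\<And>A. A \<in> sets Q \<Longrightarrow> (\<integral>\<^sup>+x\<in>A. ennreal (p x) \<partial>Q) = ennreal (l A)"
proof -
  interpret prob_space Q by fact
  have l0: "0 \<le> l A" if "A \<in> sets Q" for A
    using tendsto_lowerbound[OF lim[OF that] _ F, of 0] by simp
  have l1: "l A \<le> measure Q A" if "A \<in> sets Q" for A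
  proof (rule tendsto_upperbound[OF lim[OF that] _ F])
    show "\<forall>\<^sub>F n in F. measure Q (A \<inter> B n) \<le> measure Q A"
      using that by (intro always_eventually allI finite_measure_mono) auto
  qed
  define N where "N = measure_of (space Q) (sets Q) (\<lambda>A. ennreal (l A))"
  have N: "emeasure N A = ennreal (l A)" if "A \<in> sets Q" for A
  proof (rule emeasure_measure_of[OF N_def])
    show "sets Q \<subseteq> Pow (space Q)" by (rule sets.space_closed)
    show "positive (sets N) (\<lambda>A. ennreal (l A))"
      using l0[of "{}"] l1[of "{}"] by (simp add: positive_def)
    show "A \<in> sets N" using that by (simp add: N_def sets.sigma_sets_eq)
    show "countably_additive (sets N) (\<lambda>A. ennreal (l A))"
    proof (rule countably_additiveI)
      fix A :: "nat \<Rightarrow> 'a set"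
      assume "range A \<subseteq> sets N" and disj: "disjoint_family A"
      then have A: "range A \<subseteq> sets Q" by (simp add: N_def sets.sigma_sets_eq)
      have *: "(\<lambda>k. measure Q (A k \<inter> B n)) sums measure Q ((\<Union>k. A k) \<inter> B n)" for n
      proof -
        have "(\<lambda>k. measure Q (A k \<inter> B n)) sums measure Q (\<Union>k. A k \<inter> B n)"
          using A B by (intro finite_measure_UNION disjoint_family_on_bisimulation[OF disj]) auto
        then show ?thesis by (simp only: UN_extend_simps)
      qed
      have Ak: "A k \<in> sets Q" for k using A by auto
      have bd: "0 \<le> measure Q (A k \<inter> B n) \<and> measure Q (A k \<inter> B n) \<le> measure Q (A k)" for n k
        using Ak by (auto intro: finite_measure_mono)
      note t = tendsto_measure_UNION_dominated[where \<nu> = "\<lambda>n A. measure Q (A \<inter> B n)" and \<mu> = Q and b = "\<lambda>k. l (A k)",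
        OF finite_measure_axioms disj A bd * lim[OF Ak] F]
      have "l (\<Union>k. A k) = (\<Sum>k. l (A k))" "summable (\<lambda>k. l (A k))"
        using tendsto_unique[OF F lim t(1)] A t(2) by auto
      then show "(\<Sum>i. ennreal (l (A i))) = ennreal (l (\<Union> (range A)))"
        using l0[OF Ak] by (simp add: suminf_ennreal2)
    qed
  qed
  have sN: "sets N = sets Q" by (simp add: N_def sets.sigma_sets_eq)
  have "absolutely_continuous Q N"
    unfolding absolutely_continuous_def
    using l1 N sN by (fastforce simp: null_sets_def emeasure_eq_measure ennreal_eq_0_iff)
  from Radon_Nikodym[OF this sN] obtain f
    where f[measurable]: "f \<in> borel_measurable Q" and dens: "density Q f = N" by blast
  have int: "(\<integral>\<^sup>+x\<in>A. f x \<partial>Q) = ennreal (l A)" if "A \<in> sets Q" for A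
    using emeasure_density[OF f that] N[OF that] dens by simp
  have "(\<integral>\<^sup>+x. f x \<partial>Q) = ennreal (l (space Q))"
    using int[of "space Q"] by (simp cong: nn_integral_cong)
  then have fin: "AE x in Q. f x \<noteq> \<infinity>"
    by (intro nn_integral_noteq_infinite) auto
  show ?thesis
  proof
    fix A assume A: "A \<in> sets Q"
    have "(\<integral>\<^sup>+x\<in>A. ennreal (enn2real (f x)) \<partial>Q) = (\<integral>\<^sup>+x\<in>A. f x \<partial>Q)"
      using fin by (intro nn_integral_cong_AE) (auto simp: ennreal_enn2real_if)
    with int[OF A] show "(\<integral>\<^sup>+x\<in>A. ennreal (enn2real (f x)) \<partial>Q) = ennreal (l A)" by simp
  qed auto
qed

text \<open>
  The sets on which the measures converge form a Dynkin system: complements are clear and disjoint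
  unions are handled by the common dominating measure.
\<close>

lemma dominated_setwise_convergence:
  fixes \<nu> :: "'n \<Rightarrow> 'a measure"
  assumes fin: "finite_measure \<mu>" "\<And>n. finite_measure (\<nu> n)" "finite_measure \<nu>'"
    and sets: "\<And>n. sets (\<nu> n) = sets \<mu>" "sets \<nu>' = sets \<mu>"
    and dom: "\<And>n S. S \<in> sets \<mu> \<Longrightarrow> measure (\<nu> n) S \<le> measure \<mu> S"
    and gen: "sets \<mu> = sigma_sets (space \<mu>) G" "Int_stable G" "space \<mu> \<in> G"
    and lim: "\<And>S. S \<in> G \<Longrightarrow> ((\<lambda>n. measure (\<nu> n) S) \<longlongrightarrow> measure \<nu>' S) F"
    and F: "F \<noteq> bot" and S: "S \<in> sets \<mu>"
  shows "((\<lambda>n. measure (\<nu> n) S) \<longlongrightarrow> measure \<nu>' S) F"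
proof -
  have G: "G \<subseteq> Pow (space \<mu>)"
    using gen(1) sets.space_closed[of \<mu>] sigma_sets.Basic by blast
  have sp: "space (\<nu> n) = space \<mu>" "space \<nu>' = space \<mu>" for n
    by (rule sets_eq_imp_space_eq[OF sets(1)], rule sets_eq_imp_space_eq[OF sets(2)])
  have "S \<in> sigma_sets (space \<mu>) G"
    using S gen(1) by simp
  with gen(2) G show ?thesis
  proof (induction rule: sigma_sets_induct_disjoint)
    case (basic A)
    then show ?case by (rule lim)
  next
    case empty
    then show ?case by simp
  next
    case (compl A)
    then have A: "A \<in> sets \<mu>" using gen(1) by simp
    have "measure (\<nu> n) (space \<mu> - A) = measure (\<nu> n) (space \<mu>) - measure (\<nu> n) A" for n
      using finite_measure.finite_measure_compl[OF fin(2), of A n] A sets sp by simp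
    moreover have "measure \<nu>' (space \<mu> - A) = measure \<nu>' (space \<mu>) - measure \<nu>' A"
      using finite_measure.finite_measure_compl[OF fin(3), of A] A sets sp by simp
    ultimately show ?case
      using compl by (auto intro!: tendsto_diff lim gen(3))
  next
    case (union A)
    then have A: "range A \<subseteq> sets \<mu>" using gen(1) by simp
    have *: "(\<lambda>k. measure (\<nu> n) (A k)) sums measure (\<nu> n) (\<Union>k. A k)" for n
      using finite_measure.finite_measure_UNION[OF fin(2)] A sets union by metis
    have "(\<lambda>k. measure \<nu>' (A k)) sums measure \<nu>' (\<Union>k. A k)"
      using finite_measure.finite_measure_UNION[OF fin(3)] A sets union by metis
    then have "measure \<nu>' (\<Union>k. A k) = (\<Sum>k. measure \<nu>' (A k))" by (simp add: sums_iff)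
    moreover have "((\<lambda>n. measure (\<nu> n) (\<Union>k. A k)) \<longlongrightarrow> (\<Sum>k. measure \<nu>' (A k))) F"
      using A dom
      by (intro tendsto_measure_UNION_dominated(1)[where \<nu> = "\<lambda>n. measure (\<nu> n)", OF fin(1) union(1) A _ * _ F])
         (auto intro!: union)
    ultimately show ?case by simp
  qed
qed

section \<open>Nested cells in a second countable space\<close>

text \<open>
  A base is given by the balls of radius \<open>1 / (n + 1)\<close> around the points of a countable dense set.
\<close>

lemma metrizable_separable_imp_second_countable:
  assumes "metrizable_space X" "separable_space X"
  shows "second_countable X"
proof -
  obtain M d where "Metric_space M d" and X: "X = Metric_space.mtopology M d"
    using assms(1) by (auto simp: metrizable_space_def)
  interpret Metric_space M d by fact
  obtain S where S: "countable S" "S \<subseteq> M" "mtopology closure_of S = M"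
    using assms(2) by (auto simp: separable_space_def X)
  let ?B = "(\<lambda>(s, n). mball s (inverse (Suc n))) ` (S \<times> (UNIV :: nat set))"
  show ?thesis
    unfolding second_countable_def
  proof (intro exI conjI allI impI ballI)
    show "countable ?B" using S(1) by (intro countable_image) auto
    show "openin X V" if "V \<in> ?B" for V using that by (auto simp: X)
    fix U x assume *: "openin X U \<and> x \<in> U"
    then obtain r where r: "0 < r" "mball x r \<subseteq> U" and xM: "x \<in> M"
      unfolding X openin_mtopology by blast
    obtain n where n: "inverse (real (Suc n)) < r / 2"
      using reals_Archimedean[of "r / 2"] r(1) by auto
    have "x \<in> mtopology closure_of S" using xM S by simp
    moreover have "0 < inverse (real (Suc n))" by simp
    ultimately obtain s where s: "s \<in> S" "s \<in> mball x (inverse (real (Suc n)))"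
      unfolding metric_closure_of by blast
    have "mball s (inverse (Suc n)) \<subseteq> mball x r"
    proof
      fix z assume z: "z \<in> mball s (inverse (Suc n))"
      then have "d x z \<le> d x s + d s z" using s xM by (intro triangle) auto
      with z s n xM show "z \<in> mball x r" by auto
    qed
    then show "\<exists>V\<in>?B. x \<in> V \<and> V \<subseteq> U"
      using s r by (intro bexI[of _ "mball s (inverse (Suc n))"]) (auto simp: commute)
  qed
qed

lemma standard_borel_top_countability_separation:
  assumes "standard_borel_top T"
  shows "second_countable T" "regular_space T" "Hausdorff_space T"
proof -
  obtain X B where X: "completely_metrizable_space X" "separable_space X" and T: "T = subtopology X B"
    using assms by (auto simp: standard_borel_top_def)
  have m: "metrizable_space X" using X(1) by (rule completely_metrizable_imp_metrizable_space)
  show "second_countable T" "regular_space T" "Hausdorff_space T"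
    unfolding T using m X(2)
    by (simp_all add: second_countable_subtopology metrizable_separable_imp_second_countable
        regular_space_subtopology metrizable_imp_regular_space Hausdorff_space_subtopology
        metrizable_imp_Hausdorff_space)
qed

text \<open>
  The first \<open>k\<close> membership bits of a point with respect to \<open>D 0, D 1, \<dots>\<close>, read as a binary number.
  Numbers are used rather than bit lists because their order later turns the cells of a level into
  consecutive subintervals of the unit interval.
\<close>

primrec code :: "(nat \<Rightarrow> 'u set) \<Rightarrow> nat \<Rightarrow> 'u \<Rightarrow> nat" where
  "code D 0 u = 0"
| "code D (Suc k) u = 2 * code D k u + of_bool (u \<in> D k)"

lemma code_Suc_div_2: "code D (Suc k) u div 2 = code D k u"
  by simp

lemma code_less: "code D k u < 2 ^ k"
  by (induction k) (auto simp: of_bool_def)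

definition cell :: "'u topology \<Rightarrow> (nat \<Rightarrow> 'u set) \<Rightarrow> nat \<Rightarrow> nat \<Rightarrow> 'u set" where
  "cell X D k j = {u \<in> topspace X. code D k u = j}"

text \<open>
  Halving the code forgets the last bit, so a branch picks a decreasing sequence of nonempty cells.
\<close>

definition branch :: "'u topology \<Rightarrow> (nat \<Rightarrow> 'u set) \<Rightarrow> (nat \<Rightarrow> nat) \<Rightarrow> bool" where
  "branch X D \<kappa> \<longleftrightarrow> (\<forall>k. \<kappa> (Suc k) div 2 = \<kappa> k \<and> cell X D k (\<kappa> k) \<noteq> {})"

definition branch_converges ::
  "'u topology \<Rightarrow> (nat \<Rightarrow> 'u set) \<Rightarrow> (nat \<Rightarrow> nat) \<Rightarrow> 'u \<Rightarrow> bool" where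
  "branch_converges X D \<kappa> x \<longleftrightarrow>
     x \<in> topspace X \<and> (\<forall>V. openin X V \<longrightarrow> x \<in> V \<longrightarrow> (\<exists>k. cell X D k (\<kappa> k) \<subseteq> V))"

lemma branch_antimono:
  assumes "branch X D \<kappa>" "k \<le> l"
  shows "cell X D l (\<kappa> l) \<subseteq> cell X D k (\<kappa> k)"
  using assms(2)
proof (induction l rule: dec_induct)
  case (step l)
  have "cell X D (Suc l) (\<kappa> (Suc l)) \<subseteq> cell X D l (\<kappa> l)"
  proof
    fix u assume u: "u \<in> cell X D (Suc l) (\<kappa> (Suc l))"
    then have "code D l u = \<kappa> (Suc l) div 2"
      using code_Suc_div_2[of D l u] by (simp add: cell_def)
    also have "\<dots> = \<kappa> l" using assms(1) by (simp add: branch_def)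
    finally show "u \<in> cell X D l (\<kappa> l)" using u by (simp add: cell_def)
  qed
  with step show ?case by blast
qed simp

text \<open>
  A cell of level \<open>k + 1\<close> is either contained in \<open>D k\<close> or disjoint from it.
\<close>

lemma cell_Suc_decides:
  assumes "u \<in> cell X D (Suc k) j" "u \<in> D k"
  shows "cell X D (Suc k) j \<subseteq> D k"
proof
  fix v assume "v \<in> cell X D (Suc k) j"
  with assms have "code D (Suc k) v = code D (Suc k) u" by (simp add: cell_def)
  then have "odd (code D (Suc k) v)" using assms(2) by simp
  then show "v \<in> D k" by (auto split: if_splits)
qed

text \<open>
  The sequence \<open>D\<close> may contain sets that are not open: the compact sets of an exhaustion have to be
  among them as well.
\<close>

definition contains_base :: "'u topology \<Rightarrow> (nat \<Rightarrow> 'u set) \<Rightarrow> bool" where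
  "contains_base X D \<longleftrightarrow> (\<forall>V x. openin X V \<and> x \<in> V \<longrightarrow> (\<exists>j. openin X (D j) \<and> x \<in> D j \<and> D j \<subseteq> V))"

text \<open>
  By compactness the closures of the cells of the branch have a common point \<open>x\<close>.  To see that the
  cells shrink to \<open>x\<close>, cover the compact set by finitely many \<open>D j\<close> that are contained in a given
  neighbourhood of \<open>x\<close> or do not have \<open>x\<close> in their closure.  Once the level has passed all these
  \<open>j\<close>, the cell lies inside one of them, and it cannot be one of the second kind.
\<close>

lemma branch_in_compact_converges:
  assumes X: "Hausdorff_space X" and base: "contains_base X D" and br: "branch X D \<kappa>"
    and C: "compactin X C" and k0: "cell X D k0 (\<kappa> k0) \<subseteq> C"
  shows "\<exists>x. branch_converges X D \<kappa> x"
proof -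
  define E where "E k = cell X D k (\<kappa> k)" for k
  have E: "E k \<noteq> {}" "E k \<subseteq> topspace X" for k
    using br by (auto simp: E_def branch_def cell_def)
  have anti: "E l \<subseteq> E k" if "k \<le> l" for k l
    using branch_antimono[OF br that] by (simp add: E_def)
  have CX: "C \<subseteq> topspace X" using C by (rule compactin_subset_topspace)
  obtain x where x: "x \<in> C" "\<And>k. x \<in> X closure_of (E k)"
  proof -
    have "C \<inter> \<Inter> (range (\<lambda>k. X closure_of E k)) \<noteq> {}"
      using C unfolding compactin_fip
    proof (elim conjE allE impE)
      show "(\<forall>S\<in>range (\<lambda>k. X closure_of E k). closedin X S) \<and>
        (\<forall>\<F>. finite \<F> \<and> \<F> \<subseteq> range (\<lambda>k. X closure_of E k) \<longrightarrow> C \<inter> \<Inter> \<F> \<noteq> {})"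
      proof (intro conjI allI impI)
        fix \<F> assume "finite \<F> \<and> \<F> \<subseteq> range (\<lambda>k. X closure_of E k)"
        then obtain J where J: "finite J" "\<F> = (\<lambda>k. X closure_of E k) ` J"
          by (metis finite_subset_image)
        define m where "m = Max (insert k0 J)"
        have "k \<le> m" if "k \<in> insert k0 J" for k
          unfolding m_def using J(1) that by (intro Max_ge) auto
        then have "E m \<subseteq> C" "\<And>k. k \<in> J \<Longrightarrow> E m \<subseteq> X closure_of E k"
          using anti k0 closure_of_subset[OF E(2)] by (fastforce simp: E_def)+
        moreover obtain u where "u \<in> E m" using E(1) by blast
        ultimately have "u \<in> C \<inter> \<Inter> \<F>" using J(2) by blast
        then show "C \<inter> \<Inter> \<F> \<noteq> {}" by blast
      qed auto
    qed
    then show ?thesis using that by blast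
  qed
  have "\<exists>k. E k \<subseteq> V" if V: "openin X V" "x \<in> V" for V
  proof -
    have "\<exists>j. openin X (D j) \<and> z \<in> D j \<and> (D j \<subseteq> V \<or> x \<notin> X closure_of D j)" if z: "z \<in> C" for z
    proof (cases "z \<in> V")
      case True
      then show ?thesis using base V by (meson contains_base_def)
    next
      case False
      then have "z \<noteq> x" using V by auto
      then obtain O1 O2 where O: "openin X O1" "openin X O2" "z \<in> O1" "x \<in> O2" "disjnt O1 O2"
        using X z x CX unfolding Hausdorff_space_def by (metis subsetD)
      then obtain j where j: "openin X (D j)" "z \<in> D j" "D j \<subseteq> O1"
        using base by (meson contains_base_def)
      then have "x \<notin> X closure_of D j"
        using O unfolding in_closure_of disjnt_iff by blast
      with j show ?thesis by blast
    qed
    then obtain f where f: "\<And>z. z \<in> C \<Longrightarrow>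
        openin X (D (f z)) \<and> z \<in> D (f z) \<and> (D (f z) \<subseteq> V \<or> x \<notin> X closure_of D (f z))"
      by metis
    have "\<exists>\<F>. finite \<F> \<and> \<F> \<subseteq> (\<lambda>z. D (f z)) ` C \<and> C \<subseteq> \<Union> \<F>"
      using f by (intro compactinD[OF C]) auto
    then obtain Z where Z: "finite Z" "Z \<subseteq> C" "C \<subseteq> (\<Union>z\<in>Z. D (f z))"
      by (metis finite_subset_image)
    define k where "k = Max (insert k0 (Suc ` f ` Z))"
    have k: "l \<le> k" if "l \<in> insert k0 (Suc ` f ` Z)" for l
      unfolding k_def using Z(1) that by (intro Max_ge) auto
    obtain u where u: "u \<in> E k" using E(1) by blast
    then have "u \<in> C" using anti[of k0 k] k k0 by (auto simp: E_def)
    then obtain z where z: "z \<in> Z" "u \<in> D (f z)" using Z by blast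
    have sub: "E k \<subseteq> E (Suc (f z))" using z k by (intro anti) auto
    then have "E (Suc (f z)) \<subseteq> D (f z)"
      using u z cell_Suc_decides unfolding E_def by (metis subsetD)
    with sub have EkD: "E k \<subseteq> D (f z)" by blast
    then have "x \<in> X closure_of D (f z)"
      using x(2)[of k] closure_of_mono by blast
    then have "D (f z) \<subseteq> V" using f z Z by blast
    with EkD show ?thesis by blast
  qed
  then show ?thesis
    using x CX by (auto simp: branch_converges_def E_def)
qed

text \<open>
  This expresses the position of the limit point by countably many conditions on the branch, which
  is what its measurability rests on.  The closure is needed because a limit of points of \<open>D j\<close> may
  leave \<open>D j\<close>; regularity makes the condition necessary as well.
\<close>

lemma branch_limit_in_open_iff:
  assumes X: "regular_space X" and base: "contains_base X D" and br: "branch X D \<kappa>"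
    and x: "branch_converges X D \<kappa> x" and V: "openin X V"
  shows "x \<in> V \<longleftrightarrow> (\<exists>j k. openin X (D j) \<and> X closure_of D j \<subseteq> V \<and> cell X D k (\<kappa> k) \<subseteq> D j)"
proof
  assume "x \<in> V"
  then obtain U W where U: "openin X U" "x \<in> U" "U \<subseteq> W" "closedin X W" "W \<subseteq> V"
    using X V unfolding neighbourhood_base_of_closedin[symmetric] neighbourhood_base_of by metis
  then obtain j where j: "openin X (D j)" "x \<in> D j" "D j \<subseteq> U"
    using base by (meson contains_base_def)
  then have "X closure_of D j \<subseteq> V"
    using U by (meson closure_of_minimal order_trans)
  with j x show "\<exists>j k. openin X (D j) \<and> X closure_of D j \<subseteq> V \<and> cell X D k (\<kappa> k) \<subseteq> D j"
    unfolding branch_converges_def by blast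
next
  assume "\<exists>j k. openin X (D j) \<and> X closure_of D j \<subseteq> V \<and> cell X D k (\<kappa> k) \<subseteq> D j"
  then obtain j k where jk: "X closure_of D j \<subseteq> V" "cell X D k (\<kappa> k) \<subseteq> D j" by blast
  have "x \<in> X closure_of D j"
    unfolding in_closure_of
  proof (intro conjI allI impI)
    show "x \<in> topspace X" using x by (simp add: branch_converges_def)
    fix T assume "x \<in> T \<and> openin X T"
    then obtain l where "cell X D l (\<kappa> l) \<subseteq> T" using x by (auto simp: branch_converges_def)
    moreover have "cell X D (max k l) (\<kappa> (max k l)) \<noteq> {}" using br by (simp add: branch_def)
    ultimately show "\<exists>y. y \<in> D j \<and> y \<in> T"
      using branch_antimono[OF br, of k "max k l"] branch_antimono[OF br, of l "max k l"] jk(2)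
      by fastforce
  qed
  with jk(1) show "x \<in> V" by blast
qed

section \<open>Borel sets of a topology\<close>

lemma space_borel_of_top [simp]: "space (borel_of_top X) = topspace X"
  unfolding borel_of_top_def by (rule space_measure_of) (auto dest: openin_subset)

lemma sets_borel_of_top: "sets (borel_of_top X) = sigma_sets (topspace X) {V. openin X V}"
  unfolding borel_of_top_def by (rule sets_measure_of) (auto dest: openin_subset)

lemma borel_of_top_open: "openin X V \<Longrightarrow> V \<in> sets (borel_of_top X)"
  by (simp add: sets_borel_of_top)

lemma borel_of_top_closed: "closedin X V \<Longrightarrow> V \<in> sets (borel_of_top X)"
  using sets.compl_sets[OF borel_of_top_open, of X "topspace X - V"]
  by (simp add: closedin_def double_diff)

lemma measurable_borel_of_top:
  assumes "\<And>x. x \<in> space M \<Longrightarrow> f x \<in> topspace X"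
    and "\<And>V. openin X V \<Longrightarrow> {x \<in> space M. f x \<in> V} \<in> sets M"
  shows "f \<in> measurable M (borel_of_top X)"
  unfolding borel_of_top_def
proof (rule measurable_measure_of)
  show "f -` V \<inter> space M \<in> sets M" if "V \<in> {V. openin X V}" for V
    using assms(2)[of V] that by (simp add: vimage_def Int_def conj_commute)
qed (use assms(1) in \<open>auto dest: openin_subset\<close>)

section \<open>Sampling an index from a weight sequence\<close>

definition uniform01 :: "real measure" where
  "uniform01 = restrict_space lborel {0..<1}"

lemma space_uniform01 [simp]: "space uniform01 = {0..<1}"
  by (simp add: uniform01_def space_restrict_space)

lemma prob_space_uniform01: "prob_space uniform01"
  by (rule prob_spaceI) (simp add: uniform01_def space_restrict_space emeasure_restrict_space)

lemma emeasure_uniform01_ico: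
  assumes "0 \<le> a" "a \<le> b" "b \<le> 1"
  shows "emeasure uniform01 {a..<b} = ennreal (b - a)"
  using assms by (simp add: uniform01_def emeasure_restrict_space)

text \<open>
  The discrete inverse distribution function of the weights \<open>w\<close>.
\<close>

definition quantile_index :: "(nat \<Rightarrow> real) \<Rightarrow> real \<Rightarrow> nat" where
  "quantile_index w \<xi> = (LEAST j. \<xi> < (\<Sum>l\<le>j. w l))"

lemma quantile_index_eq_iff:
  assumes w: "\<And>l. 0 \<le> w l" and one: "(\<Sum>l<n. w l) = 1" and \<xi>: "0 \<le> \<xi>" "\<xi> < 1"
  shows "quantile_index w \<xi> < n"
    and "quantile_index w \<xi> = j \<longleftrightarrow> (\<Sum>l<j. w l) \<le> \<xi> \<and> \<xi> < (\<Sum>l<Suc j. w l)"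
proof -
  have "n \<noteq> 0" using one by (cases n) auto
  have n: "\<xi> < (\<Sum>l\<le>n - 1. w l)"
  proof -
    have "{..n - 1} = {..<n}" using \<open>n \<noteq> 0\<close> by auto
    then show ?thesis using one \<xi>(2) by simp
  qed
  then have "quantile_index w \<xi> \<le> n - 1" unfolding quantile_index_def by (rule Least_le)
  then show "quantile_index w \<xi> < n" using \<open>n \<noteq> 0\<close> by simp
  have mono: "(\<Sum>l<i. w l) \<le> (\<Sum>l<k. w l)" if "i \<le> k" for i k
    using that w by (intro sum_mono2) auto
  show "quantile_index w \<xi> = j \<longleftrightarrow> (\<Sum>l<j. w l) \<le> \<xi> \<and> \<xi> < (\<Sum>l<Suc j. w l)"
  proof
    assume j: "quantile_index w \<xi> = j"
    have "\<xi> < (\<Sum>l\<le>j. w l)" using LeastI[of "\<lambda>j. \<xi> < (\<Sum>l\<le>j. w l)", OF n] j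
      by (simp add: quantile_index_def)
    moreover have "(\<Sum>l<j. w l) \<le> \<xi>"
    proof (cases j)
      case (Suc i)
      then have "\<not> \<xi> < (\<Sum>l\<le>i. w l)"
        using not_less_Least[of i "\<lambda>j. \<xi> < (\<Sum>l\<le>j. w l)"] j by (simp add: quantile_index_def)
      then show ?thesis using Suc by (simp add: lessThan_Suc_atMost)
    qed (use \<xi> in simp)
    ultimately show "(\<Sum>l<j. w l) \<le> \<xi> \<and> \<xi> < (\<Sum>l<Suc j. w l)"
      by (simp only: lessThan_Suc_atMost)
  next
    assume j: "(\<Sum>l<j. w l) \<le> \<xi> \<and> \<xi> < (\<Sum>l<Suc j. w l)"
    show "quantile_index w \<xi> = j"
      unfolding quantile_index_def
    proof (rule Least_equality)
      show "\<xi> < (\<Sum>l\<le>j. w l)" using j by (simp only: lessThan_Suc_atMost)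
      fix i assume "\<xi> < (\<Sum>l\<le>i. w l)"
      then have "\<xi> < (\<Sum>l<Suc i. w l)" by (simp only: lessThan_Suc_atMost)
      with j mono[of "Suc i" j] show "j \<le> i" by linarith
    qed
  qed
qed

text \<open>
  If \<open>w'\<close> splits each weight \<open>w l\<close> into the two consecutive weights \<open>2 l\<close> and \<open>2 l + 1\<close>, then the
  interval of the unit interval that belongs to \<open>l\<close> is split accordingly.  Hence the same \<open>\<xi>\<close>
  selects nested cells at successive levels.
\<close>

lemma quantile_index_refine:
  assumes w: "\<And>l. 0 \<le> w l" and one: "(\<Sum>l<n. w l) = 1"
    and w': "\<And>l. 0 \<le> w' l" and split: "\<And>l. l < n \<Longrightarrow> w' (2 * l) + w' (2 * l + 1) = w l"
    and \<xi>: "0 \<le> \<xi>" "\<xi> < 1"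
  shows "quantile_index w' \<xi> div 2 = quantile_index w \<xi>"
proof -
  have sum: "(\<Sum>l<2 * j. w' l) = (\<Sum>l<j. w l)" if "j \<le> n" for j
    using that
  proof (induction j)
    case (Suc j)
    then show ?case using split[of j] by simp
  qed simp
  have one': "(\<Sum>l<2 * n. w' l) = 1" using sum[of n] one by simp
  define i where "i = quantile_index w' \<xi>"
  have i: "(\<Sum>l<i. w' l) \<le> \<xi>" "\<xi> < (\<Sum>l<Suc i. w' l)" "i < 2 * n"
    using quantile_index_eq_iff[where w=w' and n="2*n" and \<xi>=\<xi>, OF w' one' \<xi>] by (auto simp: i_def)
  have mono: "(\<Sum>l<i. w' l) \<le> (\<Sum>l<k. w' l)" if "i \<le> k" for i k
    using that w' by (intro sum_mono2) auto
  have "(\<Sum>l<i div 2. w l) \<le> \<xi>"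
    using sum[of "i div 2"] mono[of "2 * (i div 2)" i] i by (simp add: less_mult_imp_div_less)
  moreover have "\<xi> < (\<Sum>l<Suc (i div 2). w l)"
  proof -
    have "Suc (i div 2) \<le> n" using i(3) by linarith
    moreover have "Suc i \<le> 2 * Suc (i div 2)" by presburger
    ultimately show ?thesis
      using sum[of "Suc (i div 2)"] mono[of "Suc i" "2 * Suc (i div 2)"] i(2)
      by (metis order_less_le_trans)
  qed
  ultimately show ?thesis
    using quantile_index_eq_iff(2)[OF w one \<xi>, of "i div 2"] by (simp add: i_def)
qed

lemma emeasure_quantile_index:
  assumes w: "\<And>l. 0 \<le> w l" and one: "(\<Sum>l<n. w l) = 1" and j: "j < n"
  shows "emeasure uniform01 {\<xi> \<in> space uniform01. quantile_index w \<xi> = j} = ennreal (w j)"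
proof -
  have le1: "(\<Sum>l<i. w l) \<le> 1" if "i \<le> n" for i
    unfolding one[symmetric] using that w by (intro sum_mono2) auto
  have "{\<xi> \<in> space uniform01. quantile_index w \<xi> = j} = {(\<Sum>l<j. w l)..<(\<Sum>l<Suc j. w l)}"
  proof (intro set_eqI iffI)
    fix \<xi> assume "\<xi> \<in> {\<xi> \<in> space uniform01. quantile_index w \<xi> = j}"
    then show "\<xi> \<in> {(\<Sum>l<j. w l)..<(\<Sum>l<Suc j. w l)}"
      using quantile_index_eq_iff(2)[OF w one, of \<xi> j] by auto
  next
    fix \<xi> assume a: "\<xi> \<in> {(\<Sum>l<j. w l)..<(\<Sum>l<Suc j. w l)}"
    moreover have "0 \<le> (\<Sum>l<j. w l)" using w by (intro sum_nonneg) auto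
    ultimately have "0 \<le> \<xi>" "\<xi> < 1" using le1[of "Suc j"] j by auto
    then show "\<xi> \<in> {\<xi> \<in> space uniform01. quantile_index w \<xi> = j}"
      using quantile_index_eq_iff(2)[OF w one, of \<xi> j] a by auto
  qed
  moreover have "0 \<le> (\<Sum>l<j. w l)" using w by (intro sum_nonneg) auto
  ultimately show ?thesis
    using le1[of "Suc j"] j w[of j] by (simp add: emeasure_uniform01_ico)
qed

section \<open>Limits of sequences of measurable maps as randomised maps\<close>

lemma measurable_quantile_index [measurable]:
  assumes [measurable]: "\<And>j. p j \<in> borel_measurable M"
  shows "(\<lambda>(z, \<xi>). quantile_index (\<lambda>j. p j z) \<xi>) \<in> measurable (M \<Otimes>\<^sub>M uniform01) (count_space UNIV)"
proof -
  have [measurable]: "(\<lambda>\<xi>. \<xi>) \<in> borel_measurable uniform01"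
    by (simp add: uniform01_def measurable_restrict_space1)
  show ?thesis unfolding quantile_index_def by measurable
qed

lemma measurable_code [measurable]:
  assumes "\<And>k. D k \<in> sets (borel_of_top X)"
  shows "code D k \<in> measurable (borel_of_top X) (count_space UNIV)"
proof (induction k)
  case (Suc k)
  note [measurable] = assms Suc
  show ?case by simp
qed simp

locale coded_space =
  fixes X :: "'u topology" and D :: "nat \<Rightarrow> 'u set"
  assumes Hausdorff: "Hausdorff_space X" and regular: "regular_space X"
    and base: "contains_base X D" and D_sets: "\<And>k. D k \<in> sets (borel_of_top X)"

lemma pred_count_space:
  assumes "\<kappa> \<in> measurable M (count_space UNIV)"
  shows "Measurable.pred M (\<lambda>a. R (\<kappa> a))"
  using measurable_compose[OF assms, of R "count_space UNIV"] by simp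

text \<open>
  The predicate \<open>good\<close> stands for a condition that forces the branch to converge; elsewhere the map is
  given the fixed value \<open>x0\<close>.
\<close>

lemma (in coded_space) measurable_branch_limit:
  fixes \<kappa> :: "nat \<Rightarrow> 'a \<Rightarrow> nat"
  assumes \<kappa>[measurable]: "\<And>k. \<kappa> k \<in> measurable M (count_space UNIV)"
    and conv: "\<And>a. a \<in> space M \<Longrightarrow> branch X D (\<lambda>k. \<kappa> k a) \<Longrightarrow> good a \<Longrightarrow>
      branch_converges X D (\<lambda>k. \<kappa> k a) (g a)"
    and good[measurable]: "Measurable.pred M good"
    and x0: "x0 \<in> topspace X"
  shows "(\<lambda>a. if branch X D (\<lambda>k. \<kappa> k a) \<and> good a then g a else x0) \<in> measurable M (borel_of_top X)"
proof (rule measurable_borel_of_top)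
  have br[measurable]: "Measurable.pred M (\<lambda>a. branch X D (\<lambda>k. \<kappa> k a))"
  proof -
    have 1: "Measurable.pred M (\<lambda>a. cell X D k (\<kappa> k a) \<noteq> {})"
      "Measurable.pred M (\<lambda>a. \<kappa> (Suc k) a div 2 = m)"
      "Measurable.pred M (\<lambda>a. \<kappa> k a = m)" for k m
      by (rule pred_count_space[OF \<kappa>])+
    have *: "\<kappa> (Suc k) a div 2 = \<kappa> k a \<longleftrightarrow> (\<exists>m. \<kappa> (Suc k) a div 2 = m \<and> \<kappa> k a = m)" for k a
      by auto
    show ?thesis unfolding branch_def * by (intro pred_intros_logic pred_intros_countable 1)
  qed
  fix V assume V: "openin X V"
  have [measurable]: "Measurable.pred M (\<lambda>a. cell X D k (\<kappa> k a) \<subseteq> D j)" for k j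
    by (rule pred_count_space[OF \<kappa>])
  have "{a \<in> space M. (if branch X D (\<lambda>k. \<kappa> k a) \<and> good a then g a else x0) \<in> V} =
    {a \<in> space M. if branch X D (\<lambda>k. \<kappa> k a) \<and> good a then
       \<exists>j k. openin X (D j) \<and> X closure_of D j \<subseteq> V \<and> cell X D k (\<kappa> k a) \<subseteq> D j else x0 \<in> V}"
  proof (intro Collect_cong conj_cong refl)
    fix a assume "a \<in> space M"
    then have iff: "g a \<in> V \<longleftrightarrow>
        (\<exists>j k. openin X (D j) \<and> X closure_of D j \<subseteq> V \<and> cell X D k (\<kappa> k a) \<subseteq> D j)"
      if "branch X D (\<lambda>k. \<kappa> k a) \<and> good a"
      using branch_limit_in_open_iff[OF regular base _ conv V] that by blast
    show "((if branch X D (\<lambda>k. \<kappa> k a) \<and> good a then g a else x0) \<in> V) \<longleftrightarrow>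
      (if branch X D (\<lambda>k. \<kappa> k a) \<and> good a then
       \<exists>j k. openin X (D j) \<and> X closure_of D j \<subseteq> V \<and> cell X D k (\<kappa> k a) \<subseteq> D j else x0 \<in> V)"
    proof (cases "branch X D (\<lambda>k. \<kappa> k a) \<and> good a")
      case True
      show ?thesis unfolding if_P[OF True] by (rule iff[OF True])
    next
      case False
      show ?thesis unfolding if_not_P[OF False] by (rule refl)
    qed
  qed
  also have "\<dots> \<in> sets M" by measurable
  finally show "{a \<in> space M. (if branch X D (\<lambda>k. \<kappa> k a) \<and> good a then g a else x0) \<in> V} \<in> sets M" .
qed (use conv x0 in \<open>auto simp: branch_converges_def\<close>)

text \<open>
  The densities of the limits for the individual cells inherit, almost everywhere, the relations
  between the indicators of the cells: they sum to one on each level, they are additive under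
  refinement, and they vanish for empty cells.  Uniqueness of densities transfers each relation.
\<close>

lemma (in coded_space) weak_limit_cell_densities:
  fixes \<gamma> :: "nat \<Rightarrow> 'y \<Rightarrow> 'u"
  assumes Q: "prob_space Q" and \<gamma>[measurable]: "\<And>n. \<gamma> n \<in> measurable Q (borel_of_top X)"
    and F: "F \<noteq> bot"
    and conv: "\<And>k j A. A \<in> sets Q \<Longrightarrow>
      \<exists>l. ((\<lambda>n. measure Q (A \<inter> {z \<in> space Q. code D k (\<gamma> n z) = j})) \<longlongrightarrow> l) F"
  obtains p :: "nat \<Rightarrow> nat \<Rightarrow> 'y \<Rightarrow> real"
  where "\<And>k j. p k j \<in> borel_measurable Q" "\<And>k j z. 0 \<le> p k j z"
    "\<And>k j. finite_measure (density Q (\<lambda>z. ennreal (p k j z)))"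
    "\<And>k j A. A \<in> sets Q \<Longrightarrow>
       ((\<lambda>n. measure Q (A \<inter> {z \<in> space Q. code D k (\<gamma> n z) = j})) \<longlongrightarrow>
         measure (density Q (\<lambda>z. ennreal (p k j z))) A) F"
    "AE z in Q. (\<forall>k. (\<Sum>j<2 ^ k. p k j z) = 1) \<and>
       (\<forall>k j. p (Suc k) (2 * j) z + p (Suc k) (2 * j + 1) z = p k j z) \<and>
       (\<forall>k j. cell X D k j = {} \<longrightarrow> p k j z = 0)"
proof -
  interpret prob_space Q by fact
  note D_sets[measurable]
  define B where "B n k j = {z \<in> space Q. code D k (\<gamma> n z) = j}" for n k j
  have B[measurable]: "B n k j \<in> sets Q" for n k j
    unfolding B_def by measurable
  define l where "l k j A = (SOME l. ((\<lambda>n. measure Q (A \<inter> B n k j)) \<longlongrightarrow> l) F)" for k j A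
  have l: "((\<lambda>n. measure Q (A \<inter> B n k j)) \<longlongrightarrow> l k j A) F" if "A \<in> sets Q" for k j A
    using someI_ex[OF conv[OF that, of k j]] by (simp only: l_def B_def)
  have l0: "0 \<le> l k j A" if "A \<in> sets Q" for k j A
    using tendsto_lowerbound[OF l[OF that] _ F, of 0] by simp
  let ?R = "\<lambda>k j p. p \<in> borel_measurable Q \<and> (\<forall>z. 0 \<le> p z) \<and>
      (\<forall>A\<in>sets Q. (\<integral>\<^sup>+z\<in>A. ennreal (p z) \<partial>Q) = ennreal (l k j A))"
  define p where "p k j = (SOME p. ?R k j p)" for k j
  have ex: "\<exists>p. ?R k j p" for k j
    by (rule weak_limit_density[OF Q B F l, of k j]) auto
  have "?R k j (p k j)" for k j
    unfolding p_def by (rule someI_ex[OF ex])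
  then have p[measurable]: "\<And>k j. p k j \<in> borel_measurable Q" and p0: "\<And>k j z. 0 \<le> p k j z"
    and int: "\<And>k j A. A \<in> sets Q \<Longrightarrow> (\<integral>\<^sup>+z\<in>A. ennreal (p k j z) \<partial>Q) = ennreal (l k j A)"
    by auto
  have em: "emeasure (density Q (\<lambda>z. ennreal (p k j z))) A = ennreal (l k j A)" if "A \<in> sets Q" for k j A
    using that by (simp add: emeasure_density int)
  have l_0: "l 0 0 A = measure Q A" if A: "A \<in> sets Q" for A
  proof (rule tendsto_unique[OF F l[OF A]])
    have "A \<inter> B n 0 0 = A" for n using sets.sets_into_space[OF A] by (auto simp: B_def)
    then show "((\<lambda>n. measure Q (A \<inter> B n 0 0)) \<longlongrightarrow> measure Q A) F" by simp
  qed
  have l_Suc: "l (Suc k) (2 * j) A + l (Suc k) (2 * j + 1) A = l k j A" if A: "A \<in> sets Q" for k j A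
  proof (rule tendsto_unique[OF F tendsto_add[OF l[OF A] l[OF A]]])
    have "measure Q (A \<inter> B n (Suc k) (2 * j)) + measure Q (A \<inter> B n (Suc k) (2 * j + 1)) =
      measure Q (A \<inter> B n k j)" for n
    proof -
      have "A \<inter> B n k j = (A \<inter> B n (Suc k) (2 * j)) \<union> (A \<inter> B n (Suc k) (2 * j + 1))"
        by (auto simp: B_def of_bool_def split: if_splits)
      moreover have "(A \<inter> B n (Suc k) (2 * j)) \<inter> (A \<inter> B n (Suc k) (2 * j + 1)) = {}"
        by (auto simp: B_def)
      ultimately show ?thesis
        using A by (simp add: finite_measure_Union)
    qed
    then show "((\<lambda>n. measure Q (A \<inter> B n (Suc k) (2 * j)) + measure Q (A \<inter> B n (Suc k) (2 * j + 1)))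
        \<longlongrightarrow> l k j A) F"
      using l[OF A, of k j] by simp
  qed
  have l_empty: "l k j A = 0" if "cell X D k j = {}" and A: "A \<in> sets Q" for k j A
  proof (rule tendsto_unique[OF F l[OF A]])
    have "B n k j = {}" for n
      using that measurable_space[OF \<gamma>] by (fastforce simp: B_def cell_def)
    then show "((\<lambda>n. measure Q (A \<inter> B n k j)) \<longlongrightarrow> 0) F" by simp
  qed
  have AE_0: "AE z in Q. ennreal (p 0 0 z) = 1"
    by (rule density_unique_finite_measure)
       (auto simp: int l_0 emeasure_eq_measure)
  have AE_Suc: "AE z in Q. ennreal (p (Suc k) (2 * j) z + p (Suc k) (2 * j + 1) z) = ennreal (p k j z)" for k j
  proof (rule density_unique_finite_measure)
    fix A assume A: "A \<in> sets Q"
    have "(\<integral>\<^sup>+z\<in>A. ennreal (p (Suc k) (2 * j) z + p (Suc k) (2 * j + 1) z) \<partial>Q) =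
       (\<integral>\<^sup>+z\<in>A. ennreal (p (Suc k) (2 * j) z) \<partial>Q) + (\<integral>\<^sup>+z\<in>A. ennreal (p (Suc k) (2 * j + 1) z) \<partial>Q)"
      using A p0 by (subst nn_integral_add[symmetric]) (auto simp: distrib_right ennreal_plus)
    also have "\<dots> = ennreal (l k j A)"
      unfolding int[OF A] using l0[OF A] l_Suc[OF A, of k j] by (simp flip: ennreal_plus)
    finally show "(\<integral>\<^sup>+z\<in>A. ennreal (p (Suc k) (2 * j) z + p (Suc k) (2 * j + 1) z) \<partial>Q) =
       (\<integral>\<^sup>+z\<in>A. ennreal (p k j z) \<partial>Q)" by (simp add: int[OF A])
  qed auto
  have AE_empty: "AE z in Q. cell X D k j = {} \<longrightarrow> ennreal (p k j z) = 0" for k j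
  proof (cases "cell X D k j = {}")
    case True
    have "AE z in Q. ennreal (p k j z) = 0"
      by (rule density_unique_finite_measure) (auto simp: int l_empty[OF True])
    then show ?thesis by simp
  qed simp
  have AE: "AE z in Q. ennreal (p 0 0 z) = 1 \<and>
     (\<forall>k j. ennreal (p (Suc k) (2 * j) z + p (Suc k) (2 * j + 1) z) = ennreal (p k j z)) \<and>
     (\<forall>k j. cell X D k j = {} \<longrightarrow> ennreal (p k j z) = 0)"
    using AE_0 AE_Suc AE_empty by (simp add: AE_all_countable)
  show ?thesis
  proof (rule that[of p])
    fix k j
    show "finite_measure (density Q (\<lambda>z. ennreal (p k j z)))"
      by (rule finite_measureI) (simp add: em)
    fix A assume A: "A \<in> sets Q"
    have "measure (density Q (\<lambda>z. ennreal (p k j z))) A = l k j A"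
      using em[OF A] l0[OF A] by (simp add: measure_def)
    then show "((\<lambda>n. measure Q (A \<inter> {z \<in> space Q. code D k (\<gamma> n z) = j})) \<longlongrightarrow>
         measure (density Q (\<lambda>z. ennreal (p k j z))) A) F"
      using l[OF A, of k j] by (simp add: B_def)
  next
    show "AE z in Q. (\<forall>k. (\<Sum>j<2 ^ k. p k j z) = 1) \<and>
       (\<forall>k j. p (Suc k) (2 * j) z + p (Suc k) (2 * j + 1) z = p k j z) \<and>
       (\<forall>k j. cell X D k j = {} \<longrightarrow> p k j z = 0)"
      using AE
    proof (eventually_elim, intro conjI)
      fix z assume a: "ennreal (p 0 0 z) = 1 \<and>
        (\<forall>k j. ennreal (p (Suc k) (2 * j) z + p (Suc k) (2 * j + 1) z) = ennreal (p k j z)) \<and>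
        (\<forall>k j. cell X D k j = {} \<longrightarrow> ennreal (p k j z) = 0)"
      have s: "p (Suc k) (2 * j) z + p (Suc k) (2 * j + 1) z = p k j z" for k j
        using a p0 by (metis add_nonneg_nonneg ennreal_inj)
      then show "\<forall>k j. p (Suc k) (2 * j) z + p (Suc k) (2 * j + 1) z = p k j z" by blast
      show "\<forall>k j. cell X D k j = {} \<longrightarrow> p k j z = 0"
        using a p0 by (metis ennreal_0 ennreal_inj order_refl)
      have sum: "(\<Sum>j<2 * n. p (Suc k) j z) = (\<Sum>j<n. p k j z)" for k n
        by (induction n) (use s in \<open>auto simp: add.assoc\<close>)
      show "\<forall>k. (\<Sum>j<2 ^ k. p k j z) = 1"
      proof
        fix k show "(\<Sum>j<2 ^ k. p k j z) = 1"
        proof (induction k)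
          case 0
          have "p 0 0 z = 1" using a p0[of 0 0 z] by (metis ennreal_1 ennreal_inj zero_le_one)
          then show ?case by simp
        next
          case (Suc k)
          then show ?case using sum[of k "2 ^ k"] by simp
        qed
      qed
    qed
  qed (use p p0 in auto)
qed

text \<open>
  The limit of the maps \<open>\<gamma> n\<close> as a randomised map: \<open>p k j z\<close> is the limiting conditional probability
  that \<open>\<gamma> n z\<close> lies in cell \<open>j\<close> of level \<open>k\<close>, \<open>\<kappa> k z \<xi>\<close> is the cell sampled by the uniform variable
  \<open>\<xi>\<close>, and \<open>G z \<xi>\<close> is the point to which the sampled cells shrink.  The conditional law of \<open>G z\<close> given
  \<open>z\<close> is the limit of \<open>\<gamma> n\<close> in the sense of Young measures.
\<close>

definition young_limit ::
  "'u topology \<Rightarrow> (nat \<Rightarrow> 'u set) \<Rightarrow> 'y measure \<Rightarrow> 'n filter \<Rightarrow> ('n \<Rightarrow> 'y \<Rightarrow> 'u) \<Rightarrow>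
   (nat \<Rightarrow> 'y \<Rightarrow> real \<Rightarrow> nat) \<Rightarrow> (nat \<Rightarrow> nat \<Rightarrow> 'y \<Rightarrow> real) \<Rightarrow> ('y \<Rightarrow> real \<Rightarrow> 'u) \<Rightarrow> bool" where
  "young_limit X D Q F \<gamma> \<kappa> p G \<longleftrightarrow>
     (\<forall>k j. p k j \<in> borel_measurable Q) \<and>
     (\<forall>k j. finite_measure (density Q (\<lambda>z. ennreal (p k j z)))) \<and>
     (\<forall>k j. \<forall>A\<in>sets Q.
        ((\<lambda>n. measure Q (A \<inter> {z \<in> space Q. code D k (\<gamma> n z) = j})) \<longlongrightarrow>
          measure (density Q (\<lambda>z. ennreal (p k j z))) A) F) \<and>
     (\<forall>k. (\<lambda>(z, \<xi>). \<kappa> k z \<xi>) \<in> measurable (Q \<Otimes>\<^sub>M uniform01) (count_space UNIV)) \<and>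
     (\<lambda>(z, \<xi>). G z \<xi>) \<in> measurable (Q \<Otimes>\<^sub>M uniform01) (borel_of_top X) \<and>
     (AE z in Q. \<forall>k. \<forall>j<2 ^ k.
        emeasure uniform01 {\<xi> \<in> space uniform01. \<kappa> k z \<xi> = j} = ennreal (p k j z)) \<and>
     (AE z in Q. AE \<xi> in uniform01. branch X D (\<lambda>k. \<kappa> k z \<xi>) \<and>
        branch_converges X D (\<lambda>k. \<kappa> k z \<xi>) (G z \<xi>) \<and> (\<forall>k. \<kappa> k z \<xi> < 2 ^ k))"

text \<open>
  The sampled cells form a branch for almost every \<open>z\<close> and every \<open>\<xi>\<close>.  What remains is that the
  branch enters one of the compact sets \<open>D (s r)\<close>.  The probability \<open>q r z\<close> that the cell of level
  \<open>s r + 1\<close> misses \<open>D (s r)\<close> has integral at most \<open>e r\<close>, so its infimum over \<open>r\<close> is zero for almost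
  every \<open>z\<close>, and then almost no \<open>\<xi>\<close> misses all of these sets.
\<close>

lemma (in coded_space) young_limit_exists:
  fixes \<gamma> :: "nat \<Rightarrow> 'y \<Rightarrow> 'u" and e :: "nat \<Rightarrow> ennreal"
  assumes Q: "prob_space Q" and \<gamma>[measurable]: "\<And>n. \<gamma> n \<in> measurable Q (borel_of_top X)"
    and F: "F \<noteq> bot"
    and conv: "\<And>k j A. A \<in> sets Q \<Longrightarrow>
      \<exists>l. ((\<lambda>n. measure Q (A \<inter> {z \<in> space Q. code D k (\<gamma> n z) = j})) \<longlongrightarrow> l) F"
    and compact: "\<And>r. compactin X (D (s r))"
    and tight: "\<And>n r. emeasure Q {z \<in> space Q. \<gamma> n z \<notin> D (s r)} \<le> e r"
    and e: "e \<longlonglongrightarrow> 0" and x0: "x0 \<in> topspace X"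
  shows "\<exists>\<kappa> p G. young_limit X D Q F \<gamma> \<kappa> p G"
proof -
  interpret prob_space Q by fact
  interpret U: prob_space uniform01 by (rule prob_space_uniform01)
  note D_sets[measurable]
  obtain p :: "nat \<Rightarrow> nat \<Rightarrow> 'y \<Rightarrow> real" where
    p[measurable]: "\<And>k j. p k j \<in> borel_measurable Q" and p0: "\<And>k j z. 0 \<le> p k j z"
    and pfin: "\<And>k j. finite_measure (density Q (\<lambda>z. ennreal (p k j z)))"
    and plim: "\<And>k j A. A \<in> sets Q \<Longrightarrow>
       ((\<lambda>n. measure Q (A \<inter> {z \<in> space Q. code D k (\<gamma> n z) = j})) \<longlongrightarrow>
         measure (density Q (\<lambda>z. ennreal (p k j z))) A) F"
    and tree: "AE z in Q. (\<forall>k. (\<Sum>j<2 ^ k. p k j z) = 1) \<and>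
       (\<forall>k j. p (Suc k) (2 * j) z + p (Suc k) (2 * j + 1) z = p k j z) \<and>
       (\<forall>k j. cell X D k j = {} \<longrightarrow> p k j z = 0)"
    by (rule weak_limit_cell_densities[OF Q \<gamma> F conv], assumption, rule that, blast+)
  define \<kappa> where "\<kappa> k z \<xi> = quantile_index (\<lambda>j. p k j z) \<xi>" for k z \<xi>
  have \<kappa>: "(\<lambda>(z, \<xi>). \<kappa> k z \<xi>) \<in> measurable (Q \<Otimes>\<^sub>M uniform01) (count_space UNIV)" for k
    unfolding \<kappa>_def by (rule measurable_quantile_index[OF p])
  have \<kappa>z: "(\<lambda>\<xi>. \<kappa> k z \<xi>) \<in> measurable uniform01 (count_space UNIV)" if "z \<in> space Q" for k z
    using measurable_compose[OF measurable_Pair1'[OF that] \<kappa>] by simp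
  define good where "good z \<xi> \<longleftrightarrow> (\<exists>r. odd (\<kappa> (Suc (s r)) z \<xi>))" for z \<xi>
  define g where "g z \<xi> = (SOME x. branch_converges X D (\<lambda>k. \<kappa> k z \<xi>) x)" for z \<xi>
  have g: "branch_converges X D (\<lambda>k. \<kappa> k z \<xi>) (g z \<xi>)"
    if br: "branch X D (\<lambda>k. \<kappa> k z \<xi>)" and "good z \<xi>" for z \<xi>
  proof -
    obtain r where r: "odd (\<kappa> (Suc (s r)) z \<xi>)" using \<open>good z \<xi>\<close> by (auto simp: good_def)
    have "cell X D (Suc (s r)) (\<kappa> (Suc (s r)) z \<xi>) \<subseteq> D (s r)"
    proof
      fix u assume "u \<in> cell X D (Suc (s r)) (\<kappa> (Suc (s r)) z \<xi>)"
      then have "code D (Suc (s r)) u = \<kappa> (Suc (s r)) z \<xi>" by (simp add: cell_def)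
      with r have "odd (code D (Suc (s r)) u)" by simp
      then show "u \<in> D (s r)" by (auto split: if_splits)
    qed
    then have "\<exists>x. branch_converges X D (\<lambda>k. \<kappa> k z \<xi>) x"
      using branch_in_compact_converges[OF Hausdorff base br compact] by blast
    then show ?thesis unfolding g_def by (rule someI_ex)
  qed
  \<comment> \<open>On the null set of exceptional pairs any fixed action will do.\<close>
  define G where "G z \<xi> = (if branch X D (\<lambda>k. \<kappa> k z \<xi>) \<and> good z \<xi> then g z \<xi> else x0)" for z \<xi>
  have \<kappa>': "(\<lambda>a. \<kappa> k (fst a) (snd a)) \<in> measurable (Q \<Otimes>\<^sub>M uniform01) (count_space UNIV)" for k
    using \<kappa>[of k] by (simp only: case_prod_unfold)
  have "(\<lambda>a. if branch X D (\<lambda>k. \<kappa> k (fst a) (snd a)) \<and> good (fst a) (snd a) then g (fst a) (snd a) else x0)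
    \<in> measurable (Q \<Otimes>\<^sub>M uniform01) (borel_of_top X)"
  proof (rule measurable_branch_limit[OF \<kappa>' _ _ x0])
    have [measurable]: "Measurable.pred (Q \<Otimes>\<^sub>M uniform01) (\<lambda>a. odd (\<kappa> (Suc (s r)) (fst a) (snd a)))" for r
      by (rule pred_count_space[OF \<kappa>'])
    show "Measurable.pred (Q \<Otimes>\<^sub>M uniform01) (\<lambda>a. good (fst a) (snd a))"
      unfolding good_def by measurable
  qed (auto intro: g)
  then have G: "(\<lambda>(z, \<xi>). G z \<xi>) \<in> measurable (Q \<Otimes>\<^sub>M uniform01) (borel_of_top X)"
    by (simp only: G_def case_prod_unfold)
  \<comment> \<open>The even codes of level \<open>s r + 1\<close> are those of the points outside \<open>D (s r)\<close>.\<close>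
  define q where "q r z = (\<Sum>j<2 ^ s r. p (Suc (s r)) (2 * j) z)" for r z
  have q0: "0 \<le> q r z" for r z unfolding q_def by (intro sum_nonneg p0)
  have q[measurable]: "q r \<in> borel_measurable Q" for r
    unfolding q_def by measurable
  have q_le: "(\<integral>\<^sup>+z. ennreal (q r z) \<partial>Q) \<le> e r" for r
  proof (cases "e r = \<infinity>")
    case False
    define W where "W n j = {z \<in> space Q. code D (Suc (s r)) (\<gamma> n z) = 2 * j}" for n j
    have W[measurable]: "W n j \<in> sets Q" for n j unfolding W_def by measurable
    let ?P = "\<lambda>j. density Q (\<lambda>z. ennreal (p (Suc (s r)) (2 * j) z))"
    have "((\<lambda>n. \<Sum>j<2 ^ s r. measure Q (space Q \<inter> W n j)) \<longlongrightarrow>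
        (\<Sum>j<2 ^ s r. measure (?P j) (space Q))) F"
      unfolding W_def by (intro tendsto_sum plim) auto
    moreover have "(\<Sum>j<2 ^ s r. measure Q (space Q \<inter> W n j)) \<le> enn2real (e r)" for n
    proof -
      have "(\<Sum>j<2 ^ s r. measure Q (space Q \<inter> W n j)) = measure Q (\<Union>j<2 ^ s r. W n j)"
      proof -
        have "space Q \<inter> W n j = W n j" for j unfolding W_def by blast
        moreover have "disjoint_family_on (W n) {..<2 ^ s r}"
          unfolding W_def disjoint_family_on_def by auto
        ultimately show ?thesis by (simp add: finite_measure_finite_Union image_subset_iff)
      qed
      also have "\<dots> \<le> measure Q {z \<in> space Q. \<gamma> n z \<notin> D (s r)}"
      proof (intro finite_measure_mono)
        have "u \<notin> D (s r)" if "code D (Suc (s r)) u = 2 * j" for u j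
        proof
          assume "u \<in> D (s r)"
          then have "odd (code D (Suc (s r)) u)" by simp
          with that show False by simp
        qed
        then show "(\<Union>j<2 ^ s r. W n j) \<subseteq> {z \<in> space Q. \<gamma> n z \<notin> D (s r)}"
          unfolding W_def by blast
      qed measurable
      also have "\<dots> \<le> enn2real (e r)"
        using tight[of n r] False by (simp add: measure_def enn2real_mono top.not_eq_extremum)
      finally show ?thesis .
    qed
    ultimately have le: "(\<Sum>j<2 ^ s r. measure (?P j) (space Q)) \<le> enn2real (e r)"
      by (intro tendsto_upperbound[OF _ _ F]) auto
    have "(\<integral>\<^sup>+z. ennreal (q r z) \<partial>Q) = (\<Sum>j<2 ^ s r. \<integral>\<^sup>+z. ennreal (p (Suc (s r)) (2 * j) z) \<partial>Q)"
      unfolding q_def by (subst nn_integral_sum[symmetric]) (auto simp: p0)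
    also have "\<dots> = (\<Sum>j<2 ^ s r. emeasure (?P j) (space Q))"
      by (intro sum.cong refl, subst emeasure_density) (auto intro!: nn_integral_cong)
    also have "\<dots> = ennreal (\<Sum>j<2 ^ s r. measure (?P j) (space Q))"
      by (simp add: finite_measure.emeasure_eq_measure[OF pfin] sum_ennreal)
    also have "\<dots> \<le> ennreal (enn2real (e r))" using le by (rule ennreal_leI)
    also have "\<dots> = e r" using False by (simp add: ennreal_enn2real_if)
    finally show ?thesis .
  qed simp
  have "(\<integral>\<^sup>+z. (INF r. ennreal (q r z)) \<partial>Q) \<le> 0"
  proof (rule LIMSEQ_le_const[OF e])
    have "(\<integral>\<^sup>+z. (INF r. ennreal (q r z)) \<partial>Q) \<le> e r" for r
      by (rule order_trans[OF nn_integral_mono q_le[of r]]) (auto intro: INF_lower)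
    then show "\<exists>N. \<forall>n\<ge>N. (\<integral>\<^sup>+z. (INF r. ennreal (q r z)) \<partial>Q) \<le> e n" by blast
  qed
  then have q_AE: "AE z in Q. (INF r. ennreal (q r z)) = 0"
    by (subst (asm) le_zero_eq, subst (asm) nn_integral_0_iff_AE) auto
  have "young_limit X D Q F \<gamma> \<kappa> p G"
    unfolding young_limit_def
  proof (intro conjI)
    show "AE z in Q. \<forall>k. \<forall>j<2 ^ k.
       emeasure uniform01 {\<xi> \<in> space uniform01. \<kappa> k z \<xi> = j} = ennreal (p k j z)"
      using tree unfolding \<kappa>_def
    proof (eventually_elim, intro allI impI)
      fix z k j
      assume a: "(\<forall>k. (\<Sum>j<2 ^ k. p k j z) = 1) \<and>
        (\<forall>k j. p (Suc k) (2 * j) z + p (Suc k) (2 * j + 1) z = p k j z) \<and>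
        (\<forall>k j. cell X D k j = {} \<longrightarrow> p k j z = 0)" and j: "j < (2::nat) ^ k"
      show "emeasure uniform01 {\<xi> \<in> space uniform01. quantile_index (\<lambda>j. p k j z) \<xi> = j} = ennreal (p k j z)"
        by (rule emeasure_quantile_index[OF p0 _ j]) (use a in blast)
    qed
    show "AE z in Q. AE \<xi> in uniform01. branch X D (\<lambda>k. \<kappa> k z \<xi>) \<and>
       branch_converges X D (\<lambda>k. \<kappa> k z \<xi>) (G z \<xi>) \<and> (\<forall>k. \<kappa> k z \<xi> < 2 ^ k)"
      using tree q_AE AE_space
    proof eventually_elim
      case (elim z)
      then have one: "\<And>k. (\<Sum>j<2 ^ k. p k j z) = 1"
        and split: "\<And>k j. p (Suc k) (2 * j) z + p (Suc k) (2 * j + 1) z = p k j z"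
        and empty: "\<And>k j. cell X D k j = {} \<Longrightarrow> p k j z = 0"
        and z: "z \<in> space Q" by auto
      have bnd: "\<kappa> k z \<xi> < 2 ^ k" if "\<xi> \<in> space uniform01" for k \<xi>
        using quantile_index_eq_iff(1)[OF p0 one] that by (simp add: \<kappa>_def)
      have br: "branch X D (\<lambda>k. \<kappa> k z \<xi>)" if "\<xi> \<in> space uniform01" for \<xi>
        unfolding branch_def
      proof (intro allI conjI notI)
        fix k
        show "\<kappa> (Suc k) z \<xi> div 2 = \<kappa> k z \<xi>"
          using quantile_index_refine[OF p0 one p0 split, of \<xi> k] that by (simp add: \<kappa>_def)
        assume "cell X D k (\<kappa> k z \<xi>) = {}"
        then have "p k (\<kappa> k z \<xi>) z = 0" by (rule empty)
        then show False
          using quantile_index_eq_iff(2)[OF p0 one[of k], of \<xi> "\<kappa> k z \<xi>"] that by (auto simp: \<kappa>_def)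
      qed
      have "AE \<xi> in uniform01. good z \<xi>"
      proof -
        have E[measurable]: "{\<xi> \<in> space uniform01. \<kappa> k z \<xi> = j} \<in> sets uniform01" for k j
          using pred_count_space[OF \<kappa>z[OF z]] by (simp add: pred_def)
        let ?bad = "{\<xi> \<in> space uniform01. \<not> good z \<xi>}"
        have [measurable]: "Measurable.pred uniform01 (\<lambda>\<xi>. odd (\<kappa> (Suc (s r)) z \<xi>))" for r
          by (rule pred_count_space[OF \<kappa>z[OF z]])
        have bad: "?bad \<in> sets uniform01" unfolding good_def by measurable
        have "emeasure uniform01 ?bad \<le> ennreal (q r z)" for r
        proof -
          have "?bad \<subseteq> (\<Union>j<2 ^ s r. {\<xi> \<in> space uniform01. \<kappa> (Suc (s r)) z \<xi> = 2 * j})"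
          proof
            fix \<xi> assume "\<xi> \<in> ?bad"
            then have \<xi>: "\<xi> \<in> space uniform01" "even (\<kappa> (Suc (s r)) z \<xi>)" by (auto simp: good_def)
            then obtain j where "\<kappa> (Suc (s r)) z \<xi> = 2 * j" by (auto elim: evenE)
            with bnd[OF \<xi>(1), of "Suc (s r)"] \<xi>(1)
            show "\<xi> \<in> (\<Union>j<2 ^ s r. {\<xi> \<in> space uniform01. \<kappa> (Suc (s r)) z \<xi> = 2 * j})" by auto
          qed
          then have "emeasure uniform01 ?bad \<le>
              (\<Sum>j<2 ^ s r. emeasure uniform01 {\<xi> \<in> space uniform01. \<kappa> (Suc (s r)) z \<xi> = 2 * j})"
            by (intro order_trans[OF emeasure_mono emeasure_subadditive_finite])
               (auto simp del: space_uniform01 intro!: E)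
          also have "\<dots> = (\<Sum>j<2 ^ s r. ennreal (p (Suc (s r)) (2 * j) z))"
            using emeasure_quantile_index[OF p0 one] by (intro sum.cong refl) (simp add: \<kappa>_def)
          also have "\<dots> = ennreal (q r z)" by (simp add: q_def sum_ennreal p0)
          finally show ?thesis .
        qed
        then have "emeasure uniform01 ?bad \<le> (INF r. ennreal (q r z))" by (rule INF_greatest)
        then have "emeasure uniform01 ?bad = 0" using elim by simp
        with bad show ?thesis by (intro AE_I[where N = ?bad]) auto
      qed
      then show ?case
        using AE_space
      proof eventually_elim
        case (elim \<xi>)
        then show ?case using br[of \<xi>] bnd[of \<xi>] g[of z \<xi>] by (simp add: G_def)
      qed
    qed
  qed (use p p0 pfin plim \<kappa> G in auto)
  then show ?thesis by blast
qed

section \<open>Setwise limits under a product measure\<close>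

text \<open>
  The integrands are approximated from below by simple functions, for which setwise convergence of
  the measures suffices; monotone convergence then recovers the integrands.
\<close>

lemma setwise_limit_nn_integral_le:
  fixes \<nu> :: "'n \<Rightarrow> 'j \<Rightarrow> 'a measure" and V :: ennreal
  assumes J: "finite J" and fin: "\<And>n j. j \<in> J \<Longrightarrow> finite_measure (\<nu> n j)" "\<And>j. j \<in> J \<Longrightarrow> finite_measure (\<nu>' j)"
    and sets: "\<And>n j. j \<in> J \<Longrightarrow> sets (\<nu> n j) = sets M" "\<And>j. j \<in> J \<Longrightarrow> sets (\<nu>' j) = sets M"
    and lim: "\<And>j S. j \<in> J \<Longrightarrow> S \<in> sets M \<Longrightarrow> ((\<lambda>n. measure (\<nu> n j) S) \<longlongrightarrow> measure (\<nu>' j) S) F"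
    and F: "F \<noteq> bot" and a: "\<And>j. j \<in> J \<Longrightarrow> a j \<in> borel_measurable M"
    and le: "\<And>n. (\<Sum>j\<in>J. \<integral>\<^sup>+x. a j x \<partial>\<nu> n j) \<le> v n" and v: "(v \<longlongrightarrow> V) F"
  shows "(\<Sum>j\<in>J. \<integral>\<^sup>+x. a j x \<partial>\<nu>' j) \<le> V"
proof -
  let ?R = "\<lambda>j s. (\<forall>i. simple_function M (s i)) \<and> incseq s \<and> (\<forall>i x. s i x < top) \<and>
      (\<forall>x. (SUP i. s i x) = a j x)"
  define s where "s j = (SOME s. ?R j s)" for j
  have ex: "\<exists>s. ?R j s" if "j \<in> J" for j
    by (rule borel_measurable_implies_simple_function_sequence'[OF a[OF that]]) blast
  have "?R j (s j)" if "j \<in> J" for j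
    unfolding s_def by (rule someI_ex[OF ex[OF that]])
  then have s: "\<And>j i. j \<in> J \<Longrightarrow> simple_function M (s j i)" "\<And>j. j \<in> J \<Longrightarrow> incseq (s j)"
      "\<And>j i x. j \<in> J \<Longrightarrow> s j i x < top" "\<And>j x. j \<in> J \<Longrightarrow> (SUP i. s j i x) = a j x"
    by blast+
  have s_le: "s j i x \<le> a j x" if "j \<in> J" for j i x
    using s(4)[OF that, of x] by (metis SUP_upper UNIV_I)
  have simple: "simple_function N (s j i)" if "j \<in> J" "sets N = sets M" for N j i
    using s(1)[OF that(1)] simple_function_cong_algebra[OF that(2)] sets_eq_imp_space_eq[OF that(2)] by blast
  have int: "(\<integral>\<^sup>+x. s j i x \<partial>N) = (\<Sum>y\<in>s j i ` space M. y * ennreal (measure N (s j i -` {y} \<inter> space M)))"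
    if "j \<in> J" "sets N = sets M" "finite_measure N" for N j i
  proof -
    have "(\<integral>\<^sup>+x. s j i x \<partial>N) = (\<integral>\<^sup>Sx. s j i x \<partial>N)"
      using simple[OF that(1,2)] by (rule nn_integral_eq_simple_integral)
    then show ?thesis
      using sets_eq_imp_space_eq[OF that(2)]
      by (simp add: simple_integral_def finite_measure.emeasure_eq_measure[OF that(3)])
  qed
  have bound: "(\<Sum>j\<in>J. \<integral>\<^sup>+x. s j i x \<partial>\<nu>' j) \<le> V" for i
  proof (rule tendsto_le[OF F v])
    show "((\<lambda>n. \<Sum>j\<in>J. \<integral>\<^sup>+x. s j i x \<partial>\<nu> n j) \<longlongrightarrow> (\<Sum>j\<in>J. \<integral>\<^sup>+x. s j i x \<partial>\<nu>' j)) F"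
    proof (rule tendsto_sum)
      fix j assume j: "j \<in> J"
      show "((\<lambda>n. \<integral>\<^sup>+x. s j i x \<partial>\<nu> n j) \<longlongrightarrow> (\<integral>\<^sup>+x. s j i x \<partial>\<nu>' j)) F"
        unfolding int[OF j sets(1)[OF j] fin(1)[OF j]] int[OF j sets(2)[OF j] fin(2)[OF j]]
      proof (intro tendsto_sum ennreal_tendsto_cmult tendsto_ennrealI lim[OF j])
        fix y assume "y \<in> s j i ` space M"
        then show "y < top" using s(3)[OF j] by auto
        show "s j i -` {y} \<inter> space M \<in> sets M"
          using s(1)[OF j] by (rule simple_functionD(2))
      qed
    qed
    show "\<forall>\<^sub>F n in F. (\<Sum>j\<in>J. \<integral>\<^sup>+x. s j i x \<partial>\<nu> n j) \<le> v n"
      by (intro always_eventually allI order_trans[OF sum_mono le] nn_integral_mono s_le)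
  qed
  have "(\<Sum>j\<in>J. \<integral>\<^sup>+x. a j x \<partial>\<nu>' j) = (\<Sum>j\<in>J. SUP i. \<integral>\<^sup>+x. s j i x \<partial>\<nu>' j)"
  proof (rule sum.cong[OF refl])
    fix j assume j: "j \<in> J"
    have "(\<integral>\<^sup>+x. (SUP i. s j i x) \<partial>\<nu>' j) = (SUP i. \<integral>\<^sup>+x. s j i x \<partial>\<nu>' j)"
      using s(2)[OF j] borel_measurable_simple_function[OF simple[OF j sets(2)[OF j]]]
      by (rule nn_integral_monotone_convergence_SUP)
    then show "(\<integral>\<^sup>+x. a j x \<partial>\<nu>' j) = (SUP i. \<integral>\<^sup>+x. s j i x \<partial>\<nu>' j)"
      by (simp add: s(4)[OF j])
  qed
  also have "\<dots> = (SUP i. \<Sum>j\<in>J. \<integral>\<^sup>+x. s j i x \<partial>\<nu>' j)"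
    by (rule ennreal_SUP_sum[symmetric]) (use s(2) in \<open>auto intro!: incseq_nn_integral\<close>)
  also have "\<dots> \<le> V" by (rule SUP_least) (rule bound)
  finally show ?thesis .
qed

lemma enn2real_prod: "enn2real (\<Prod>i\<in>I. f i) = (\<Prod>i\<in>I. enn2real (f i))"
  by (induction I rule: infinite_finite_induct) (auto simp: enn2real_mult)

lemma finite_measure_density_le_1:
  assumes "prob_space M" "h \<in> borel_measurable M" "\<And>x. h x \<le> 1"
  shows "finite_measure (density M h)"
    and "S \<in> sets M \<Longrightarrow> measure (density M h) S \<le> measure M S"
proof -
  interpret prob_space M by fact
  have le: "emeasure (density M h) S \<le> emeasure M S" if "S \<in> sets M" for S
  proof -
    have "(\<integral>\<^sup>+x. h x * indicator S x \<partial>M) \<le> (\<integral>\<^sup>+x. indicator S x \<partial>M)"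
      using assms(3) by (intro nn_integral_mono) (auto simp: indicator_def)
    then show ?thesis using that assms(2) by (simp add: emeasure_density)
  qed
  show "finite_measure (density M h)"
    using le[of "space M"] by (intro finite_measureI) (auto simp: emeasure_space_1 top_unique)
  show "S \<in> sets M \<Longrightarrow> measure (density M h) S \<le> measure M S"
    using le[of S] by (auto simp: measure_def less_top[symmetric] intro!: enn2real_mono)
qed

locale product_team =
  fixes P :: "'w measure" and Q :: "nat \<Rightarrow> 'y measure" and I :: "nat set"
  assumes P: "prob_space P" and Q: "\<And>i. prob_space (Q i)" and I: "finite I"

sublocale product_team \<subseteq> P: prob_space P by (rule P)
sublocale product_team \<subseteq> Q: product_prob_space Q I
  by (intro product_prob_space.intro product_prob_spaceI Q product_sigma_finite.intro) 
    (use Q prob_space_imp_sigma_finite in \<open>auto simp: product_sigma_finite_def product_prob_space_axioms_def\<close>)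

context product_team begin

lemma emeasure_density_PiE:
  assumes h[measurable]: "\<And>i. i \<in> I \<Longrightarrow> h i \<in> borel_measurable (Q i)" and X: "\<And>i. i \<in> I \<Longrightarrow> X i \<in> sets (Q i)"
  shows "emeasure (density (Pi\<^sub>M I Q) (\<lambda>y. \<Prod>i\<in>I. h i (y i))) (Pi\<^sub>E I X) =
    (\<Prod>i\<in>I. emeasure (density (Q i) (h i)) (X i))"
proof -
  have "emeasure (density (Pi\<^sub>M I Q) (\<lambda>y. \<Prod>i\<in>I. h i (y i))) (Pi\<^sub>E I X) =
    (\<integral>\<^sup>+y. (\<Prod>i\<in>I. h i (y i)) * indicator (Pi\<^sub>E I X) y \<partial>Pi\<^sub>M I Q)"
    using X I by (intro emeasure_density) (auto intro!: sets_PiM_I_finite borel_measurable_prod_ennreal)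
  also have "\<dots> = (\<integral>\<^sup>+y. (\<Prod>i\<in>I. h i (y i) * indicator (X i) (y i)) \<partial>Pi\<^sub>M I Q)"
  proof (rule nn_integral_cong)
    fix y assume "y \<in> space (Pi\<^sub>M I Q)"
    then have "indicator (Pi\<^sub>E I X) y = (\<Prod>i\<in>I. indicator (X i) (y i) :: ennreal)"
      using I by (auto simp: indicator_def space_PiM PiE_iff)
    then show "(\<Prod>i\<in>I. h i (y i)) * indicator (Pi\<^sub>E I X) y = (\<Prod>i\<in>I. h i (y i) * indicator (X i) (y i))"
      by (simp add: prod.distrib)
  qed
  also have "\<dots> = (\<Prod>i\<in>I. \<integral>\<^sup>+z. h i z * indicator (X i) z \<partial>Q i)"
    using X by (intro Q.product_nn_integral_prod I borel_measurable_times_ennreal borel_measurable_indicator h)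
  also have "\<dots> = (\<Prod>i\<in>I. emeasure (density (Q i) (h i)) (X i))"
    using X by (intro prod.cong refl emeasure_density[symmetric]) auto
  finally show ?thesis .
qed

lemma emeasure_density_Times:
  assumes h[measurable]: "h \<in> borel_measurable (Pi\<^sub>M I Q)"
    and A[measurable]: "A \<in> sets P" and B[measurable]: "B \<in> sets (Pi\<^sub>M I Q)"
  shows "emeasure (density (P \<Otimes>\<^sub>M Pi\<^sub>M I Q) (\<lambda>x. h (snd x))) (A \<times> B) =
    emeasure P A * emeasure (density (Pi\<^sub>M I Q) h) B"
proof -
  have "emeasure (density (P \<Otimes>\<^sub>M Pi\<^sub>M I Q) (\<lambda>x. h (snd x))) (A \<times> B) =
    (\<integral>\<^sup>+x. h (snd x) * indicator (A \<times> B) x \<partial>(P \<Otimes>\<^sub>M Pi\<^sub>M I Q))"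
    by (intro emeasure_density) auto
  also have "\<dots> = (\<integral>\<^sup>+w. \<integral>\<^sup>+y. h y * indicator (A \<times> B) (w, y) \<partial>Pi\<^sub>M I Q \<partial>P)"
    by (subst Q.nn_integral_fst[symmetric]) auto
  also have "\<dots> = (\<integral>\<^sup>+w. indicator A w * emeasure (density (Pi\<^sub>M I Q) h) B \<partial>P)"
    by (intro nn_integral_cong) (auto simp: indicator_times emeasure_density mult_ac nn_integral_cmult[symmetric])
  also have "\<dots> = emeasure P A * emeasure (density (Pi\<^sub>M I Q) h) B"
    by (simp add: nn_integral_multc)
  finally show ?thesis .
qed

lemma finite_measure_density_prod:
  assumes h[measurable]: "\<And>i. i \<in> I \<Longrightarrow> h i \<in> borel_measurable (Q i)"
    and fin: "\<And>i. i \<in> I \<Longrightarrow> finite_measure (density (Q i) (h i))"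
  shows "finite_measure (density (Pi\<^sub>M I Q) (\<lambda>y. \<Prod>i\<in>I. h i (y i)))"
    and "finite_measure (density (P \<Otimes>\<^sub>M Pi\<^sub>M I Q) (\<lambda>x. \<Prod>i\<in>I. h i (snd x i)))"
proof -
  have m: "(\<lambda>y. \<Prod>i\<in>I. h i (y i)) \<in> borel_measurable (Pi\<^sub>M I Q)"
    by (intro borel_measurable_prod_ennreal) measurable
  have "emeasure (density (Pi\<^sub>M I Q) (\<lambda>y. \<Prod>i\<in>I. h i (y i))) (Pi\<^sub>E I (\<lambda>i. space (Q i))) \<noteq> \<infinity>"
    using fin by (subst emeasure_density_PiE) (auto simp: ennreal_prod_eq_top finite_measure.emeasure_eq_measure)
  then have *: "emeasure (density (Pi\<^sub>M I Q) (\<lambda>y. \<Prod>i\<in>I. h i (y i))) (space (Pi\<^sub>M I Q)) \<noteq> \<infinity>"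
    by (simp add: space_PiM)
  then show "finite_measure (density (Pi\<^sub>M I Q) (\<lambda>y. \<Prod>i\<in>I. h i (y i)))"
    by (intro finite_measureI) simp
  show "finite_measure (density (P \<Otimes>\<^sub>M Pi\<^sub>M I Q) (\<lambda>x. \<Prod>i\<in>I. h i (snd x i)))"
    using * emeasure_density_Times[OF m sets.top sets.top]
    by (intro finite_measureI) (simp add: space_pair_measure P.emeasure_space_1)
qed

text \<open>
  For rectangles the integral is a product of one-dimensional integrals, which converge one by one.
  Rectangles are an intersection-stable generator, first of the product over \<open>I\<close> and then of the
  product with \<open>P\<close>, and densities bounded by one are dominated by the reference measure.
\<close>

lemma product_setwise_limit:
  fixes h :: "'n \<Rightarrow> nat \<Rightarrow> 'y \<Rightarrow> ennreal"
  assumes h[measurable]: "\<And>n i. i \<in> I \<Longrightarrow> h n i \<in> borel_measurable (Q i)" and h1: "\<And>n i z. h n i z \<le> 1"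
    and h'[measurable]: "\<And>i. i \<in> I \<Longrightarrow> h' i \<in> borel_measurable (Q i)"
    and fin: "\<And>i. i \<in> I \<Longrightarrow> finite_measure (density (Q i) (h' i))"
    and lim: "\<And>i A. i \<in> I \<Longrightarrow> A \<in> sets (Q i) \<Longrightarrow>
      ((\<lambda>n. measure (density (Q i) (h n i)) A) \<longlongrightarrow> measure (density (Q i) (h' i)) A) F"
    and F: "F \<noteq> bot" and S: "S \<in> sets (P \<Otimes>\<^sub>M Pi\<^sub>M I Q)"
  shows "((\<lambda>n. measure (density (P \<Otimes>\<^sub>M Pi\<^sub>M I Q) (\<lambda>x. \<Prod>i\<in>I. h n i (snd x i))) S) \<longlongrightarrow>
     measure (density (P \<Otimes>\<^sub>M Pi\<^sub>M I Q) (\<lambda>x. \<Prod>i\<in>I. h' i (snd x i))) S) F"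
proof -
  have PiM: "prob_space (Pi\<^sub>M I Q)" by (rule prob_space_PiM) (rule Q)
  interpret PQ: pair_prob_space P "Pi\<^sub>M I Q"
    using P PiM by (simp add: pair_prob_space_def pair_sigma_finite_def prob_space_imp_sigma_finite)
  have m: "(\<lambda>y. \<Prod>i\<in>I. h n i (y i)) \<in> borel_measurable (Pi\<^sub>M I Q)"
    "(\<lambda>y. \<Prod>i\<in>I. h' i (y i)) \<in> borel_measurable (Pi\<^sub>M I Q)" for n
    by (intro borel_measurable_prod_ennreal; measurable)+
  have m2: "(\<lambda>x. \<Prod>i\<in>I. h n i (snd x i)) \<in> borel_measurable (P \<Otimes>\<^sub>M Pi\<^sub>M I Q)" for n
    using measurable_compose[OF measurable_snd m(1)] by simp
  have le1: "(\<Prod>i\<in>I. h n i (y i)) \<le> 1" for n y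
    using h1 by (intro prod_le_1) auto
  have 1: "((\<lambda>n. measure (density (Pi\<^sub>M I Q) (\<lambda>y. \<Prod>i\<in>I. h n i (y i))) B) \<longlongrightarrow>
     measure (density (Pi\<^sub>M I Q) (\<lambda>y. \<Prod>i\<in>I. h' i (y i))) B) F" if B: "B \<in> sets (Pi\<^sub>M I Q)" for B
  proof (rule dominated_setwise_convergence[where G = "prod_algebra I Q", OF _ _ _ _ _ _ _ _ _ _ F B])
    show "finite_measure (Pi\<^sub>M I Q)" using PiM by (rule prob_space.finite_measure)
    show "sets (Pi\<^sub>M I Q) = sigma_sets (space (Pi\<^sub>M I Q)) (prod_algebra I Q)"
      by (simp add: sets_PiM space_PiM)
    show "space (Pi\<^sub>M I Q) \<in> prod_algebra I Q"
      using I by (auto simp: space_PiM intro!: prod_algebraI_finite)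
    fix S assume "S \<in> prod_algebra I Q"
    then obtain X where X: "S = Pi\<^sub>E I X" "\<And>i. i \<in> I \<Longrightarrow> X i \<in> sets (Q i)"
      by (auto elim!: prod_algebraE_all)
    show "((\<lambda>n. measure (density (Pi\<^sub>M I Q) (\<lambda>y. \<Prod>i\<in>I. h n i (y i))) S) \<longlongrightarrow>
     measure (density (Pi\<^sub>M I Q) (\<lambda>y. \<Prod>i\<in>I. h' i (y i))) S) F"
    proof -
      have "((\<lambda>n. \<Prod>i\<in>I. measure (density (Q i) (h n i)) (X i)) \<longlongrightarrow>
          (\<Prod>i\<in>I. measure (density (Q i) (h' i)) (X i))) F"
        by (intro tendsto_prod lim X)
      then show ?thesis
        using X by (simp add: measure_def emeasure_density_PiE enn2real_prod)
    qed
  qed (auto intro!: Int_stable_prod_algebra finite_measure_density_le_1[OF PiM m(1) le1]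
        finite_measure_density_prod(1) fin)
  let ?G = "{A \<times> B | A B. A \<in> sets P \<and> B \<in> sets (Pi\<^sub>M I Q)}"
  show ?thesis
  proof (rule dominated_setwise_convergence[where G = ?G, OF _ _ _ _ _ _ _ _ _ _ F S])
    show "sets (P \<Otimes>\<^sub>M Pi\<^sub>M I Q) = sigma_sets (space (P \<Otimes>\<^sub>M Pi\<^sub>M I Q)) ?G"
      by (simp add: sets_pair_measure space_pair_measure)
    show "space (P \<Otimes>\<^sub>M Pi\<^sub>M I Q) \<in> ?G"
      by (auto simp: space_pair_measure)
    fix S assume "S \<in> ?G"
    then obtain A B where AB: "S = A \<times> B" "A \<in> sets P" "B \<in> sets (Pi\<^sub>M I Q)" by blast
    show "((\<lambda>n. measure (density (P \<Otimes>\<^sub>M Pi\<^sub>M I Q) (\<lambda>x. \<Prod>i\<in>I. h n i (snd x i))) S) \<longlongrightarrow>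
     measure (density (P \<Otimes>\<^sub>M Pi\<^sub>M I Q) (\<lambda>x. \<Prod>i\<in>I. h' i (snd x i))) S) F"
      using tendsto_mult[OF tendsto_const 1[OF AB(3)], of "measure P A"]
        emeasure_density_Times[OF m(1) AB(2,3)] emeasure_density_Times[OF m(2) AB(2,3)]
      by (simp add: measure_def enn2real_mult AB(1))
  qed (auto intro!: Int_stable_pair_measure_generator finite_measure_density_prod(2) fin PQ.finite_measure_axioms
     finite_measure_density_le_1[OF PQ.prob_space_axioms m2 le1])
qed

end

lemma measure_density_indicator:
  assumes "B \<in> sets Q" "A \<in> sets Q"
  shows "measure (density Q (indicator B)) A = measure Q (A \<inter> B)"
  using assms by (simp add: measure_def emeasure_restricted Int_commute)

section \<open>The cost in terms of the independent reference measures\<close>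

lemma restrict_actions:
  assumes "t \<in> {1..n}"
  shows "restrict (actions n \<gamma> y) {1..<t} = actions (t - 1) \<gamma> y"
  using assms by (auto simp: actions_def fun_eq_iff)

lemma measurable_actions:
  assumes "\<gamma> \<in> team_policies N Y U" "n \<le> N" "n \<le> m"
  shows "actions n \<gamma> \<in> measurable (Pi\<^sub>M {1..m} Y) (Pi\<^sub>M {1..n} (\<lambda>t. borel_of_top (U t)))"
  unfolding actions_def
proof (rule measurable_restrict)
  fix t assume t: "t \<in> {1..n}"
  then have "\<gamma> t \<in> measurable (Y t) (borel_of_top (U t))"
    using assms by (auto simp: team_policies_def)
  moreover have "(\<lambda>y. y t) \<in> measurable (Pi\<^sub>M {1..m} Y) (Y t)"
    using t assms by (intro measurable_component_singleton) auto
  ultimately show "(\<lambda>y. \<gamma> t (y t)) \<in> measurable (Pi\<^sub>M {1..m} Y) (borel_of_top (U t))"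
    by (rule measurable_compose[rotated])
qed

text \<open>
  The density of the joint law of \<open>\<omega>\<^sub>0\<close> and the first \<open>n\<close> measurements under the policy \<open>\<gamma>\<close> with
  respect to the product of \<open>P\<close> and the reference measures.
\<close>

definition path_density ::
  "(nat \<Rightarrow> 'y \<Rightarrow> ('w, 'y, 'u) history \<Rightarrow> real) \<Rightarrow> (nat \<Rightarrow> 'y \<Rightarrow> 'u) \<Rightarrow> nat \<Rightarrow> 'w \<Rightarrow> (nat \<Rightarrow> 'y) \<Rightarrow> ennreal"
  where
  "path_density f \<gamma> n w y =
     (\<Prod>t\<in>{1..n}. ennreal (f t (y t) (w, restrict y {1..<t}, actions (t - 1) \<gamma> y)))"

text \<open>
  Here every \<open>Q i\<close> is a probability measure, also for \<open>i\<close> outside \<open>{1..N}\<close>, because the theory of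
  finite products requires \<open>\<sigma>\<close>-finite factors for all indices.
\<close>

locale reduced_team =
  fixes N :: nat and P :: "'w measure" and Y :: "nat \<Rightarrow> 'y measure" and U :: "nat \<Rightarrow> 'u topology"
    and K :: "nat \<Rightarrow> ('w, 'y, 'u) history \<Rightarrow> 'y measure" and c :: "'w \<Rightarrow> (nat \<Rightarrow> 'u) \<Rightarrow> real"
    and Q :: "nat \<Rightarrow> 'y measure" and f :: "nat \<Rightarrow> 'y \<Rightarrow> ('w, 'y, 'u) history \<Rightarrow> real"
  assumes team: "sequential_team N P Y U K c"
    and reduction: "independent_reduction N P Y U K Q f"
    and prob_Q: "\<And>i. prob_space (Q i)"
begin

lemma prob_P: "prob_space P"
  using team by (simp add: sequential_team_def)

sublocale product_team P Q "{1..N}"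
  by (intro product_team.intro prob_P prob_Q) simp

lemma sets_Q: "t \<in> {1..N} \<Longrightarrow> sets (Q t) = sets (Y t)"
  using reduction by (simp add: independent_reduction_def)

lemma sets_PiM_Q: "n \<le> N \<Longrightarrow> sets (Pi\<^sub>M {1..n} Q) = sets (Pi\<^sub>M {1..n} Y)"
  by (intro sets_PiM_cong sets_Q) auto

lemma sets_pair_Q: "n \<le> N \<Longrightarrow> sets (P \<Otimes>\<^sub>M Pi\<^sub>M {1..n} Q) = sets (P \<Otimes>\<^sub>M Pi\<^sub>M {1..n} Y)"
  by (intro sets_pair_measure_cong sets_PiM_Q refl)

lemma kernel_eq_density:
  assumes t: "t \<in> {1..N}" and h: "h \<in> space (history_space P Y U t)"
  shows "K t h = density (Q t) (\<lambda>z. ennreal (f t z h))" "sets (K t h) = sets (Y t)"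
proof -
  have "K t \<in> measurable (history_space P Y U t) (prob_algebra (Y t))"
    using team t by (simp add: sequential_team_def)
  then have "K t h \<in> space (prob_algebra (Y t))" using h by (rule measurable_space)
  then show s: "sets (K t h) = sets (Y t)" by (simp add: space_prob_algebra)
  have "(\<lambda>(z, h). f t z h) \<in> borel_measurable (Y t \<Otimes>\<^sub>M history_space P Y U t)"
    using reduction t by (simp add: independent_reduction_def)
  from measurable_Pair1[OF this h]
  have [measurable]: "(\<lambda>z. f t z h) \<in> borel_measurable (Q t)"
    by (simp add: measurable_cong_sets[OF sets_Q[OF t] refl])
  show "K t h = density (Q t) (\<lambda>z. ennreal (f t z h))"
  proof (rule measure_eqI)
    show "sets (K t h) = sets (density (Q t) (\<lambda>z. ennreal (f t z h)))"
      using s sets_Q[OF t] by simp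
    fix S assume "S \<in> sets (K t h)"
    then have S: "S \<in> sets (Y t)" "S \<in> sets (Q t)" using s sets_Q[OF t] by auto
    have "emeasure (K t h) S = (\<integral>\<^sup>+z\<in>S. ennreal (f t z h) \<partial>Q t)"
      using reduction t h S by (simp add: independent_reduction_def)
    also have "\<dots> = emeasure (density (Q t) (\<lambda>z. ennreal (f t z h))) S"
      using S by (subst emeasure_density) auto
    finally show "emeasure (K t h) S = emeasure (density (Q t) (\<lambda>z. ennreal (f t z h))) S" .
  qed
qed

lemma measurable_history:
  assumes \<gamma>: "\<gamma> \<in> team_policies N Y U" and "t \<in> {1..N}" "t \<le> Suc n"
  shows "(\<lambda>(w, y). (w, restrict y {1..<t}, actions (t - 1) \<gamma> y)) \<in>
    measurable (P \<Otimes>\<^sub>M Pi\<^sub>M {1..n} Y) (history_space P Y U t)"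
proof -
  have *: "{1..t - 1} = {1..<t}" using assms by auto
  have [measurable]: "actions (t - 1) \<gamma> \<in> measurable (Pi\<^sub>M {1..n} Y) (Pi\<^sub>M {1..<t} (\<lambda>t. borel_of_top (U t)))"
  proof -
    have "t - 1 \<le> N" "t - 1 \<le> n" using assms by auto
    from measurable_actions[OF \<gamma> this] show ?thesis by (simp only: *)
  qed
  have [measurable]: "(\<lambda>y. restrict y {1..<t}) \<in> measurable (Pi\<^sub>M {1..n} Y) (Pi\<^sub>M {1..<t} Y)"
    using assms by (intro measurable_restrict_subset) auto
  show ?thesis unfolding history_space_def by measurable
qed

lemma measurable_f:
  assumes t: "t \<in> {1..N}" and "a \<in> measurable M (Y t)" "b \<in> measurable M (history_space P Y U t)"
  shows "(\<lambda>x. f t (a x) (b x)) \<in> borel_measurable M"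
proof -
  have "(\<lambda>(z, h). f t z h) \<in> borel_measurable (Y t \<Otimes>\<^sub>M history_space P Y U t)"
    using reduction t by (simp add: independent_reduction_def)
  from measurable_compose[OF measurable_Pair[OF assms(2,3)] this] show ?thesis by simp
qed

lemma measurable_path_density:
  assumes \<gamma>: "\<gamma> \<in> team_policies N Y U" and n: "n \<le> N"
  shows "(\<lambda>(w, y). path_density f \<gamma> n w y) \<in> borel_measurable (P \<Otimes>\<^sub>M Pi\<^sub>M {1..n} Y)"
  unfolding path_density_def case_prod_unfold
proof (intro borel_measurable_prod_ennreal measurable_compose[OF _ measurable_ennreal] measurable_f)
  fix t assume t: "t \<in> {1..n}"
  then show "t \<in> {1..N}" using n by auto
  show "(\<lambda>x. snd x t) \<in> measurable (P \<Otimes>\<^sub>M Pi\<^sub>M {1..n} Y) (Y t)"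
    using t by measurable
  show "(\<lambda>x. (fst x, restrict (snd x) {1..<t}, actions (t - 1) \<gamma> (snd x))) \<in>
    measurable (P \<Otimes>\<^sub>M Pi\<^sub>M {1..n} Y) (history_space P Y U t)"
    using measurable_history[OF \<gamma>, of t n] t n by (simp add: case_prod_unfold)
qed

lemma path_density_Suc:
  assumes y: "y \<in> extensional {1..n}"
  shows "path_density f \<gamma> (Suc n) w (y(Suc n := z)) =
    path_density f \<gamma> n w y * ennreal (f (Suc n) z (w, y, actions n \<gamma> y))"
proof -
  have r: "restrict (y(Suc n := z)) {1..<Suc n} = y"
    using y by (auto simp: fun_eq_iff extensional_def)
  have a: "actions m \<gamma> (y(Suc n := z)) = actions m \<gamma> y" if "m \<le> n" for m
    using that by (auto simp: actions_def fun_eq_iff)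
  have "{1..Suc n} = insert (Suc n) {1..n}" by auto
  moreover have "(\<Prod>t\<in>{1..n}. ennreal (f t ((y(Suc n := z)) t)
        (w, restrict (y(Suc n := z)) {1..<t}, actions (t - 1) \<gamma> (y(Suc n := z))))) =
      (\<Prod>t\<in>{1..n}. ennreal (f t (y t) (w, restrict y {1..<t}, actions (t - 1) \<gamma> y)))"
  proof (rule prod.cong[OF refl])
    fix t assume t: "t \<in> {1..n}"
    have "restrict (y(Suc n := z)) {1..<t} = restrict y {1..<t}"
      using t by (auto simp: fun_eq_iff)
    then show "ennreal (f t ((y(Suc n := z)) t)
        (w, restrict (y(Suc n := z)) {1..<t}, actions (t - 1) \<gamma> (y(Suc n := z)))) =
      ennreal (f t (y t) (w, restrict y {1..<t}, actions (t - 1) \<gamma> y))"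
      using t a[of "t - 1"] by auto
  qed
  ultimately show ?thesis
    using r a[of n] by (simp add: path_density_def mult.commute)
qed

text \<open>
  Induction along the order of the decision makers: each transition multiplies the density by
  \<open>f (Suc n)\<close>, and the integral over the new measurement turns into one more factor of the product
  measure.
\<close>

lemma team_law_density:
  assumes \<gamma>: "\<gamma> \<in> team_policies N Y U" and "n \<le> N"
  shows "sets (team_law P Y K \<gamma> n) = sets (P \<Otimes>\<^sub>M Pi\<^sub>M {1..n} Y) \<and>
    (\<forall>g\<in>borel_measurable (P \<Otimes>\<^sub>M Pi\<^sub>M {1..n} Y).
      (\<integral>\<^sup>+x. g x \<partial>team_law P Y K \<gamma> n) =
      (\<integral>\<^sup>+w. \<integral>\<^sup>+y. path_density f \<gamma> n w y * g (w, y) \<partial>Pi\<^sub>M {1..n} Q \<partial>P))"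
  using \<open>n \<le> N\<close>
proof (induction n)
  case 0
  have m: "(\<lambda>w. (w, \<lambda>_. undefined)) \<in> measurable P (P \<Otimes>\<^sub>M Pi\<^sub>M {1..0} Y)"
    by (intro measurable_Pair) (auto simp: space_PiM)
  show ?case
  proof (intro conjI ballI)
    fix g :: "'w \<times> (nat \<Rightarrow> 'y) \<Rightarrow> ennreal" assume g: "g \<in> borel_measurable (P \<Otimes>\<^sub>M Pi\<^sub>M {1..0} Y)"
    show "(\<integral>\<^sup>+x. g x \<partial>team_law P Y K \<gamma> 0) =
      (\<integral>\<^sup>+w. \<integral>\<^sup>+y. path_density f \<gamma> 0 w y * g (w, y) \<partial>Pi\<^sub>M {1..0} Q \<partial>P)"
      using m g by (simp add: nn_integral_distr path_density_def PiM_empty nn_integral_count_space_finite)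
  qed simp
next
  case (Suc n)
  let ?t = "Suc n"
  have t: "?t \<in> {1..N}" "n \<le> N" using Suc.prems by auto
  have I: "{1..<Suc n} = {1..n}" by auto
  have II: "insert (Suc n) {1..n} = {1..Suc n}" by auto
  have sL[measurable_cong]: "sets (team_law P Y K \<gamma> n) = sets (P \<Otimes>\<^sub>M Pi\<^sub>M {1..n} Y)"
    and IH: "\<And>g. g \<in> borel_measurable (P \<Otimes>\<^sub>M Pi\<^sub>M {1..n} Y) \<Longrightarrow>
      (\<integral>\<^sup>+x. g x \<partial>team_law P Y K \<gamma> n) =
      (\<integral>\<^sup>+w. \<integral>\<^sup>+y. path_density f \<gamma> n w y * g (w, y) \<partial>Pi\<^sub>M {1..n} Q \<partial>P)"
    using Suc.IH t(2) by blast+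
  have spL: "space (team_law P Y K \<gamma> n) = space P \<times> space (Pi\<^sub>M {1..n} Y)"
    using sets_eq_imp_space_eq[OF sL] by (simp add: space_pair_measure)
  define L where "L = P \<Otimes>\<^sub>M Pi\<^sub>M {1..n} Y"
  define B where "B = P \<Otimes>\<^sub>M Pi\<^sub>M {1..Suc n} Y"
  define h :: "'w \<times> (nat \<Rightarrow> 'y) \<Rightarrow> ('w, 'y, 'u) history" where "h = (\<lambda>(w, y). (w, y, actions n \<gamma> y))"
  have h: "h \<in> measurable L (history_space P Y U ?t)"
  proof -
    have "(\<lambda>(w, y). (w, restrict y {1..<Suc n}, actions (Suc n - 1) \<gamma> y)) \<in> measurable L (history_space P Y U ?t)"
      unfolding L_def using t by (intro measurable_history[OF \<gamma>]) auto
    then show ?thesis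
      by (rule measurable_cong[THEN iffD1, rotated])
         (auto simp: h_def L_def space_pair_measure atLeastLessThanSuc_atLeastAtMost space_PiM PiE_restrict)
  qed
  have K: "(\<lambda>x. K ?t (h x)) \<in> measurable L (subprob_algebra (Y ?t))"
  proof -
    have "K ?t \<in> measurable (history_space P Y U ?t) (prob_algebra (Y ?t))"
      using team t(1) by (simp add: sequential_team_def)
    from measurable_compose[OF h measurable_prob_algebraD[OF this]] show ?thesis .
  qed
  have upd: "(\<lambda>(x, z). (fst x, (snd x)(Suc n := z))) \<in> measurable (L \<Otimes>\<^sub>M Y ?t) B"
  proof -
    have "{1..Suc n} = {1..n} \<union> {Suc n}" by auto
    then have [measurable]: "(\<lambda>x. (snd (fst x))(Suc n := snd x)) \<in>
        measurable ((P \<Otimes>\<^sub>M Pi\<^sub>M {1..n} Y) \<Otimes>\<^sub>M Y ?t) (Pi\<^sub>M {1..Suc n} Y)"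
      by (rule measurable_fun_upd) measurable
    show ?thesis unfolding B_def L_def case_prod_unfold by measurable
  qed
  define \<kappa> where "\<kappa> = (\<lambda>(w, y). distr (K ?t (w, y, actions n \<gamma> y)) B (\<lambda>z. (w, y(Suc n := z))))"
  have \<kappa>_eq: "\<kappa> x = distr (K ?t (h x)) B (\<lambda>z. (fst x, (snd x)(Suc n := z)))" for x
    by (cases x) (simp add: \<kappa>_def h_def)
  have \<kappa>: "\<kappa> \<in> measurable L (subprob_algebra B)"
    unfolding \<kappa>_eq[abs_def] by (rule measurable_distr2[OF upd K])
  have law: "team_law P Y K \<gamma> (Suc n) = team_law P Y K \<gamma> n \<bind> \<kappa>"
    by (simp add: \<kappa>_def B_def)
  have "space (Pi\<^sub>M {1..n} Q) \<noteq> {}" 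
    by (rule prob_space.not_empty[OF prob_space_PiM]) (rule prob_Q)
  then have ne: "space L \<noteq> {}"
    unfolding L_def space_pair_measure sets_eq_imp_space_eq[OF sets_PiM_Q[OF t(2)], symmetric]
    using P.not_empty by blast
  have sL': "sets (team_law P Y K \<gamma> n) = sets L" by (simp add: L_def sL)
  show ?case
  proof (intro conjI ballI)
    show "sets (team_law P Y K \<gamma> (Suc n)) = sets (P \<Otimes>\<^sub>M Pi\<^sub>M {1..Suc n} Y)"
      unfolding law B_def[symmetric]
      using ne by (intro sets_bind) (auto simp: \<kappa>_eq sets_eq_imp_space_eq[OF sL'])
    fix g :: "'w \<times> (nat \<Rightarrow> 'y) \<Rightarrow> ennreal" assume "g \<in> borel_measurable (P \<Otimes>\<^sub>M Pi\<^sub>M {1..Suc n} Y)"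
    then have g: "g \<in> borel_measurable B" by (simp add: B_def)
    define g' where "g' x = (\<integral>\<^sup>+z. ennreal (f ?t z (h x)) * g (fst x, (snd x)(Suc n := z)) \<partial>Q ?t)" for x
    have fm: "(\<lambda>(x, z). f ?t z (h x)) \<in> borel_measurable (L \<Otimes>\<^sub>M Y ?t)"
      unfolding case_prod_unfold
      by (rule measurable_f[OF t(1) measurable_snd measurable_compose[OF measurable_fst h]])
    have gm: "(\<lambda>(x, z). g (fst x, (snd x)(Suc n := z))) \<in> borel_measurable (L \<Otimes>\<^sub>M Y ?t)"
      using measurable_compose[OF upd g] by (simp only: case_prod_unfold)
    have prodm: "(\<lambda>(x, z). ennreal (f ?t z (h x)) * g (fst x, (snd x)(Suc n := z)))
        \<in> borel_measurable (L \<Otimes>\<^sub>M Q ?t)"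
    proof -
      have s: "sets (L \<Otimes>\<^sub>M Q ?t) = sets (L \<Otimes>\<^sub>M Y ?t)"
        by (intro sets_pair_measure_cong refl sets_Q t)
      show ?thesis
        using borel_measurable_times_ennreal[OF measurable_compose[OF fm measurable_ennreal] gm]
        unfolding measurable_cong_sets[OF s refl] by (simp only: case_prod_unfold)
    qed
    have g': "g' \<in> borel_measurable L"
      unfolding g'_def
      using Q.M.borel_measurable_nn_integral[OF prodm] by simp
    have inner: "(\<integral>\<^sup>+b. g b \<partial>\<kappa> x) = g' x" if x: "x \<in> space L" for x
    proof -
      have hx: "h x \<in> space (history_space P Y U ?t)" using measurable_space[OF h x] .
      have u: "(\<lambda>z. (fst x, (snd x)(Suc n := z))) \<in> measurable (Y ?t) B"
        using measurable_Pair2[OF upd x] by simp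
      have "(\<integral>\<^sup>+b. g b \<partial>\<kappa> x) = (\<integral>\<^sup>+z. g (fst x, (snd x)(Suc n := z)) \<partial>K ?t (h x))"
        unfolding \<kappa>_eq
      proof (rule nn_integral_distr)
        show "(\<lambda>z. (fst x, (snd x)(Suc n := z))) \<in> measurable (K ?t (h x)) B"
          using u unfolding measurable_cong_sets[OF kernel_eq_density(2)[OF t(1) hx] refl] .
      qed (use g in simp)
      also have "\<dots> = g' x"
        unfolding kernel_eq_density(1)[OF t(1) hx] g'_def
      proof (rule nn_integral_density)
        show "(\<lambda>z. ennreal (f ?t z (h x))) \<in> borel_measurable (Q ?t)"
          using measurable_Pair2[OF fm x] unfolding measurable_cong_sets[OF sets_Q[OF t(1)] refl]
          by simp
        show "(\<lambda>z. g (fst x, (snd x)(Suc n := z))) \<in> borel_measurable (Q ?t)"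
          using measurable_compose[OF u g] unfolding measurable_cong_sets[OF sets_Q[OF t(1)] refl] .
      qed
      finally show ?thesis .
    qed
    have "(\<integral>\<^sup>+x. g x \<partial>team_law P Y K \<gamma> (Suc n)) = (\<integral>\<^sup>+x. \<integral>\<^sup>+b. g b \<partial>\<kappa> x \<partial>team_law P Y K \<gamma> n)"
      unfolding law
      by (rule nn_integral_bind[OF g]) (use \<kappa> in \<open>simp only: measurable_cong_sets[OF sL' refl]\<close>)
    also have "\<dots> = (\<integral>\<^sup>+x. g' x \<partial>team_law P Y K \<gamma> n)"
      using inner by (intro nn_integral_cong) (simp add: sets_eq_imp_space_eq[OF sL'])
    also have "\<dots> = (\<integral>\<^sup>+w. \<integral>\<^sup>+y. path_density f \<gamma> n w y * g' (w, y) \<partial>Pi\<^sub>M {1..n} Q \<partial>P)"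
      using g' by (intro IH) (simp add: L_def)
    also have "\<dots> = (\<integral>\<^sup>+w. \<integral>\<^sup>+y. path_density f \<gamma> (Suc n) w y * g (w, y) \<partial>Pi\<^sub>M {1..Suc n} Q \<partial>P)"
    proof (rule nn_integral_cong)
      fix w assume w: "w \<in> space P"
      have m: "(\<lambda>y. path_density f \<gamma> (Suc n) w y * g (w, y)) \<in> borel_measurable (Pi\<^sub>M {1..Suc n} Q)"
      proof -
        have "(\<lambda>y. path_density f \<gamma> (Suc n) w y) \<in> borel_measurable (Pi\<^sub>M {1..Suc n} Y)"
          using measurable_Pair2[OF measurable_path_density[OF \<gamma> Suc.prems] w] by simp
        moreover have "(\<lambda>y. g (w, y)) \<in> borel_measurable (Pi\<^sub>M {1..Suc n} Y)"
          using measurable_Pair2[OF g[unfolded B_def] w] by simp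
        ultimately show ?thesis
          unfolding measurable_cong_sets[OF sets_PiM_Q[OF Suc.prems] refl]
          by (rule borel_measurable_times_ennreal)
      qed
      have "(\<integral>\<^sup>+y. path_density f \<gamma> (Suc n) w y * g (w, y) \<partial>Pi\<^sub>M {1..Suc n} Q) =
        (\<integral>\<^sup>+y. \<integral>\<^sup>+z. path_density f \<gamma> (Suc n) w (y(Suc n := z)) * g (w, y(Suc n := z)) \<partial>Q ?t \<partial>Pi\<^sub>M {1..n} Q)"
        using Q.product_nn_integral_insert[of "{1..n}" "Suc n", OF _ _ m[folded II]]
        unfolding II by simp
      also have "\<dots> = (\<integral>\<^sup>+y. path_density f \<gamma> n w y * g' (w, y) \<partial>Pi\<^sub>M {1..n} Q)"
      proof (rule nn_integral_cong)
        fix y assume y: "y \<in> space (Pi\<^sub>M {1..n} Q)"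
        then have ext: "y \<in> extensional {1..n}" by (auto simp: space_PiM PiE_def)
        have x: "(w, y) \<in> space L"
          unfolding L_def space_pair_measure sets_eq_imp_space_eq[OF sets_PiM_Q[OF t(2)], symmetric]
          using w y by blast
        have "(\<lambda>z. ennreal (f ?t z (h (w, y))) * g (w, y(Suc n := z))) \<in> borel_measurable (Q ?t)"
          using measurable_Pair2[OF prodm x] by simp
        then show "(\<integral>\<^sup>+z. path_density f \<gamma> (Suc n) w (y(Suc n := z)) * g (w, y(Suc n := z)) \<partial>Q ?t) =
          path_density f \<gamma> n w y * g' (w, y)"
          unfolding path_density_Suc[OF ext] g'_def
          by (simp add: h_def mult.assoc nn_integral_cmult)
      qed
      finally show "(\<integral>\<^sup>+y. path_density f \<gamma> n w y * g' (w, y) \<partial>Pi\<^sub>M {1..n} Q) =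
        (\<integral>\<^sup>+y. path_density f \<gamma> (Suc n) w y * g (w, y) \<partial>Pi\<^sub>M {1..Suc n} Q)" by simp
    qed
    finally show "(\<integral>\<^sup>+x. g x \<partial>team_law P Y K \<gamma> (Suc n)) =
       (\<integral>\<^sup>+w. \<integral>\<^sup>+y. path_density f \<gamma> (Suc n) w y * g (w, y) \<partial>Pi\<^sub>M {1..Suc n} Q \<partial>P)" .
  qed
qed

lemma measurable_reduced_cost:
  "(\<lambda>(x, u). reduced_cost N c f (fst x) (snd x) u) \<in>
     borel_measurable ((P \<Otimes>\<^sub>M Pi\<^sub>M {1..N} Y) \<Otimes>\<^sub>M Pi\<^sub>M {1..N} (\<lambda>t. borel_of_top (U t)))"
  (is "_ \<in> borel_measurable (?M \<Otimes>\<^sub>M ?U)")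
  unfolding reduced_cost_def case_prod_unfold
proof (intro borel_measurable_times borel_measurable_prod measurable_f)
  have "(\<lambda>(w, u). c w u) \<in> borel_measurable (P \<Otimes>\<^sub>M ?U)"
    using team by (simp add: sequential_team_def)
  from measurable_compose[OF _ this, of "\<lambda>x. (fst (fst x), snd x)" "?M \<Otimes>\<^sub>M ?U"]
  show "(\<lambda>x. c (fst (fst x)) (snd x)) \<in> borel_measurable (?M \<Otimes>\<^sub>M ?U)" by simp
  fix t assume t: "t \<in> {1..N}"
  show "(\<lambda>x. snd (fst x) t) \<in> measurable (?M \<Otimes>\<^sub>M ?U) (Y t)"
    using t by measurable
  have [measurable]: "(\<lambda>y. restrict y {1..<t}) \<in> measurable (Pi\<^sub>M {1..N} Y) (Pi\<^sub>M {1..<t} Y)"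
    "(\<lambda>y. restrict y {1..<t}) \<in> measurable ?U (Pi\<^sub>M {1..<t} (\<lambda>t. borel_of_top (U t)))"
    using t by (auto intro!: measurable_restrict_subset)
  show "(\<lambda>x. (fst (fst x), restrict (snd (fst x)) {1..<t}, restrict (snd x) {1..<t}))
      \<in> measurable (?M \<Otimes>\<^sub>M ?U) (history_space P Y U t)"
    unfolding history_space_def by measurable
qed

lemma reduced_cost_nonneg:
  assumes "w \<in> space P" "y \<in> space (Pi\<^sub>M {1..N} Y)" "u \<in> (\<Pi>\<^sub>E t\<in>{1..N}. topspace (U t))"
  shows "0 \<le> reduced_cost N c f w y u"
  unfolding reduced_cost_def
proof (intro mult_nonneg_nonneg prod_nonneg)
  show "0 \<le> c w u" using team assms by (simp add: sequential_team_def)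
  fix t assume t: "t \<in> {1..N}"
  have "y t \<in> space (Y t)" using assms t by (auto simp: space_PiM)
  moreover have "(w, restrict y {1..<t}, restrict u {1..<t}) \<in> space (history_space P Y U t)"
    using assms t by (fastforce simp: history_space_def space_pair_measure space_PiM PiE_iff)
  ultimately show "0 \<le> f t (y t) (w, restrict y {1..<t}, restrict u {1..<t})"
    using reduction t by (simp add: independent_reduction_def)
qed

lemma actions_in_PiE:
  assumes \<gamma>: "\<gamma> \<in> team_policies N Y U" and y: "y \<in> space (Pi\<^sub>M {1..N} Y)"
  shows "actions N \<gamma> y \<in> (\<Pi>\<^sub>E t\<in>{1..N}. topspace (U t))"
  using measurable_space[OF measurable_actions[OF \<gamma> order_refl order_refl] y] by (simp add: space_PiM)

lemma team_cost_eq_reduced: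
  assumes \<gamma>: "\<gamma> \<in> team_policies N Y U"
  shows "team_cost N P Y K c \<gamma> =
    (\<integral>\<^sup>+x. ennreal (reduced_cost N c f (fst x) (snd x) (actions N \<gamma> (snd x))) \<partial>(P \<Otimes>\<^sub>M Pi\<^sub>M {1..N} Q))"
proof -
  note [measurable] = measurable_actions[OF \<gamma> order_refl order_refl]
  have c: "(\<lambda>(w, u). c w u) \<in> borel_measurable (P \<Otimes>\<^sub>M Pi\<^sub>M {1..N} (\<lambda>t. borel_of_top (U t)))"
    using team by (simp add: sequential_team_def)
  have cm: "(\<lambda>(w, y). ennreal (c w (actions N \<gamma> y))) \<in> borel_measurable (P \<Otimes>\<^sub>M Pi\<^sub>M {1..N} Y)"
  proof -
    have "(\<lambda>x. (fst x, actions N \<gamma> (snd x))) \<in> measurable (P \<Otimes>\<^sub>M Pi\<^sub>M {1..N} Y)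
        (P \<Otimes>\<^sub>M Pi\<^sub>M {1..N} (\<lambda>t. borel_of_top (U t)))" by measurable
    from measurable_compose[OF measurable_compose[OF this c] measurable_ennreal]
    show ?thesis by (simp only: case_prod_unfold fst_conv snd_conv)
  qed
  have rm: "(\<lambda>x. ennreal (reduced_cost N c f (fst x) (snd x) (actions N \<gamma> (snd x)))) \<in>
      borel_measurable (P \<Otimes>\<^sub>M Pi\<^sub>M {1..N} Q)"
  proof -
    have "(\<lambda>x. reduced_cost N c f (fst x) (snd x) (actions N \<gamma> (snd x))) \<in> borel_measurable (P \<Otimes>\<^sub>M Pi\<^sub>M {1..N} Y)"
    proof -
      have "(\<lambda>x. (x, actions N \<gamma> (snd x))) \<in> measurable (P \<Otimes>\<^sub>M Pi\<^sub>M {1..N} Y)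
          ((P \<Otimes>\<^sub>M Pi\<^sub>M {1..N} Y) \<Otimes>\<^sub>M Pi\<^sub>M {1..N} (\<lambda>t. borel_of_top (U t)))" by measurable
      from measurable_compose[OF this measurable_reduced_cost] show ?thesis
        by (simp only: prod.case)
    qed
    then show ?thesis
      unfolding measurable_cong_sets[OF sets_pair_Q[OF order_refl] refl]
      by (rule measurable_compose[OF _ measurable_ennreal])
  qed
  have "team_cost N P Y K c \<gamma> =
    (\<integral>\<^sup>+w. \<integral>\<^sup>+y. path_density f \<gamma> N w y * ennreal (c w (actions N \<gamma> y)) \<partial>Pi\<^sub>M {1..N} Q \<partial>P)"
    using team_law_density[OF \<gamma> order_refl] cm by (simp add: team_cost_def)
  also have "\<dots> = (\<integral>\<^sup>+w. \<integral>\<^sup>+y. ennreal (reduced_cost N c f w y (actions N \<gamma> y)) \<partial>Pi\<^sub>M {1..N} Q \<partial>P)"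
  proof (intro nn_integral_cong)
    fix w y assume w: "w \<in> space P" and "y \<in> space (Pi\<^sub>M {1..N} Q)"
    then have y: "y \<in> space (Pi\<^sub>M {1..N} Y)"
      using sets_eq_imp_space_eq[OF sets_PiM_Q[OF order_refl]] by simp
    note u = actions_in_PiE[OF \<gamma> y]
    have f0: "0 \<le> f t (y t) (w, restrict y {1..<t}, actions (t - 1) \<gamma> y)" if t: "t \<in> {1..N}" for t
    proof -
      have "y t \<in> space (Y t)" using y t by (auto simp: space_PiM)
      moreover have "(w, restrict y {1..<t}, actions (t - 1) \<gamma> y) \<in> space (history_space P Y U t)"
        using measurable_space[OF measurable_history[OF \<gamma> t, of N], of "(w, y)"] w y t
        by (auto simp: space_pair_measure)
      ultimately show ?thesis using reduction t by (simp add: independent_reduction_def)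
    qed
    have "0 \<le> c w (actions N \<gamma> y)" using team w u by (simp add: sequential_team_def)
    moreover have "path_density f \<gamma> N w y =
        ennreal (\<Prod>t\<in>{1..N}. f t (y t) (w, restrict y {1..<t}, actions (t - 1) \<gamma> y))"
      unfolding path_density_def by (rule prod_ennreal) (rule f0)
    moreover have "reduced_cost N c f w y (actions N \<gamma> y) =
        c w (actions N \<gamma> y) * (\<Prod>t\<in>{1..N}. f t (y t) (w, restrict y {1..<t}, actions (t - 1) \<gamma> y))"
      unfolding reduced_cost_def
      by (intro arg_cong2[where f = "(*)"] refl prod.cong) (simp only: restrict_actions)
    ultimately show "path_density f \<gamma> N w y * ennreal (c w (actions N \<gamma> y)) =
      ennreal (reduced_cost N c f w y (actions N \<gamma> y))"
      by (simp only: ennreal_mult' mult.commute)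
  qed
  also have "\<dots> = (\<integral>\<^sup>+x. ennreal (reduced_cost N c f (fst x) (snd x) (actions N \<gamma> (snd x))) \<partial>(P \<Otimes>\<^sub>M Pi\<^sub>M {1..N} Q))"
    by (subst Q.nn_integral_fst[OF rm, symmetric]) simp
  finally show ?thesis .
qed

end

section \<open>Bounding the cost from below on cells\<close>

lemma coded_space_exists:
  assumes X: "second_countable X" "regular_space X" "Hausdorff_space X"
    and C: "\<And>r. compactin X (C r)"
  obtains D where "coded_space X D" "\<And>r. D (2 * r + 1) = C r"
proof -
  obtain \<B> where \<B>: "countable \<B>" "\<And>V. V \<in> \<B> \<Longrightarrow> openin X V"
    "\<And>U x. openin X U \<Longrightarrow> x \<in> U \<Longrightarrow> \<exists>V\<in>\<B>. x \<in> V \<and> V \<subseteq> U"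
    using X(1) unfolding second_countable_def by metis
  define B where "B = from_nat_into (insert {} \<B>)"
  have rB: "range B = insert {} \<B>"
    unfolding B_def using \<B>(1) by (intro range_from_nat_into) auto
  \<comment> \<open>The base sits at even and the compact sets at odd positions.\<close>
  define D where "D k = (if even k then B (k div 2) else C (k div 2))" for k
  have Bo: "openin X (B k)" for k
    using rB \<B>(2) by (metis insertE openin_empty rangeI)
  show ?thesis
  proof
    show "coded_space X D"
    proof
      show "contains_base X D"
        unfolding contains_base_def
      proof (intro allI impI)
        fix V x assume "openin X V \<and> x \<in> V"
        then obtain W where W: "W \<in> \<B>" "x \<in> W" "W \<subseteq> V" using \<B>(3) by blast
        then obtain k where "W = B k" using rB by blast
        then show "\<exists>j. openin X (D j) \<and> x \<in> D j \<and> D j \<subseteq> V"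
          using W Bo by (intro exI[of _ "2 * k"]) (simp add: D_def)
      qed
      show "D k \<in> sets (borel_of_top X)" for k
        unfolding D_def using Bo C compactin_imp_closedin[OF X(3)]
        by (auto intro: borel_of_top_open borel_of_top_closed)
    qed (use X in auto)
  qed (simp add: D_def)
qed

lemma countable_dense_subset:
  assumes "second_countable X" "E \<subseteq> topspace X"
  obtains S where "countable S" "S \<subseteq> E" "E \<subseteq> X closure_of S"
proof -
  have "separable_space (subtopology X E)"
    using assms(1) by (intro second_countable_imp_separable_space second_countable_subtopology)
  then obtain S where S: "countable S" "S \<subseteq> topspace (subtopology X E)"
    "subtopology X E closure_of S = topspace (subtopology X E)"
    unfolding separable_space_def by blast
  have "S \<subseteq> E" using S(2) by auto
  then have "E \<inter> S = S" by blast
  then have "E \<subseteq> X closure_of S"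
    using S(3) assms(2) by (simp add: closure_of_subtopology) blast
  with S(1) \<open>S \<subseteq> E\<close> show ?thesis by (rule that)
qed

text \<open>
  By continuity the infimum of the cost over a product of cells may be taken over a countable dense
  subset, and it is then measurable in the remaining variables.
\<close>

lemma INF_dense_PiE_le:
  fixes g :: "('i \<Rightarrow> 'u) \<Rightarrow> real"
  assumes g: "continuous_map (product_topology X I) euclideanreal g"
    and dense: "\<And>i. i \<in> I \<Longrightarrow> E i \<subseteq> X i closure_of S i"
    and u: "u \<in> Pi\<^sub>E I E" and "0 \<le> g u"
  shows "(INF v\<in>Pi\<^sub>E I S. ennreal (g v)) \<le> ennreal (g u)"
proof (rule ennreal_le_epsilon)
  fix e :: real assume e: "0 < e"
  have "u \<in> product_topology X I closure_of (Pi\<^sub>E I S)"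
    using u dense by (auto simp: closure_of_product_topology PiE_iff)
  then have "g u \<in> closure (g ` Pi\<^sub>E I S)"
    using continuous_map_image_closure_subset[OF g] by auto
  then obtain v where v: "v \<in> Pi\<^sub>E I S" "dist (g v) (g u) < e"
    using e unfolding closure_approachable by blast
  have "(INF v\<in>Pi\<^sub>E I S. ennreal (g v)) \<le> ennreal (g v)" using v(1) by (rule INF_lower)
  also have "\<dots> \<le> ennreal (g u + e)" using v(2) by (intro ennreal_leI) (auto simp: dist_real_def)
  also have "\<dots> = ennreal (g u) + ennreal e" using e \<open>0 \<le> g u\<close> by (intro ennreal_plus) auto
  finally show "(INF v\<in>Pi\<^sub>E I S. ennreal (g v)) \<le> ennreal (g u) + ennreal e" .
qed

text \<open>
  A neighbourhood of \<open>u\<close> on which \<open>g\<close> stays above a number below \<open>g u\<close> contains a box of open sets;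
  each coordinate branch ends up in its side of the box.
\<close>

lemma le_liminf_INF_cells:
  fixes g :: "('i \<Rightarrow> 'u) \<Rightarrow> real"
  assumes g: "continuous_map (product_topology X I) euclideanreal g" and I: "finite I"
    and br: "\<And>i. i \<in> I \<Longrightarrow> branch (X i) (D i) (\<kappa> i)"
    and conv: "\<And>i. i \<in> I \<Longrightarrow> branch_converges (X i) (D i) (\<kappa> i) (u i)"
    and u: "u \<in> extensional I"
    and S: "\<And>i k. i \<in> I \<Longrightarrow> S k i \<subseteq> cell (X i) (D i) k (\<kappa> i k)"
  shows "ennreal (g u) \<le> liminf (\<lambda>k. INF v\<in>Pi\<^sub>E I (S k). ennreal (g v))"
  unfolding le_Liminf_iff
proof (intro allI impI)
  fix y :: ennreal assume y: "y < ennreal (g u)"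
  then obtain b where b: "y = ennreal b" "0 \<le> b" by (cases y) auto
  then have "b < g u" using y by (simp add: ennreal_less_iff)
  then obtain b' where b': "b < b'" "b' < g u" using dense by blast
  define W where "W = {v \<in> topspace (product_topology X I). g v \<in> {b'<..}}"
  have "openin (product_topology X I) W"
    unfolding W_def by (rule openin_continuous_map_preimage[OF g]) auto
  moreover have "u \<in> topspace (product_topology X I)"
    using conv u by (auto simp: branch_converges_def PiE_iff)
  then have "u \<in> W" using b' by (simp add: W_def)
  ultimately obtain V where V: "\<And>i. i \<in> I \<Longrightarrow> openin (X i) (V i)" "u \<in> Pi\<^sub>E I V" "Pi\<^sub>E I V \<subseteq> W"
    unfolding openin_product_topology_alt by metis
  have "\<exists>k. cell (X i) (D i) k (\<kappa> i k) \<subseteq> V i" if "i \<in> I" for i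
    using conv[OF that] V(1)[OF that] V(2) that by (auto simp: branch_converges_def PiE_iff)
  then obtain k where k: "\<And>i. i \<in> I \<Longrightarrow> cell (X i) (D i) (k i) (\<kappa> i (k i)) \<subseteq> V i" by metis
  define m where "m = Max (insert 0 (k ` I))"
  have m: "k i \<le> m" if "i \<in> I" for i
    unfolding m_def using I that by (intro Max_ge) auto
  have "y < (INF v\<in>Pi\<^sub>E I (S n). ennreal (g v))" if n: "m \<le> n" for n
  proof -
    have "y < ennreal b'" using b b' by (simp add: ennreal_less_iff)
    also have "ennreal b' \<le> (INF v\<in>Pi\<^sub>E I (S n). ennreal (g v))"
    proof (rule INF_greatest)
      fix v assume v: "v \<in> Pi\<^sub>E I (S n)"
      have "v i \<in> V i" if i: "i \<in> I" for i
        using v i S[OF i, of n] branch_antimono[OF br[OF i], of "k i" n] k[OF i] m[OF i] n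
        by (force simp: PiE_iff)
      then have "v \<in> Pi\<^sub>E I V" using v by (auto simp: PiE_iff)
      then have "v \<in> W" using V(3) by blast
      then show "ennreal b' \<le> ennreal (g v)" by (intro ennreal_leI) (simp add: W_def)
    qed
    finally show ?thesis .
  qed
  then show "\<forall>\<^sub>F n in sequentially. y < (INF v\<in>Pi\<^sub>E I (S n). ennreal (g v))"
    by (auto simp: eventually_sequentially)
qed

lemma sum_PiE_select:
  fixes a :: "('i \<Rightarrow> 'j) \<Rightarrow> ennreal"
  assumes I: "finite I" and T: "\<And>i. i \<in> I \<Longrightarrow> finite (T i)" and v: "\<And>i. i \<in> I \<Longrightarrow> v i \<in> T i"
  shows "(\<Sum>j\<in>Pi\<^sub>E I T. (\<Prod>i\<in>I. if v i = j i then 1 else 0) * a j) = a (restrict v I)"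
proof -
  have "(\<Prod>i\<in>I. if v i = j i then 1 else 0) * a j = (if j = restrict v I then a j else 0)"
    if j: "j \<in> Pi\<^sub>E I T" for j
  proof (cases "\<forall>i\<in>I. v i = j i")
    case True
    then have "j = restrict v I" using j by (auto simp: fun_eq_iff PiE_iff extensional_def)
    then show ?thesis by simp
  next
    case False
    then have "j \<noteq> restrict v I" by auto
    moreover have "(\<Prod>i\<in>I. if v i = j i then 1 else 0 :: ennreal) = 0"
      using False I by auto
    ultimately show ?thesis by simp
  qed
  then have "(\<Sum>j\<in>Pi\<^sub>E I T. (\<Prod>i\<in>I. if v i = j i then 1 else 0) * a j) =
      (\<Sum>j\<in>Pi\<^sub>E I T. if j = restrict v I then a j else 0)"
    by (intro sum.cong refl)
  also have "\<dots> = a (restrict v I)"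
    using finite_PiE[OF I T] v by (subst sum.delta) auto
  finally show ?thesis .
qed

lemma AE_pair_snd:
  assumes "sigma_finite_measure N" "AE y in N. R y"
  shows "AE x in M \<Otimes>\<^sub>M N. R (snd x)"
proof -
  interpret N: sigma_finite_measure N by fact
  obtain A where A: "{y \<in> space N. \<not> R y} \<subseteq> A" "emeasure N A = 0" "A \<in> sets N"
    using assms(2) by (rule AE_E)
  have "emeasure (M \<Otimes>\<^sub>M N) (space M \<times> A) = 0"
    using A by (simp add: N.emeasure_pair_measure_Times)
  then show ?thesis
    using A by (intro AE_I[of _ _ "space M \<times> A"]) (auto simp: space_pair_measure)
qed

lemma (in prob_space) exists_le_of_nn_integral_le:
  assumes g[measurable]: "g \<in> borel_measurable M" and le: "(\<integral>\<^sup>+x. g x \<partial>M) \<le> V"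
  shows "\<exists>x\<in>space M. g x \<le> V"
proof (rule ccontr)
  assume "\<not> ?thesis"
  then have gt: "\<And>x. x \<in> space M \<Longrightarrow> V < g x" by (meson not_le)
  obtain x where "x \<in> space M" using not_empty by blast
  from gt[OF this] have "V \<noteq> \<infinity>" by auto
  have "(\<integral>\<^sup>+x. V \<partial>M) < (\<integral>\<^sup>+x. g x \<partial>M)"
  proof (rule nn_integral_less)
    show "(\<integral>\<^sup>+x. V \<partial>M) \<noteq> \<infinity>" using \<open>V \<noteq> \<infinity>\<close> by (simp add: emeasure_space_1)
    show "AE x in M. V \<le> g x" using gt by (intro AE_I2) (simp add: less_imp_le)
    show "\<not> (AE x in M. g x \<le> V)"
    proof
      assume "AE x in M. g x \<le> V"
      then have "AE x in M. False" using AE_space by eventually_elim (use gt in \<open>auto simp: not_le[symmetric]\<close>)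
      then show False by simp
    qed
  qed auto
  with le show False by (simp add: emeasure_space_1)
qed

section \<open>Deterministic policies below the limit of the costs\<close>

text \<open>
  The lower semicontinuity and the derandomisation step.  For each level \<open>k\<close> the function \<open>a k j\<close> is
  the infimum of the reduced cost over the product cell with indices \<open>j\<close>, and \<open>\<nu> k n j\<close>, \<open>\<nu>' k j\<close> are
  the reference measure weighted with the probability that the actions fall into this product cell,
  under \<open>\<gamma> n\<close> and in the limit respectively.
\<close>

lemma (in reduced_team) exists_policy_le_limit:
  fixes D :: "nat \<Rightarrow> nat \<Rightarrow> 'u set" and \<gamma> :: "nat \<Rightarrow> nat \<Rightarrow> 'y \<Rightarrow> 'u"
  assumes cont: "\<And>w y. w \<in> space P \<Longrightarrow> y \<in> space (Pi\<^sub>M {1..N} Y) \<Longrightarrow>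
         continuous_map (product_topology U {1..N}) euclideanreal (reduced_cost N c f w y)"
    and sc: "\<And>i. i \<in> {1..N} \<Longrightarrow> second_countable (U i)"
    and coded: "\<And>i. i \<in> {1..N} \<Longrightarrow> coded_space (U i) (D i)"
    and \<gamma>: "\<And>n. \<gamma> n \<in> team_policies N Y U"
    and young: "\<And>i. i \<in> {1..N} \<Longrightarrow> young_limit (U i) (D i) (Q i) F (\<lambda>n. \<gamma> n i) (\<kappa> i) (p i) (G i)"
    and F: "F \<noteq> bot" and V: "((\<lambda>n. team_cost N P Y K c (\<gamma> n)) \<longlongrightarrow> V) F"
  shows "\<exists>\<gamma>'\<in>team_policies N Y U. team_cost N P Y K c \<gamma>' \<le> V"
proof -
  let ?I = "{1..N}"
  define M where "M = P \<Otimes>\<^sub>M Pi\<^sub>M ?I Q"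
  define \<Xi> where "\<Xi> = Pi\<^sub>M ?I (\<lambda>_. uniform01)"
  define BU where "BU = Pi\<^sub>M ?I (\<lambda>t. borel_of_top (U t))"
  define r where "r x u = reduced_cost N c f (fst x) (snd x) u" for x u
  interpret \<Xi>p: prob_space \<Xi>
    unfolding \<Xi>_def by (rule prob_space_PiM) (rule prob_space_uniform01)
  interpret \<Xi>f: product_sigma_finite "\<lambda>_::nat. uniform01"
    by (intro product_sigma_finite.intro prob_space_imp_sigma_finite prob_space_uniform01)
  have PQ: "prob_space (Pi\<^sub>M ?I Q)" by (rule prob_space_PiM) (rule prob_Q)
  interpret Mp: pair_prob_space P "Pi\<^sub>M ?I Q"
    using prob_P PQ by (simp add: pair_prob_space_def pair_sigma_finite_def prob_space_imp_sigma_finite)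
  have Mprob: "prob_space M" unfolding M_def by (rule Mp.prob_space_axioms)
  interpret M\<Xi>: pair_sigma_finite M \<Xi>
    using Mprob \<Xi>p.prob_space_axioms by (simp add: pair_sigma_finite_def prob_space_imp_sigma_finite)
  have spM: "fst x \<in> space P" "snd x \<in> space (Pi\<^sub>M ?I Y)" "\<And>i. i \<in> ?I \<Longrightarrow> snd x i \<in> space (Q i)"
    if "x \<in> space M" for x
  proof -
    have x: "fst x \<in> space P" "snd x \<in> space (Pi\<^sub>M ?I Q)"
      using that by (auto simp: M_def space_pair_measure)
    then show "fst x \<in> space P" "snd x \<in> space (Pi\<^sub>M ?I Y)"
      unfolding sets_eq_imp_space_eq[OF sets_PiM_Q[OF order_refl]] by auto
    show "\<And>i. i \<in> ?I \<Longrightarrow> snd x i \<in> space (Q i)" using x(2) by (auto simp: space_PiM PiE_iff)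
  qed
  have sets_M: "sets M = sets (P \<Otimes>\<^sub>M Pi\<^sub>M ?I Y)"
    unfolding M_def by (rule sets_pair_Q) simp
  have comp[measurable]: "(\<lambda>x. snd x i) \<in> measurable M (Q i)" if "i \<in> ?I" for i
    unfolding M_def using that by measurable
  have rm: "(\<lambda>(x, u). r x u) \<in> borel_measurable (M \<Otimes>\<^sub>M BU)"
    using measurable_reduced_cost
    unfolding measurable_cong_sets[OF sets_pair_measure_cong[OF sets_M refl] refl] BU_def r_def .
  have rcont: "continuous_map (product_topology U ?I) euclideanreal (r x)" if "x \<in> space M" for x
    using cont[OF spM(1,2)[OF that]] by (simp add: r_def[abs_def])
  have r0: "0 \<le> r x u" if "x \<in> space M" "u \<in> (\<Pi>\<^sub>E t\<in>?I. topspace (U t))" for x u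
    unfolding r_def using spM(1,2)[OF that(1)] that(2) by (rule reduced_cost_nonneg)
  have cost: "team_cost N P Y K c \<gamma>' = (\<integral>\<^sup>+x. ennreal (r x (actions N \<gamma>' (snd x))) \<partial>M)"
    if "\<gamma>' \<in> team_policies N Y U" for \<gamma>'
    unfolding M_def r_def by (rule team_cost_eq_reduced[OF that])
  define S where "S i k l = (SOME S. countable S \<and> S \<subseteq> cell (U i) (D i) k l \<and>
      cell (U i) (D i) k l \<subseteq> U i closure_of S)" for i k l
  have S: "countable (S i k l)" "S i k l \<subseteq> cell (U i) (D i) k l"
    "cell (U i) (D i) k l \<subseteq> U i closure_of S i k l" if i: "i \<in> ?I" for i k l
  proof -
    have "\<exists>S. countable S \<and> S \<subseteq> cell (U i) (D i) k l \<and> cell (U i) (D i) k l \<subseteq> U i closure_of S"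
      by (rule countable_dense_subset[OF sc[OF i], of "cell (U i) (D i) k l"]) (auto simp: cell_def)
    from someI_ex[OF this]
    show "countable (S i k l)" "S i k l \<subseteq> cell (U i) (D i) k l"
      "cell (U i) (D i) k l \<subseteq> U i closure_of S i k l"
      unfolding S_def by auto
  qed
  define a where "a k j x = (INF v\<in>(\<Pi>\<^sub>E i\<in>?I. S i k (j i)). ennreal (r x v))" for k j x
  have am[measurable]: "a k j \<in> borel_measurable M" for k j
    unfolding a_def[abs_def]
  proof (rule borel_measurable_INF)
    show "countable (\<Pi>\<^sub>E i\<in>?I. S i k (j i))" by (intro countable_PiE S) auto
    fix v assume v: "v \<in> (\<Pi>\<^sub>E i\<in>?I. S i k (j i))"
    have "v \<in> space BU"
      unfolding BU_def space_PiM space_borel_of_top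
    proof (rule PiE_I)
      show "v i \<in> topspace (U i)" if "i \<in> ?I" for i
        using v S(2)[OF that, of k "j i"] that by (auto simp: PiE_iff cell_def)
      show "v i = undefined" if "i \<notin> ?I" for i using v that by (rule PiE_arb)
    qed
    from measurable_Pair1[OF rm this] show "(\<lambda>x. ennreal (r x v)) \<in> borel_measurable M" by simp
  qed
  have a_restrict: "a k (restrict j ?I) = a k j" for k j
  proof -
    have "(\<Pi>\<^sub>E i\<in>?I. S i k (restrict j ?I i)) = (\<Pi>\<^sub>E i\<in>?I. S i k (j i))"
      by (intro PiE_cong) simp
    then show ?thesis by (simp only: a_def[abs_def])
  qed
  define J where "J k = (\<Pi>\<^sub>E i\<in>?I. {..<(2::nat) ^ k})" for k
  have finJ: "finite (J k)" for k unfolding J_def by (intro finite_PiE) auto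
  define B where "B n k i l = {z \<in> space (Q i). code (D i) k (\<gamma> n i z) = l}" for n k i l
  define \<nu> where "\<nu> k n j = density M (\<lambda>x. \<Prod>i\<in>?I. indicator (B n k i (j i)) (snd x i) :: ennreal)" for k n j
  define \<nu>' where "\<nu>' k j = density M (\<lambda>x. \<Prod>i\<in>?I. ennreal (p i k (j i) (snd x i)))" for k j
  have \<gamma>m: "\<gamma> n i \<in> measurable (Q i) (borel_of_top (U i))" if "i \<in> ?I" for n i
    unfolding measurable_cong_sets[OF sets_Q[OF that] refl]
    using \<gamma>[of n] that by (auto simp: team_policies_def)
  have Bm[measurable]: "B n k i l \<in> sets (Q i)" if i: "i \<in> ?I" for n k i l
  proof -
    have "code (D i) k \<in> measurable (borel_of_top (U i)) (count_space UNIV)"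
      using coded[OF i] by (intro measurable_code) (simp add: coded_space_def)
    from pred_count_space[OF measurable_compose[OF \<gamma>m[OF i] this], where R = "\<lambda>m. m = l"]
    show ?thesis unfolding B_def pred_def .
  qed
  have pm[measurable]: "p i k l \<in> borel_measurable (Q i)" if "i \<in> ?I" for i k l
    using young[OF that] by (simp add: young_limit_def)
  have lim: "((\<lambda>n. measure (\<nu> k n j) A) \<longlongrightarrow> measure (\<nu>' k j) A) F" if A: "A \<in> sets M" for k j A
    unfolding \<nu>_def \<nu>'_def M_def
  proof (rule product_setwise_limit[where h = "\<lambda>n i. indicator (B n k i (j i))" and h' = "\<lambda>i z. ennreal (p i k (j i) z)"])
    fix i assume i: "i \<in> ?I"
    show "finite_measure (density (Q i) (\<lambda>z. ennreal (p i k (j i) z)))"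
      using young[OF i] by (simp add: young_limit_def)
    fix A assume "A \<in> sets (Q i)"
    then show "((\<lambda>n. measure (density (Q i) (indicator (B n k i (j i)))) A) \<longlongrightarrow>
        measure (density (Q i) (\<lambda>z. ennreal (p i k (j i) z))) A) F"
      using young[OF i] Bm[OF i] by (simp add: young_limit_def measure_density_indicator B_def)
  qed (use F A in \<open>auto simp: M_def indicator_def\<close>)
  have \<nu>fin: "finite_measure (\<nu> k n j)" "finite_measure (\<nu>' k j)" for k n j
  proof -
    show "finite_measure (\<nu>' k j)"
      unfolding \<nu>'_def M_def
      using young by (intro finite_measure_density_prod(2)[where h = "\<lambda>i z. ennreal (p i k (j i) z)"])
        (auto simp: young_limit_def)
    show "finite_measure (\<nu> k n j)"
      unfolding \<nu>_def M_def
      by (intro finite_measure_density_prod(2)[where h = "\<lambda>i. indicator (B n k i (j i))"]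
          finite_measure_density_le_1(1)[OF prob_Q]) (auto simp: indicator_def)
  qed
  have below: "(\<Sum>j\<in>J k. \<integral>\<^sup>+x. a k j x \<partial>\<nu> k n j) \<le> team_cost N P Y K c (\<gamma> n)" for k n
  proof -
    have wm: "(\<lambda>x. \<Prod>i\<in>?I. indicator (B n k i (j i)) (snd x i) :: ennreal) \<in> borel_measurable M" for j
      by (intro borel_measurable_prod_ennreal measurable_compose[OF comp] borel_measurable_indicator Bm)
    have "(\<Sum>j\<in>J k. \<integral>\<^sup>+x. a k j x \<partial>\<nu> k n j) =
        (\<integral>\<^sup>+x. (\<Sum>j\<in>J k. (\<Prod>i\<in>?I. indicator (B n k i (j i)) (snd x i)) * a k j x) \<partial>M)"
      unfolding \<nu>_def using am wm
      by (subst nn_integral_sum) (auto simp: nn_integral_density)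
    also have "\<dots> \<le> (\<integral>\<^sup>+x. ennreal (r x (actions N (\<gamma> n) (snd x))) \<partial>M)"
    proof (rule nn_integral_mono)
      fix x assume x: "x \<in> space M"
      let ?v = "\<lambda>i. code (D i) k (\<gamma> n i (snd x i))"
      let ?u = "actions N (\<gamma> n) (snd x)"
      have "(\<Sum>j\<in>J k. (\<Prod>i\<in>?I. indicator (B n k i (j i)) (snd x i)) * a k j x) =
        (\<Sum>j\<in>J k. (\<Prod>i\<in>?I. if ?v i = j i then 1 else 0) * a k j x)"
        using spM(3)[OF x]
        by (intro sum.cong refl arg_cong2[where f = "(*)"] prod.cong) (simp add: B_def indicator_def)
      also have "\<dots> = a k (restrict ?v ?I) x"
        unfolding J_def by (rule sum_PiE_select) (auto simp: code_less)
      also have "\<dots> = a k ?v x" by (simp only: a_restrict)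
      also have "\<dots> \<le> ennreal (r x ?u)"
        unfolding a_def
      proof (rule INF_dense_PiE_le[OF rcont[OF x] S(3)])
        have u: "?u \<in> (\<Pi>\<^sub>E t\<in>?I. topspace (U t))" by (rule actions_in_PiE[OF \<gamma> spM(2)[OF x]])
        then show "0 \<le> r x ?u" by (rule r0[OF x])
        show "?u \<in> (\<Pi>\<^sub>E i\<in>?I. cell (U i) (D i) k (?v i))"
          using u by (auto simp: cell_def PiE_iff actions_def)
      qed auto
      finally show "(\<Sum>j\<in>J k. (\<Prod>i\<in>?I. indicator (B n k i (j i)) (snd x i)) * a k j x) \<le> ennreal (r x ?u)" .
    qed
    also have "\<dots> = team_cost N P Y K c (\<gamma> n)" by (rule cost[OF \<gamma>, symmetric])
    finally show ?thesis .
  qed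
  have bound: "(\<Sum>j\<in>J k. \<integral>\<^sup>+x. a k j x \<partial>\<nu>' k j) \<le> V" for k
    by (rule setwise_limit_nn_integral_le[where \<nu> = "\<nu> k" and M = M, OF finJ _ _ _ _ _ F _ below V])
       (use \<nu>fin lim am in \<open>auto simp: \<nu>_def \<nu>'_def\<close>)
  define u where "u x \<xi> = (\<lambda>i\<in>?I. G i (snd x i) (\<xi> i))" for x :: "'w \<times> (nat \<Rightarrow> 'y)" and \<xi>
  \<comment> \<open>Almost surely only the product cell sampled by \<open>\<xi>\<close> contributes to this sum.\<close>
  define \<Phi> where "\<Phi> k x \<xi> = (\<Sum>j\<in>J k. (\<Prod>i\<in>?I. if \<kappa> i k (snd x i) (\<xi> i) = j i then 1 else 0) * a k j x)"
    for k and x :: "'w \<times> (nat \<Rightarrow> 'y)" and \<xi> :: "nat \<Rightarrow> real"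
  have pair: "(\<lambda>x. (snd (fst x) i, snd x i)) \<in> measurable (M \<Otimes>\<^sub>M \<Xi>) (Q i \<Otimes>\<^sub>M uniform01)" if "i \<in> ?I" for i
  proof -
    have "(\<lambda>\<xi>. \<xi> i) \<in> measurable \<Xi> uniform01" unfolding \<Xi>_def using that by measurable
    with comp[OF that] show ?thesis by measurable
  qed
  have um: "(\<lambda>x. u (fst x) (snd x)) \<in> measurable (M \<Otimes>\<^sub>M \<Xi>) BU"
    unfolding u_def BU_def
  proof (rule measurable_restrict)
    fix i assume i: "i \<in> ?I"
    have "(\<lambda>(z, \<xi>). G i z \<xi>) \<in> measurable (Q i \<Otimes>\<^sub>M uniform01) (borel_of_top (U i))"
      using young[OF i] by (simp add: young_limit_def)
    from measurable_compose[OF pair[OF i] this]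
    show "(\<lambda>x. G i (snd (fst x) i) (snd x i)) \<in> measurable (M \<Otimes>\<^sub>M \<Xi>) (borel_of_top (U i))" by simp
  qed
  have \<kappa>m: "(\<lambda>x. if \<kappa> i k (snd (fst x) i) (snd x i) = l then 1 else 0 :: ennreal) \<in> borel_measurable (M \<Otimes>\<^sub>M \<Xi>)"
    if i: "i \<in> ?I" for i k l
  proof -
    have "(\<lambda>(z, \<xi>). \<kappa> i k z \<xi>) \<in> measurable (Q i \<Otimes>\<^sub>M uniform01) (count_space UNIV)"
      using young[OF i] by (simp add: young_limit_def)
    from measurable_compose[OF measurable_compose[OF pair[OF i] this], of "\<lambda>m. if m = l then 1 else 0" borel]
    show ?thesis by simp
  qed
  have \<Phi>m: "(\<lambda>(x, \<xi>). \<Phi> k x \<xi>) \<in> borel_measurable (M \<Otimes>\<^sub>M \<Xi>)" for k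
    unfolding \<Phi>_def case_prod_unfold
    by (intro borel_measurable_sum borel_measurable_times_ennreal borel_measurable_prod_ennreal \<kappa>m
        measurable_compose[OF measurable_fst am])
  have \<Phi>x: "(\<lambda>\<xi>. \<Phi> k x \<xi>) \<in> borel_measurable \<Xi>" if "x \<in> space M" for k x
    using measurable_Pair2[OF \<Phi>m that] by simp
  have AE_M: "AE x in M. \<forall>i\<in>?I. R i (snd x i)" if "\<And>i. i \<in> ?I \<Longrightarrow> AE z in Q i. R i z" for R
  proof (rule AE_finite_allI)
    fix i assume i: "i \<in> ?I"
    have "AE y in Pi\<^sub>M ?I Q. R i (y i)" using that[OF i] i by (intro AE_PiM_component prob_Q)
    then show "AE x in M. R i (snd x i)"
      unfolding M_def by (rule AE_pair_snd[OF prob_space_imp_sigma_finite[OF PQ]])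
  qed simp
  have \<Phi>int: "(\<integral>\<^sup>+x. \<integral>\<^sup>+\<xi>. \<Phi> k x \<xi> \<partial>\<Xi> \<partial>M) \<le> V" for k
  proof -
    have AE1: "AE x in M. \<forall>i\<in>?I. \<forall>k. \<forall>l<2 ^ k.
       emeasure uniform01 {\<xi> \<in> space uniform01. \<kappa> i k (snd x i) \<xi> = l} = ennreal (p i k l (snd x i))"
      using young by (intro AE_M) (simp add: young_limit_def)
    have "(\<integral>\<^sup>+x. \<integral>\<^sup>+\<xi>. \<Phi> k x \<xi> \<partial>\<Xi> \<partial>M) =
        (\<integral>\<^sup>+x. (\<Sum>j\<in>J k. (\<Prod>i\<in>?I. ennreal (p i k (j i) (snd x i))) * a k j x) \<partial>M)"
    proof (rule nn_integral_cong_AE)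
      show "AE x in M. (\<integral>\<^sup>+\<xi>. \<Phi> k x \<xi> \<partial>\<Xi>) =
          (\<Sum>j\<in>J k. (\<Prod>i\<in>?I. ennreal (p i k (j i) (snd x i))) * a k j x)"
        using AE1 AE_space
      proof eventually_elim
        case (elim x)
        have km: "(\<lambda>\<xi>. if \<kappa> i k (snd x i) \<xi> = l then 1 else 0 :: ennreal) \<in> borel_measurable uniform01"
          if i: "i \<in> ?I" for i l
        proof -
          have "(\<lambda>(z, \<xi>). \<kappa> i k z \<xi>) \<in> measurable (Q i \<Otimes>\<^sub>M uniform01) (count_space UNIV)"
            using young[OF i] by (simp add: young_limit_def)
          from measurable_compose[OF measurable_Pair2[OF this spM(3)[OF elim(2) i]], of "\<lambda>m. if m = l then 1 else 0" borel]
          show ?thesis by simp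
        qed
        have km\<Xi>: "(\<lambda>\<xi>. \<Prod>i\<in>?I. if \<kappa> i k (snd x i) (\<xi> i) = j i then 1 else 0 :: ennreal) \<in> borel_measurable \<Xi>" for j
          unfolding \<Xi>_def
        proof (rule borel_measurable_prod_ennreal)
          fix i assume i: "i \<in> ?I"
          then have "(\<lambda>\<xi>. \<xi> i) \<in> measurable (Pi\<^sub>M ?I (\<lambda>_. uniform01)) uniform01" by measurable
          from measurable_compose[OF this km[OF i]]
          show "(\<lambda>\<xi>. if \<kappa> i k (snd x i) (\<xi> i) = j i then 1 else 0 :: ennreal)
              \<in> borel_measurable (Pi\<^sub>M ?I (\<lambda>_. uniform01))" .
        qed
        have "(\<integral>\<^sup>+\<xi>. \<Phi> k x \<xi> \<partial>\<Xi>) =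
            (\<Sum>j\<in>J k. (\<integral>\<^sup>+\<xi>. (\<Prod>i\<in>?I. if \<kappa> i k (snd x i) (\<xi> i) = j i then 1 else 0) \<partial>\<Xi>) * a k j x)"
          unfolding \<Phi>_def using km\<Xi> by (subst nn_integral_sum) (auto simp: nn_integral_multc)
        also have "\<dots> = (\<Sum>j\<in>J k. (\<Prod>i\<in>?I. ennreal (p i k (j i) (snd x i))) * a k j x)"
        proof (intro sum.cong refl arg_cong2[where f = "(*)"])
          fix j assume j: "j \<in> J k"
          have "(\<integral>\<^sup>+\<xi>. (\<Prod>i\<in>?I. if \<kappa> i k (snd x i) (\<xi> i) = j i then 1 else 0 :: ennreal) \<partial>\<Xi>) =
            (\<Prod>i\<in>?I. \<integral>\<^sup>+\<xi>. (if \<kappa> i k (snd x i) \<xi> = j i then 1 else 0) \<partial>uniform01)"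
            unfolding \<Xi>_def
            by (rule \<Xi>f.product_nn_integral_prod[where f = "\<lambda>i \<xi>. if \<kappa> i k (snd x i) \<xi> = j i then 1 else 0"])
               (use km in auto)
          also have "\<dots> = (\<Prod>i\<in>?I. ennreal (p i k (j i) (snd x i)))"
          proof (rule prod.cong[OF refl])
            fix i assume i: "i \<in> ?I"
            let ?E = "{\<xi> \<in> space uniform01. \<kappa> i k (snd x i) \<xi> = j i}"
            have "(\<lambda>(z, \<xi>). \<kappa> i k z \<xi>) \<in> measurable (Q i \<Otimes>\<^sub>M uniform01) (count_space UNIV)"
              using young[OF i] by (simp add: young_limit_def)
            from pred_count_space[OF measurable_Pair2[OF this spM(3)[OF elim(2) i]], where R = "\<lambda>m. m = j i"]
            have E: "?E \<in> sets uniform01" by (simp add: pred_def)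
            have "(\<integral>\<^sup>+\<xi>. (if \<kappa> i k (snd x i) \<xi> = j i then 1 else 0) \<partial>uniform01) = (\<integral>\<^sup>+\<xi>. indicator ?E \<xi> \<partial>uniform01)"
              by (intro nn_integral_cong) (simp add: indicator_def)
            also have "\<dots> = ennreal (p i k (j i) (snd x i))"
              using E elim(1) i j by (simp add: J_def PiE_iff)
            finally show "(\<integral>\<^sup>+\<xi>. (if \<kappa> i k (snd x i) \<xi> = j i then 1 else 0) \<partial>uniform01) =
              ennreal (p i k (j i) (snd x i))" .
          qed
          finally show "(\<integral>\<^sup>+\<xi>. (\<Prod>i\<in>?I. if \<kappa> i k (snd x i) (\<xi> i) = j i then 1 else 0 :: ennreal) \<partial>\<Xi>) =
              (\<Prod>i\<in>?I. ennreal (p i k (j i) (snd x i)))" .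
        qed
        finally show ?case .
      qed
    qed
    also have "\<dots> = (\<Sum>j\<in>J k. \<integral>\<^sup>+x. a k j x \<partial>\<nu>' k j)"
    proof -
      have "(\<lambda>x. \<Prod>i\<in>?I. ennreal (p i k (j i) (snd x i))) \<in> borel_measurable M" for j
        by (intro borel_measurable_prod_ennreal measurable_compose[OF _ measurable_ennreal] measurable_compose[OF comp] pm)
      then show ?thesis
        unfolding \<nu>'_def using am by (subst nn_integral_sum) (auto simp: nn_integral_density)
    qed
    also have "\<dots> \<le> V" by (rule bound)
    finally show ?thesis .
  qed
  have AE2: "AE x in M. AE \<xi> in \<Xi>. ennreal (r x (u x \<xi>)) \<le> liminf (\<lambda>k. \<Phi> k x \<xi>)"
  proof -
    have "AE x in M. \<forall>i\<in>?I. AE \<xi> in uniform01. branch (U i) (D i) (\<lambda>k. \<kappa> i k (snd x i) \<xi>) \<and>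
       branch_converges (U i) (D i) (\<lambda>k. \<kappa> i k (snd x i) \<xi>) (G i (snd x i) \<xi>) \<and> (\<forall>k. \<kappa> i k (snd x i) \<xi> < 2 ^ k)"
      using young by (intro AE_M) (simp add: young_limit_def)
    then show ?thesis
      using AE_space
    proof eventually_elim
      case (elim x)
      have "AE \<xi> in \<Xi>. \<forall>i\<in>?I. branch (U i) (D i) (\<lambda>k. \<kappa> i k (snd x i) (\<xi> i)) \<and>
         branch_converges (U i) (D i) (\<lambda>k. \<kappa> i k (snd x i) (\<xi> i)) (G i (snd x i) (\<xi> i)) \<and>
         (\<forall>k. \<kappa> i k (snd x i) (\<xi> i) < 2 ^ k)"
      proof (rule AE_finite_allI)
        fix i assume i: "i \<in> ?I"
        show "AE \<xi> in \<Xi>. branch (U i) (D i) (\<lambda>k. \<kappa> i k (snd x i) (\<xi> i)) \<and>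
         branch_converges (U i) (D i) (\<lambda>k. \<kappa> i k (snd x i) (\<xi> i)) (G i (snd x i) (\<xi> i)) \<and>
         (\<forall>k. \<kappa> i k (snd x i) (\<xi> i) < 2 ^ k)"
          unfolding \<Xi>_def using bspec[OF elim(1) i]
          by (rule AE_PiM_component[where M = "\<lambda>_. uniform01", OF prob_space_uniform01 i])
      qed simp
      then show ?case
      proof eventually_elim
        fix \<xi> assume \<xi>: "\<forall>i\<in>?I. branch (U i) (D i) (\<lambda>k. \<kappa> i k (snd x i) (\<xi> i)) \<and>
           branch_converges (U i) (D i) (\<lambda>k. \<kappa> i k (snd x i) (\<xi> i)) (G i (snd x i) (\<xi> i)) \<and>
           (\<forall>k. \<kappa> i k (snd x i) (\<xi> i) < 2 ^ k)"
        have "\<Phi> k x \<xi> = a k (\<lambda>i. \<kappa> i k (snd x i) (\<xi> i)) x" for k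
        proof -
          have "\<Phi> k x \<xi> = a k (restrict (\<lambda>i. \<kappa> i k (snd x i) (\<xi> i)) ?I) x"
            unfolding \<Phi>_def J_def by (rule sum_PiE_select) (use \<xi> in auto)
          then show ?thesis by (simp only: a_restrict)
        qed
        moreover have "ennreal (r x (u x \<xi>)) \<le> liminf (\<lambda>k. a k (\<lambda>i. \<kappa> i k (snd x i) (\<xi> i)) x)"
          unfolding a_def
        proof (rule le_liminf_INF_cells[OF rcont[OF elim(2)]])
          fix i assume i: "i \<in> ?I"
          show "branch (U i) (D i) (\<lambda>k. \<kappa> i k (snd x i) (\<xi> i))"
            "branch_converges (U i) (D i) (\<lambda>k. \<kappa> i k (snd x i) (\<xi> i)) (u x \<xi> i)"
            using \<xi> i by (simp_all only: u_def restrict_apply if_True ball_simps)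
          show "S i k (\<kappa> i k (snd x i) (\<xi> i)) \<subseteq> cell (U i) (D i) k (\<kappa> i k (snd x i) (\<xi> i))" for k
            by (rule S(2)[OF i])
        qed (auto simp: u_def)
        ultimately show "ennreal (r x (u x \<xi>)) \<le> liminf (\<lambda>k. \<Phi> k x \<xi>)" by simp
      qed
    qed
  qed
  have ru: "(\<lambda>(x, \<xi>). ennreal (r x (u x \<xi>))) \<in> borel_measurable (M \<Otimes>\<^sub>M \<Xi>)"
  proof -
    have "(\<lambda>x. (fst x, u (fst x) (snd x))) \<in> measurable (M \<Otimes>\<^sub>M \<Xi>) (M \<Otimes>\<^sub>M BU)"
      using um by (intro measurable_Pair) auto
    from measurable_compose[OF measurable_compose[OF this rm] measurable_ennreal]
    show ?thesis by (simp add: case_prod_unfold)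
  qed
  \<comment> \<open>Fatou for \<open>\<xi>\<close> and for \<open>x\<close>, after exchanging the order of integration.\<close>
  have "(\<integral>\<^sup>+\<xi>. \<integral>\<^sup>+x. ennreal (r x (u x \<xi>)) \<partial>M \<partial>\<Xi>) = (\<integral>\<^sup>+x. \<integral>\<^sup>+\<xi>. ennreal (r x (u x \<xi>)) \<partial>\<Xi> \<partial>M)"
    by (rule M\<Xi>.Fubini'[OF ru])
  also have "\<dots> \<le> (\<integral>\<^sup>+x. \<integral>\<^sup>+\<xi>. liminf (\<lambda>k. \<Phi> k x \<xi>) \<partial>\<Xi> \<partial>M)"
    using AE2 by (intro nn_integral_mono_AE) (auto elim!: eventually_mono intro!: nn_integral_mono_AE)
  also have "\<dots> \<le> (\<integral>\<^sup>+x. liminf (\<lambda>k. \<integral>\<^sup>+\<xi>. \<Phi> k x \<xi> \<partial>\<Xi>) \<partial>M)"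
    by (intro nn_integral_mono nn_integral_liminf \<Phi>x)
  also have "\<dots> \<le> liminf (\<lambda>k. \<integral>\<^sup>+x. \<integral>\<^sup>+\<xi>. \<Phi> k x \<xi> \<partial>\<Xi> \<partial>M)"
    by (intro nn_integral_liminf \<Xi>p.borel_measurable_nn_integral \<Phi>m)
  also have "\<dots> \<le> V"
    by (rule order_trans[OF Liminf_mono[where g = "\<lambda>_. V"]]) (use \<Phi>int in \<open>auto simp: Liminf_const\<close>)
  finally have int: "(\<integral>\<^sup>+\<xi>. \<integral>\<^sup>+x. ennreal (r x (u x \<xi>)) \<partial>M \<partial>\<Xi>) \<le> V" .
  have "(\<lambda>(\<xi>, x). ennreal (r x (u x \<xi>))) \<in> borel_measurable (\<Xi> \<Otimes>\<^sub>M M)"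
    using measurable_pair_swap[OF ru] by simp
  then have "(\<lambda>\<xi>. \<integral>\<^sup>+x. ennreal (r x (u x \<xi>)) \<partial>M) \<in> borel_measurable \<Xi>"
    by (rule sigma_finite_measure.borel_measurable_nn_integral[OF prob_space_imp_sigma_finite[OF Mprob]])
  from \<Xi>p.exists_le_of_nn_integral_le[OF this int]
  obtain \<xi> where \<xi>: "\<xi> \<in> space \<Xi>" "(\<integral>\<^sup>+x. ennreal (r x (u x \<xi>)) \<partial>M) \<le> V" by blast
  define \<gamma>' where "\<gamma>' i z = G i z (\<xi> i)" for i z
  have \<gamma>': "\<gamma>' \<in> team_policies N Y U"
    unfolding team_policies_def
  proof (rule Pi_I)
    fix i assume i: "i \<in> ?I"
    have "(\<lambda>(z, \<xi>). G i z \<xi>) \<in> measurable (Q i \<Otimes>\<^sub>M uniform01) (borel_of_top (U i))"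
      using young[OF i] by (simp add: young_limit_def)
    moreover have "\<xi> i \<in> space uniform01" using \<xi>(1) i by (auto simp: \<Xi>_def space_PiM)
    ultimately have "(\<lambda>z. G i z (\<xi> i)) \<in> measurable (Q i) (borel_of_top (U i))"
      by (auto dest: measurable_Pair1)
    then show "\<gamma>' i \<in> measurable (Y i) (borel_of_top (U i))"
      unfolding measurable_cong_sets[OF sets_Q[OF i] refl] \<gamma>'_def[abs_def] .
  qed
  have "actions N \<gamma>' (snd x) = u x \<xi>" for x
    by (simp add: actions_def u_def \<gamma>'_def)
  then have "team_cost N P Y K c \<gamma>' \<le> V"
    using \<xi>(2) cost[OF \<gamma>'] by simp
  with \<gamma>' show ?thesis by blast
qed

section \<open>Tightness from the moment bound and the existence of optimal policies\<close>

text \<open>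
  A Markov bound \<open>a r * E r n \<le> m\<close> with \<open>a r \<longlonglongrightarrow> \<infinity>\<close>, in a form that avoids the
  division by \<open>a r\<close>, which may be zero or infinite.
\<close>

lemma tail_tendsto_0:
  fixes a :: "nat \<Rightarrow> ennreal" and E :: "nat \<Rightarrow> 'n \<Rightarrow> ennreal" and m :: ennreal
  assumes a: "a \<longlonglongrightarrow> \<infinity>" and m: "m < \<infinity>" and le: "\<And>r n. a r * E r n \<le> m"
  shows "(\<lambda>r. SUP n. E r n) \<longlonglongrightarrow> 0"
proof (rule order_tendstoI)
  fix x :: ennreal assume "0 < x"
  then obtain y where y: "0 < y" "y < x" using dense by blast
  then obtain \<epsilon> where \<epsilon>: "y = ennreal \<epsilon>" "0 < \<epsilon>" by (cases y) auto
  obtain \<mu> where \<mu>: "m = ennreal \<mu>" "0 \<le> \<mu>" using m by (cases m) auto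
  have "\<forall>\<^sub>F r in sequentially. ennreal ((\<mu> + 1) / \<epsilon>) < a r"
    by (rule order_tendstoD(1)[OF a]) simp
  then show "\<forall>\<^sub>F r in sequentially. (SUP n. E r n) < x"
  proof eventually_elim
    case (elim r)
    have "E r n \<le> y" for n
    proof (rule ccontr)
      assume "\<not> E r n \<le> y"
      then have "ennreal ((\<mu> + 1) / \<epsilon>) * y \<le> a r * E r n"
        using elim by (intro mult_mono) auto
      also have "\<dots> \<le> m" by (rule le)
      also have "ennreal ((\<mu> + 1) / \<epsilon>) * y = ennreal ((\<mu> + 1) / \<epsilon> * \<epsilon>)"
        unfolding \<epsilon>(1) using \<epsilon>(2) \<mu>(2) by (intro ennreal_mult[symmetric]) auto
      also have "(\<mu> + 1) / \<epsilon> * \<epsilon> = \<mu> + 1" using \<epsilon>(2) by simp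
      finally show False using \<mu> by (simp add: ennreal_le_iff)
    qed
    then have "(SUP n. E r n) \<le> y" by (rule SUP_least)
    then show ?case using y(2) by (rule le_less_trans)
  qed
qed simp

lemma moment_tail_bound:
  fixes \<phi> :: "'u \<Rightarrow> real"
  assumes \<gamma>: "\<gamma> \<in> measurable Q (borel_of_top X)" and C: "closedin X C"
    and moment: "(\<integral>\<^sup>+z. ennreal (\<phi> (\<gamma> z)) \<partial>Q) \<le> m"
  shows "(INF u\<in>topspace X - C. ennreal (\<phi> u)) * emeasure Q {z \<in> space Q. \<gamma> z \<notin> C} \<le> m"
proof -
  let ?E = "{z \<in> space Q. \<gamma> z \<notin> C}" and ?a = "INF u\<in>topspace X - C. ennreal (\<phi> u)"
  have "?E = \<gamma> -` (topspace X - C) \<inter> space Q"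
    using measurable_space[OF \<gamma>] by auto
  moreover have "topspace X - C \<in> sets (borel_of_top X)"
    using C by (intro borel_of_top_open) (simp add: closedin_def)
  ultimately have E: "?E \<in> sets Q" using measurable_sets[OF \<gamma>] by simp
  have "?a * emeasure Q ?E = (\<integral>\<^sup>+z. ?a * indicator ?E z \<partial>Q)"
    using E by (simp add: nn_integral_cmult_indicator)
  also have "\<dots> \<le> (\<integral>\<^sup>+z. ennreal (\<phi> (\<gamma> z)) \<partial>Q)"
  proof (rule nn_integral_mono)
    fix z assume "z \<in> space Q"
    then have "?a \<le> ennreal (\<phi> (\<gamma> z))" if "\<gamma> z \<notin> C"
      using measurable_space[OF \<gamma>] that by (intro INF_lower) auto
    then show "?a * indicator ?E z \<le> ennreal (\<phi> (\<gamma> z))" by (auto simp: indicator_def)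
  qed
  also note moment
  finally show ?thesis .
qed

lemma team_policies_nonempty:
  fixes Y :: "nat \<Rightarrow> 'y measure" and U :: "nat \<Rightarrow> 'u topology"
  assumes "\<And>i. i \<in> {1..N} \<Longrightarrow> topspace (U i) \<noteq> {}"
  shows "team_policies N Y U \<noteq> {}"
proof -
  define \<gamma> where "\<gamma> i z = (SOME u. u \<in> topspace (U i))" for i :: nat and z :: 'y
  have "\<gamma> \<in> team_policies N Y U"
    unfolding team_policies_def
  proof (rule Pi_I)
    fix i assume "i \<in> {1..N}"
    then have "(SOME u. u \<in> topspace (U i)) \<in> topspace (U i)" using assms some_in_eq by blast
    then show "\<gamma> i \<in> measurable (Y i) (borel_of_top (U i))"
      unfolding \<gamma>_def[abs_def] by (intro measurable_const) simp
  qed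
  then show ?thesis by blast
qed

theorem theorem5p2:
  fixes N :: nat
    and P :: "'w measure"
    and Y :: "nat \<Rightarrow> 'y measure"
    and U :: "nat \<Rightarrow> 'u topology"
    and K :: "nat \<Rightarrow> ('w, 'y, 'u) history \<Rightarrow> 'y measure"
    and c :: "'w \<Rightarrow> (nat \<Rightarrow> 'u) \<Rightarrow> real"
    and Q :: "nat \<Rightarrow> 'y measure"
    and f :: "nat \<Rightarrow> 'y \<Rightarrow> ('w, 'y, 'u) history \<Rightarrow> real"
    and C :: "nat \<Rightarrow> nat \<Rightarrow> 'u set"
    and \<phi> :: "nat \<Rightarrow> 'u \<Rightarrow> real"
    and m :: ennreal
  assumes team: "sequential_team N P Y U K c"
    and reduction: "independent_reduction N P Y U K Q f"
    and cost_continuous: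
      "\<And>w y. w \<in> space P \<Longrightarrow> y \<in> space (Pi\<^sub>M {1..N} Y) \<Longrightarrow>
         continuous_map (product_topology U {1..N}) euclideanreal (reduced_cost N c f w y)"
    and compact: "\<And>i n. i \<in> {1..N} \<Longrightarrow> compactin (U i) (C i n)"
    and increasing: "\<And>i. i \<in> {1..N} \<Longrightarrow> incseq (C i)"
    and exhaust: "\<And>i. i \<in> {1..N} \<Longrightarrow> topspace (U i) = (\<Union>n. C i n)"
    and phi_lsc: "\<And>i. i \<in> {1..N} \<Longrightarrow> lower_semicontinuous_on_top (U i) (\<phi> i)"
    and phi_nonneg: "\<And>i u. i \<in> {1..N} \<Longrightarrow> u \<in> topspace (U i) \<Longrightarrow> 0 \<le> \<phi> i u"
    and phi_coercive:
      "\<And>i. i \<in> {1..N} \<Longrightarrow>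
         (\<lambda>n. INF u\<in>topspace (U i) - C i n. ennreal (\<phi> i u)) \<longlonglongrightarrow> \<infinity>"
    and m_finite: "m < \<infinity>"
    and no_loss:
      "(INF \<gamma>\<in>moment_policies N Y U Q \<phi> m. team_cost N P Y K c \<gamma>) =
       (INF \<gamma>\<in>team_policies N Y U. team_cost N P Y K c \<gamma>)"
  shows "\<exists>\<gamma>. optimal_policy N P Y U K c \<gamma>"
proof -
  let ?J = "team_cost N P Y K c"
  define V where "V = (INF \<gamma>\<in>team_policies N Y U. ?J \<gamma>)"
  have optimal: "\<exists>\<gamma>. optimal_policy N P Y U K c \<gamma>"
    if "\<gamma> \<in> team_policies N Y U" "?J \<gamma> \<le> V" for \<gamma>
    using that INF_lower[of \<gamma> "team_policies N Y U" ?J]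
    by (auto simp: optimal_policy_def V_def intro!: exI[of _ \<gamma>])
  have std: "standard_borel_top (U i)" "topspace (U i) \<noteq> {}" if "i \<in> {1..N}" for i
    using team that by (auto simp: sequential_team_def)
  show ?thesis
  \<comment> \<open>If no policy satisfies the moment bound, both infima are infinite and every policy is optimal.\<close>
  proof (cases "moment_policies N Y U Q \<phi> m = {}")
    case True
    then have "V = \<infinity>" using no_loss by (simp add: V_def)
    moreover obtain \<gamma> where "\<gamma> \<in> team_policies N Y U"
      using team_policies_nonempty[of N U Y] std(2) by blast
    ultimately show ?thesis using optimal by simp
  next
    case False
    then obtain v where v: "decseq v" "range v \<subseteq> ?J ` moment_policies N Y U Q \<phi> m"
      "Inf (?J ` moment_policies N Y U Q \<phi> m) = (INF n::nat. v n)"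
      using ennreal_Inf_countable_INF[of "?J ` moment_policies N Y U Q \<phi> m"] by auto
    have "\<forall>n. \<exists>\<gamma>. \<gamma> \<in> moment_policies N Y U Q \<phi> m \<and> v n = ?J \<gamma>" using v(2) by blast
    then obtain \<gamma> where \<gamma>: "\<And>n. \<gamma> n \<in> moment_policies N Y U Q \<phi> m" "\<And>n. v n = ?J (\<gamma> n)"
      by metis
    have \<gamma>_team: "\<gamma> n \<in> team_policies N Y U" for n
      using \<gamma>(1)[of n] by (simp add: moment_policies_def)
    have "v \<longlonglongrightarrow> V"
      using LIMSEQ_INF[OF v(1)] v(3) no_loss by (simp add: V_def)
    moreover have "v = (\<lambda>n. ?J (\<gamma> n))" using \<gamma>(2) by (rule ext)
    ultimately have lim_J: "(\<lambda>n. ?J (\<gamma> n)) \<longlonglongrightarrow> V" by simp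
    \<comment> \<open>Nothing is known about \<open>Q i\<close> for \<open>i\<close> outside \<open>{1..N}\<close>, so it is replaced there by a point mass.\<close>
    define R where "R i = (if i \<in> {1..N} then Q i else return (count_space UNIV) undefined)" for i
    have R: "R i = Q i" if "i \<in> {1..N}" for i using that by (simp add: R_def)
    interpret reduced_team N P Y U K c R f
    proof (rule reduced_team.intro)
      show "independent_reduction N P Y U K R f"
        using reduction R unfolding independent_reduction_def by (metis (no_types, lifting))
      show "prob_space (R i)" for i
        using reduction by (auto simp: R_def independent_reduction_def intro: prob_space_return)
    qed (rule team)
    have \<gamma>_meas: "\<gamma> n i \<in> measurable (R i) (borel_of_top (U i))" if i: "i \<in> {1..N}" for n i
      unfolding measurable_cong_sets[OF sets_Q[OF i] refl]
      using \<gamma>_team[of n] i by (auto simp: team_policies_def)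
    have "\<forall>i\<in>{1..N}. \<exists>D. coded_space (U i) D \<and> (\<forall>r. D (2 * r + 1) = C i r)"
    proof
      fix i assume i: "i \<in> {1..N}"
      note s = standard_borel_top_countability_separation[OF std(1)[OF i]]
      show "\<exists>D. coded_space (U i) D \<and> (\<forall>r. D (2 * r + 1) = C i r)"
        by (rule coded_space_exists[OF s, of "C i"]) (use compact[OF i] in blast)+
    qed
    then obtain D where D: "\<And>i. i \<in> {1..N} \<Longrightarrow> coded_space (U i) (D i)"
      "\<And>i r. i \<in> {1..N} \<Longrightarrow> D i (2 * r + 1) = C i r"
      by metis
    define T where "T n = (\<lambda>(i, k, j, A). measure (R i) (A \<inter> {z \<in> space (R i). code (D i) k (\<gamma> n i z) = j}))" for n
    have T01: "T n x \<in> {0..1}" for n x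
      using prob_space.prob_le_1[OF prob_Q] by (cases x) (simp add: T_def)
    obtain F where F: "F \<le> sequentially" "F \<noteq> bot" "\<And>x. \<exists>l. ((\<lambda>n. T n x) \<longlongrightarrow> l) F"
      by (rule exists_convergent_subfilter[of T, OF T01]) (rule that)
    have "\<forall>i\<in>{1..N}. \<exists>\<kappa> p G. young_limit (U i) (D i) (R i) F (\<lambda>n. \<gamma> n i) \<kappa> p G"
    proof
      fix i assume i: "i \<in> {1..N}"
      define e where "e r = (SUP n. emeasure (R i) {z \<in> space (R i). \<gamma> n i z \<notin> C i r})" for r
      have closed: "closedin (U i) (C i r)" for r
        using compact[OF i] standard_borel_top_countability_separation(3)[OF std(1)[OF i]] by (rule compactin_imp_closedin[rotated])
      obtain x0 where x0: "x0 \<in> topspace (U i)" using std(2)[OF i] by blast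
      have moment: "(\<integral>\<^sup>+z. ennreal (\<phi> i (\<gamma> n i z)) \<partial>R i) \<le> m" for n
        using \<gamma>(1)[of n] i by (simp add: moment_policies_def R)
      have e0: "e \<longlonglongrightarrow> 0"
        unfolding e_def[abs_def]
        by (rule tail_tendsto_0[OF phi_coercive[OF i] m_finite])
          (rule moment_tail_bound[OF \<gamma>_meas[OF i] closed moment])
      have conv: "\<exists>l. ((\<lambda>n. measure (R i) (A \<inter> {z \<in> space (R i). code (D i) k (\<gamma> n i z) = j})) \<longlongrightarrow> l) F" for k j A
        using F(3)[of "(i, k, j, A)"] by (simp add: T_def)
      have comp: "compactin (U i) (D i (2 * r + 1))" for r
        unfolding D(2)[OF i] by (rule compact[OF i])
      have tight: "emeasure (R i) {z \<in> space (R i). \<gamma> n i z \<notin> D i (2 * r + 1)} \<le> e r" for n r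
        unfolding D(2)[OF i] e_def by (rule SUP_upper) simp
      show "\<exists>\<kappa> p G. young_limit (U i) (D i) (R i) F (\<lambda>n. \<gamma> n i) \<kappa> p G"
        by (rule coded_space.young_limit_exists[OF D(1)[OF i] prob_Q \<gamma>_meas[OF i] F(2) conv comp tight e0 x0])
    qed
    then obtain \<kappa> p G where young:
      "\<And>i. i \<in> {1..N} \<Longrightarrow> young_limit (U i) (D i) (R i) F (\<lambda>n. \<gamma> n i) (\<kappa> i) (p i) (G i)"
      by metis
    have "\<exists>\<gamma>'\<in>team_policies N Y U. ?J \<gamma>' \<le> V"
      by (rule exists_policy_le_limit[OF cost_continuous standard_borel_top_countability_separation(1)[OF std(1)] D(1) \<gamma>_team young F(2)
            tendsto_mono[OF F(1) lim_J]])
    then show ?thesis using optimal by blast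
  qed
qed

end
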